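(* Let $k$ be a field of characteristic zero, $B$ an object of $\mathbf{IBialg}$, and $(\pi:A\to B,\boxplus,\boxminus,0)$ an abelian group object in $\mathbf{IBialg}\downarrow B$. Let $x,x'\in F(A)$ and $b,b'\in B$. Then, identifying $b\in B$ with $0(b)\in A$, $$(xb)(x'b')=\sum\Big(\big(r(b_{(1)},b'_{(1)})x\big)\big(s(b_{(2)},b'_{(2)})x'\big)\Big)\,(b_{(3)}b'_{(3)})$$ and $$(bx)(b'x')=\sum (b_{(1)}b'_{(1)})\,\Big(\big(\bar s(b_{(2)},b'_{(2)})x\big)\big(l(b_{(3)},b'_{(3)})x'\big)\Big).$$
   Context: Bialgebras are not assumed associative. All coalgebras are coassociative and cocommutative, with $\Delta(u)=\sum u_{(1)}\otimes u_{(2)}$ (iterated: $\sum u_{(1)}\otimes u_{(2)}\otimes u_{(3)}$) and counit $\epsilon$. A unital bialgebra is a coalgebra with a bilinear product and two-sided unit which are coalgebra morphisms. An irreducible unital bialgebra is a unital bialgebra $A$ whose underlying coalgebra is isomorphic to the symmetric algebra $k[V]$ (with the elements of $V$ primitive), $V=\mathrm{Prim}\,A$. $\mathbf{IBialg}$ is the category of irreducible unital bialgebras over $k$ with unital bialgebra homomorphisms. Any such $A$ has bilinear left and right divisions $\backslash,/$ uniquely determined by $\sum u_{(1)}\backslash(u_{(2)}v)=\epsilon(u)v=\sum u_{(1)}(u_{(2)}\backslash v)$ and $\sum (vu_{(1)})/u_{(2)}=\epsilon(u)v=\sum(v/u_{(1)})u_{(2)}$. The product of $\pi_1:A_1\to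 B$ and $\pi_2:A_2\to B$ in the comma category $\mathbf{IBialg}\downarrow B$ is $A_1\otimes_BA_2$, the sum of all subcoalgebras $C$ of $A_1\otimes A_2$ on which $x\otimes y\mapsto\epsilon(y)\pi_1(x)$ and $x\otimes y\mapsto\epsilon(x)\pi_2(y)$ agree. An abelian group object consists of arrows over $B$, $\boxplus:A\otimes_BA\to A$, $\boxminus:A\to A$, $0:B\to A$, satisfying the usual abelian group diagrams. $F(A)$, the kernel of $\pi$ in $\mathbf{IBialg}$, is the sum of all subcoalgebras $C$ of $A$ with $\pi(c)=\epsilon(c)1$ for all $c\in C$. For $b,b'\in B$ and $u\in A$ (elements of $B$ viewed in $A$ through $0$): $l(b,b')u=\sum (b_{(1)}b'_{(1)})\backslash\big(b_{(2)}(b'_{(2)}u)\big)$, $r(b,b')u=\sum\big((ub_{(1)})b'_{(1)}\big)/(b_{(2)}b'_{(2)})$, $s(b,b')u=\sum\big(b_{(1)}(ub'_{(1)})\big)/(b_{(2)}b'_{(2)})$, $\bar s(b,b')u=\sum (b_{(1)}b'_{(1)})\backslash\big((b_{(2)}u)b'_{(2)}\big)$. *)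

theory Defs
  imports Complex_Main "HOL-Library.Function_Algebras" "HOL-Library.Multiset"
begin

section \<open>Vector spaces and tensor products\<close>

text \<open>A vector space is a subspace \<open>carr\<close> of a type that is itself a vector space under
  \<open>smult\<close>. Since every vector space can be taken to be a whole type, this is no restriction; the
  carrier is needed because tensor products, fibre products and kernels are subspaces.\<close>

record ('k, 'a) vspace =
  carr :: "'a set"
  smult :: "'k \<Rightarrow> 'a \<Rightarrow> 'a"

definition vspace :: "('k::field, 'a::ab_group_add, 'z) vspace_scheme \<Rightarrow> bool" where
  "vspace V \<longleftrightarrow> vector_space (smult V) \<and> module.subspace (smult V) (carr V)"

definition linear_map ::
  "('k::field, 'a::ab_group_add, 'y) vspace_scheme \<Rightarrow> ('k, 'b::ab_group_add, 'z) vspace_scheme \<Rightarrow>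
    ('a \<Rightarrow> 'b) \<Rightarrow> bool" where
  "linear_map V W f \<longleftrightarrow>
    (\<forall>x\<in>carr V. f x \<in> carr W) \<and>
    (\<forall>x\<in>carr V. \<forall>y\<in>carr V. f (x + y) = f x + f y) \<and>
    (\<forall>c. \<forall>x\<in>carr V. f (smult V c x) = smult W c (f x))"

definition bilinear_map ::
  "('k::field, 'a::ab_group_add, 'x) vspace_scheme \<Rightarrow> ('k, 'b::ab_group_add, 'y) vspace_scheme \<Rightarrow>
    ('k, 'c::ab_group_add, 'z) vspace_scheme \<Rightarrow> ('a \<Rightarrow> 'b \<Rightarrow> 'c) \<Rightarrow> bool" where
  "bilinear_map U V W f \<longleftrightarrow>
    (\<forall>x\<in>carr U. linear_map V W (\<lambda>y. f x y)) \<and> (\<forall>y\<in>carr V. linear_map U W (\<lambda>x. f x y))"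

definition fscale :: "'k::field \<Rightarrow> ('x \<Rightarrow> 'k) \<Rightarrow> 'x \<Rightarrow> 'k" where
  "fscale c f = (\<lambda>x. c * f x)"

text \<open>The tensor product of two vector spaces over a field embeds into the dual of the space of
  bilinear forms, \<open>a \<otimes> b\<close> being evaluation at \<open>(a, b)\<close>; it is taken to be its image there. The
  bilinear forms live on the ambient types, so that \<open>C \<otimes> D\<close> is literally a subspace of \<open>V \<otimes> W\<close>
  for subspaces \<open>C\<close> of \<open>V\<close> and \<open>D\<close> of \<open>W\<close>.\<close>

type_synonym ('k, 'a, 'b) tensor = "('a \<Rightarrow> 'b \<Rightarrow> 'k) \<Rightarrow> 'k"

definition bilinear_form ::
  "('k::field, 'a::ab_group_add, 'y) vspace_scheme \<Rightarrow> ('k, 'b::ab_group_add, 'z) vspace_scheme \<Rightarrow>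
    ('a \<Rightarrow> 'b \<Rightarrow> 'k) \<Rightarrow> bool" where
  "bilinear_form V W \<beta> \<longleftrightarrow>
    (\<forall>a. Vector_Spaces.linear (smult W) (*) (\<lambda>b. \<beta> a b)) \<and>
    (\<forall>b. Vector_Spaces.linear (smult V) (*) (\<lambda>a. \<beta> a b))"

definition tens ::
  "('k::field, 'a::ab_group_add, 'y) vspace_scheme \<Rightarrow> ('k, 'b::ab_group_add, 'z) vspace_scheme \<Rightarrow>
    'a \<Rightarrow> 'b \<Rightarrow> ('k, 'a, 'b) tensor" where
  "tens V W a b = (\<lambda>\<beta>. if bilinear_form V W \<beta> then \<beta> a b else 0)"

definition tensor ::
  "('k::field, 'a::ab_group_add, 'y) vspace_scheme \<Rightarrow> ('k, 'b::ab_group_add, 'z) vspace_scheme \<Rightarrow>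
    ('k, ('k, 'a, 'b) tensor) vspace" where
  "tensor V W =
    \<lparr>carr = module.span fscale {tens V W a b | a b. a \<in> carr V \<and> b \<in> carr W}, smult = fscale\<rparr>"

text \<open>The value at \<open>t\<close> of the linear map on \<open>V \<otimes> W\<close> induced by a bilinear \<open>\<beta>\<close>, that is,
  \<open>\<Sum>\<beta> a b\<close> when \<open>t = \<Sum>a \<otimes> b\<close>. It does not depend on the chosen expression for \<open>t\<close>; see
  \<open>tlift_sum_tens\<close> below.\<close>

definition tlift ::
  "('k::field, 'a::ab_group_add, 'y) vspace_scheme \<Rightarrow> ('k, 'b::ab_group_add, 'z) vspace_scheme \<Rightarrow>
    ('a \<Rightarrow> 'b \<Rightarrow> 'c::ab_group_add) \<Rightarrow> ('k, 'a, 'b) tensor \<Rightarrow> 'c" where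
  "tlift V W \<beta> t =
    (let ps = (SOME ps. set ps \<subseteq> carr V \<times> carr W \<and> t = (\<Sum>(a, b)\<leftarrow>ps. tens V W a b))
     in \<Sum>(a, b)\<leftarrow>ps. \<beta> a b)"

lemma vector_space_fscale: "vector_space (fscale :: 'k::field \<Rightarrow> ('x \<Rightarrow> 'k) \<Rightarrow> 'x \<Rightarrow> 'k)"
  by unfold_locales (auto simp: fscale_def fun_eq_iff algebra_simps)

lemma fscale_one: "fscale 1 f = f"
  by (simp add: fscale_def)

lemma vector_space_times: "vector_space ((*) :: 'k::field \<Rightarrow> 'k \<Rightarrow> 'k)"
  by unfold_locales (auto simp: algebra_simps)

lemma subspace_projection:
  assumes "vspace V"
  obtains p where "Vector_Spaces.linear (smult V) (smult V) p" "\<And>x. p x \<in> carr V"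
    "\<And>x. x \<in> carr V \<Longrightarrow> p x = x"
proof -
  interpret V: vector_space "smult V" using assms by (simp add: vspace_def)
  interpret VV: vector_space_pair "smult V" "smult V" ..
  have "\<exists>g. g ` UNIV \<subseteq> carr V \<and> Vector_Spaces.linear (smult V) (smult V) g \<and> (\<forall>v\<in>carr V. g (id v) = v)"
    using assms by (intro VV.linear_exists_left_inverse_on V.linear_id) (auto simp: vspace_def)
  then show thesis using that by auto
qed

lemma separating_functional:
  assumes "vector_space s" "w \<noteq> 0"
  obtains f where "Vector_Spaces.linear s (*) f" "f w \<noteq> (0 :: 'k::field)"
proof -
  interpret V: vector_space s by fact
  interpret K: vector_space "(*) :: 'k \<Rightarrow> 'k \<Rightarrow> 'k" by (rule vector_space_times)
  interpret VK: vector_space_pair s "(*) :: 'k \<Rightarrow> 'k \<Rightarrow> 'k" ..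
  have "V.independent {w}" using assms(2) by simp
  then obtain f where "Vector_Spaces.linear s (*) f" "\<forall>x\<in>{w}. f x = 1"
    using VK.linear_independent_extend[of "{w}" "\<lambda>_. 1"] by blast
  then show thesis using that by simp
qed

lemma linear_sum_list:
  assumes "Vector_Spaces.linear s1 s2 f"
  shows "f (\<Sum>x\<leftarrow>xs. g x) = (\<Sum>x\<leftarrow>xs. f (g x))"
proof -
  interpret Vector_Spaces.linear s1 s2 f by fact
  show ?thesis by (induction xs) (auto simp: add zero)
qed

lemma sum_list_fun_apply: "(\<Sum>x\<leftarrow>xs. g x) y = (\<Sum>x\<leftarrow>xs. g x y)"
  by (induction xs) auto

lemma bilinear_sum_eq:
  assumes V: "vspace V" and W: "vspace W" and E: "vspace E" and b: "bilinear_map V W E \<beta>"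
    and ps: "set ps \<subseteq> carr V \<times> carr W" and qs: "set qs \<subseteq> carr V \<times> carr W"
    and eq: "(\<Sum>(a, b)\<leftarrow>ps. tens V W a b) = (\<Sum>(a, b)\<leftarrow>qs. tens V W a b)"
  shows "(\<Sum>(a, b)\<leftarrow>ps. \<beta> a b) = (\<Sum>(a, b)\<leftarrow>qs. \<beta> a b)"
proof (rule ccontr)
  define w where "w = (\<Sum>(a, b)\<leftarrow>ps. \<beta> a b) - (\<Sum>(a, b)\<leftarrow>qs. \<beta> a b)"
  assume "\<not> ?thesis"
  then have "w \<noteq> 0" by (simp add: w_def)
  have vE: "vector_space (smult E)" using E by (simp add: vspace_def)
  obtain f where f: "Vector_Spaces.linear (smult E) (*) f" "f w \<noteq> 0"
    by (rule separating_functional[OF vE \<open>w \<noteq> 0\<close>])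
  obtain p where p: "Vector_Spaces.linear (smult V) (smult V) p" "\<And>x. p x \<in> carr V"
    "\<And>x. x \<in> carr V \<Longrightarrow> p x = x" using subspace_projection[OF V] by blast
  obtain q where q: "Vector_Spaces.linear (smult W) (smult W) q" "\<And>x. q x \<in> carr W"
    "\<And>x. x \<in> carr W \<Longrightarrow> q x = x" using subspace_projection[OF W] by blast
  interpret f: Vector_Spaces.linear "smult E" "(*)" f by fact
  interpret p: Vector_Spaces.linear "smult V" "smult V" p by fact
  interpret q: Vector_Spaces.linear "smult W" "smult W" q by fact
  define \<gamma> where "\<gamma> a b = f (\<beta> (p a) (q b))" for a b
  have "Vector_Spaces.linear (smult W) (*) (\<gamma> a)" for a
    using b p(2)[of a] q(2) unfolding \<gamma>_def
    by unfold_locales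
      (auto simp: bilinear_map_def linear_map_def q.add q.scale f.add f.scale)
  moreover have "Vector_Spaces.linear (smult V) (*) (\<lambda>a. \<gamma> a b)" for b
    using b p(2) q(2)[of b] unfolding \<gamma>_def
    by unfold_locales
      (auto simp: bilinear_map_def linear_map_def p.add p.scale f.add f.scale)
  ultimately have form: "bilinear_form V W \<gamma>"
    by (auto simp: bilinear_form_def)
  have *: "(\<Sum>(a, b)\<leftarrow>rs. tens V W a b) \<gamma> = f (\<Sum>(a, b)\<leftarrow>rs. \<beta> a b)"
    if "set rs \<subseteq> carr V \<times> carr W" for rs
    using that form
    by (induction rs) (auto simp: f.zero f.add tens_def \<gamma>_def p(3) q(3))
  have "f w = 0"
    using *[OF ps] *[OF qs] eq by (simp add: w_def f.diff)
  with f(2) show False by simp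
qed

lemma tlift_sum_tens:
  assumes "vspace V" "vspace W" "vspace E" "bilinear_map V W E \<beta>"
    and "set ps \<subseteq> carr V \<times> carr W"
  shows "tlift V W \<beta> (\<Sum>(a, b)\<leftarrow>ps. tens V W a b) = (\<Sum>(a, b)\<leftarrow>ps. \<beta> a b)"
proof -
  let ?P = "\<lambda>qs. set qs \<subseteq> carr V \<times> carr W \<and>
    (\<Sum>(a, b)\<leftarrow>ps. tens V W a b) = (\<Sum>(a, b)\<leftarrow>qs. tens V W a b)"
  have "?P ps" using assms(5) by simp
  then have "?P (SOME qs. ?P qs)" by (rule someI)
  then have "(\<Sum>(a, b)\<leftarrow>ps. \<beta> a b) = (\<Sum>(a, b)\<leftarrow>(SOME qs. ?P qs). \<beta> a b)"
    using bilinear_sum_eq[OF assms(1-5)] by blast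
  then show ?thesis by (simp add: tlift_def Let_def)
qed

lemma linear_form_simps:
  assumes "Vector_Spaces.linear s (*) f"
  shows "f (x + y) = f x + f y" "f (s c x) = c * f x"
proof -
  interpret Vector_Spaces.linear s "(*)" f by fact
  show "f (x + y) = f x + f y" "f (s c x) = c * f x" by (simp_all add: add scale)
qed

lemma tens_bilinear: "bilinear_map V W (tensor V W) (tens V W)"
proof -
  interpret F: vector_space fscale by (rule vector_space_fscale)
  have "tens V W x y \<in> carr (tensor V W)" if "x \<in> carr V" "y \<in> carr W" for x y
    unfolding tensor_def using that by (auto intro!: F.span_base)
  moreover have "\<beta> x (y + y') = \<beta> x y + \<beta> x y'" "\<beta> x (smult W c y) = c * \<beta> x y"
    "\<beta> (x + x') y = \<beta> x y + \<beta> x' y" "\<beta> (smult V c x) y = c * \<beta> x y"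
    if "bilinear_form V W \<beta>" for \<beta> x x' y y' c
    using that linear_form_simps[of "smult W" "\<beta> x"] linear_form_simps[of "smult V" "\<lambda>x. \<beta> x y"]
    by (auto simp: bilinear_form_def)
  ultimately show ?thesis
    by (auto simp: bilinear_map_def linear_map_def tens_def fun_eq_iff fscale_def tensor_def)
qed

lemma tensor_sum_tens:
  fixes V :: "('k::field, 'a::ab_group_add, 'y) vspace_scheme"
    and W :: "('k, 'b::ab_group_add, 'z) vspace_scheme"
  assumes V: "vspace V" and W: "vspace W" and t: "t \<in> carr (tensor V W)"
  obtains ps where "set ps \<subseteq> carr V \<times> carr W" "t = (\<Sum>(a, b)\<leftarrow>ps. tens V W a b)"
proof -
  interpret F: vector_space "fscale :: 'k \<Rightarrow> ('k, 'a, 'b) tensor \<Rightarrow> _" by (rule vector_space_fscale)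
  interpret V: vector_space "smult V" using V by (simp add: vspace_def)
  have t: "t \<in> F.span {tens V W a b | a b. a \<in> carr V \<and> b \<in> carr W}"
    using t by (simp add: tensor_def)
  have "\<exists>ps. set ps \<subseteq> carr V \<times> carr W \<and> t = (\<Sum>(a, b)\<leftarrow>ps. tens V W a b)"
    using t
  proof (induction rule: F.span_induct_alt)
    case base
    show ?case by (rule exI[of _ "[]"]) auto
  next
    case (step c x y)
    then obtain a b ps where ab: "x = tens V W a b" "a \<in> carr V" "b \<in> carr W"
      and ps: "set ps \<subseteq> carr V \<times> carr W" "y = (\<Sum>(a, b)\<leftarrow>ps. tens V W a b)" by auto
    have "smult V c a \<in> carr V" using V ab(2) by (auto simp: vspace_def V.subspace_def)
    moreover have "tens V W (smult V c a) b = fscale c x"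
      using tens_bilinear[of V W] ab by (auto simp: bilinear_map_def linear_map_def tensor_def)
    ultimately show ?case
      using ab ps by (intro exI[of _ "(smult V c a, b) # ps"]) auto
  qed
  then show thesis using that by blast
qed


section \<open>Coalgebras\<close>

record ('k, 'a) coalg = "('k, 'a) vspace" +
  comult :: "'a \<Rightarrow> ('k, 'a, 'a) tensor"
  counit :: "'a \<Rightarrow> 'k"

text \<open>Sweedler sums: \<open>\<Sum>f u\<^sub>(\<^sub>1\<^sub>) u\<^sub>(\<^sub>2\<^sub>)\<close> and \<open>\<Sum>f u\<^sub>(\<^sub>1\<^sub>) u\<^sub>(\<^sub>2\<^sub>) u\<^sub>(\<^sub>3\<^sub>)\<close>.\<close>

definition sw2 ::
  "('k::field, 'a::ab_group_add, 'z) coalg_scheme \<Rightarrow> ('a \<Rightarrow> 'a \<Rightarrow> 'c::ab_group_add) \<Rightarrow> 'a \<Rightarrow> 'c" where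
  "sw2 C f u = tlift C C f (comult C u)"

definition sw3 ::
  "('k::field, 'a::ab_group_add, 'z) coalg_scheme \<Rightarrow> ('a \<Rightarrow> 'a \<Rightarrow> 'a \<Rightarrow> 'c::ab_group_add) \<Rightarrow>
    'a \<Rightarrow> 'c" where
  "sw3 C f u = sw2 C (\<lambda>u1 w. sw2 C (\<lambda>u2 u3. f u1 u2 u3) w) u"

definition ground :: "('k::field, 'k) coalg" where
  "ground = (let K = \<lparr>carr = UNIV, smult = (*)\<rparr> in
    \<lparr>carr = UNIV, smult = (*), comult = (\<lambda>c. tens K K c 1), counit = (\<lambda>c. c)\<rparr>)"

text \<open>Coassociative and cocommutative coalgebras.\<close>

definition coalgebra :: "('k::field, 'a::ab_group_add, 'z) coalg_scheme \<Rightarrow> bool" where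
  "coalgebra C \<longleftrightarrow>
    vspace C \<and> linear_map C (tensor C C) (comult C) \<and> linear_map C ground (counit C) \<and>
    (\<forall>u\<in>carr C. sw2 C (\<lambda>u1 u2. smult C (counit C u1) u2) u = u) \<and>
    (\<forall>u\<in>carr C. sw2 C (\<lambda>u1 u2. smult C (counit C u2) u1) u = u) \<and>
    (\<forall>u\<in>carr C.
      sw2 C (\<lambda>w u3. sw2 C (\<lambda>u1 u2. tens C (tensor C C) u1 (tens C C u2 u3)) w) u =
      sw2 C (\<lambda>u1 w. sw2 C (\<lambda>u2 u3. tens C (tensor C C) u1 (tens C C u2 u3)) w) u) \<and>
    (\<forall>u\<in>carr C. sw2 C (\<lambda>u1 u2. tens C C u2 u1) u = comult C u)"

definition coalg_hom ::
  "('k::field, 'a::ab_group_add, 'y) coalg_scheme \<Rightarrow> ('k, 'b::ab_group_add, 'z) coalg_scheme \<Rightarrow>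
    ('a \<Rightarrow> 'b) \<Rightarrow> bool" where
  "coalg_hom C D f \<longleftrightarrow>
    linear_map C D f \<and>
    (\<forall>u\<in>carr C. comult D (f u) = sw2 C (\<lambda>u1 u2. tens D D (f u1) (f u2)) u) \<and>
    (\<forall>u\<in>carr C. counit D (f u) = counit C u)"

definition subcoalgebra :: "('k::field, 'a::ab_group_add, 'z) coalg_scheme \<Rightarrow> 'a set \<Rightarrow> bool" where
  "subcoalgebra C S \<longleftrightarrow>
    S \<subseteq> carr C \<and> module.subspace (smult C) S \<and>
    comult C ` S \<subseteq> carr (tensor (C\<lparr>carr := S\<rparr>) (C\<lparr>carr := S\<rparr>))"

definition tensor_coalg ::
  "('k::field, 'a::ab_group_add, 'y) coalg_scheme \<Rightarrow> ('k, 'b::ab_group_add, 'z) coalg_scheme \<Rightarrow>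
    ('k, ('k, 'a, 'b) tensor) coalg" where
  "tensor_coalg C D =
    \<lparr>carr = carr (tensor C D), smult = smult (tensor C D),
     comult = tlift C D (\<lambda>c d. sw2 C (\<lambda>c1 c2. sw2 D (\<lambda>d1 d2.
       tens (tensor C D) (tensor C D) (tens C D c1 d1) (tens C D c2 d2)) d) c),
     counit = tlift C D (\<lambda>c d. counit C c * counit D d)\<rparr>"


section \<open>The symmetric algebra as a coalgebra\<close>

text \<open>As with the tensor product, the symmetric algebra of \<open>V\<close> is realised as the span of the
  evaluations \<open>F \<mapsto> F [v\<^sub>1, \<dots>, v\<^sub>n]\<close>, the monomials \<open>v\<^sub>1 \<cdots> v\<^sub>n\<close>, where \<open>F\<close> ranges over the families
  of symmetric multilinear forms (one for each number of arguments).\<close>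

type_synonym ('k, 'a) symalg = "('a list \<Rightarrow> 'k) \<Rightarrow> 'k"

definition sym_form ::
  "('k::field, 'a::ab_group_add, 'z) vspace_scheme \<Rightarrow> ('a list \<Rightarrow> 'k) \<Rightarrow> bool" where
  "sym_form V F \<longleftrightarrow>
    (\<forall>xs ys. mset xs = mset ys \<longrightarrow> F xs = F ys) \<and>
    (\<forall>xs. Vector_Spaces.linear (smult V) (*) (\<lambda>x. F (x # xs)))"

definition monomial ::
  "('k::field, 'a::ab_group_add, 'z) vspace_scheme \<Rightarrow> 'a list \<Rightarrow> ('k, 'a) symalg" where
  "monomial V xs = (\<lambda>F. if sym_form V F then F xs else 0)"

definition symalg ::
  "('k::field, 'a::ab_group_add, 'z) vspace_scheme \<Rightarrow> ('k, ('k, 'a) symalg) vspace" where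
  "symalg V = \<lparr>carr = module.span fscale {monomial V xs | xs. set xs \<subseteq> carr V}, smult = fscale\<rparr>"

text \<open>The value at \<open>p\<close> of the linear map sending the monomial \<open>v\<^sub>1 \<cdots> v\<^sub>n\<close> to \<open>g [v\<^sub>1, \<dots>, v\<^sub>n]\<close>, where
  \<open>g\<close> is symmetric and multilinear with values in \<open>W\<close>; compare \<open>tlift\<close>.\<close>

definition slift ::
  "('k::field, 'a::ab_group_add, 'y) vspace_scheme \<Rightarrow> ('k, 'c::ab_group_add, 'z) vspace_scheme \<Rightarrow>
    ('a list \<Rightarrow> 'c) \<Rightarrow> ('k, 'a) symalg \<Rightarrow> 'c" where
  "slift V W g p =
    (let ps = (SOME ps. (\<forall>(c, xs)\<in>set ps. set xs \<subseteq> carr V) \<and>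
                        p = (\<Sum>(c, xs)\<leftarrow>ps. fscale c (monomial V xs)))
     in \<Sum>(c, xs)\<leftarrow>ps. smult W c (g xs))"

definition sym_multilinear ::
  "('k::field, 'a::ab_group_add, 'y) vspace_scheme \<Rightarrow> ('k, 'c::ab_group_add, 'z) vspace_scheme \<Rightarrow>
    ('a list \<Rightarrow> 'c) \<Rightarrow> bool" where
  "sym_multilinear V W g \<longleftrightarrow>
    (\<forall>xs ys. set xs \<subseteq> carr V \<longrightarrow> mset xs = mset ys \<longrightarrow> g xs = g ys) \<and>
    g [] \<in> carr W \<and>
    (\<forall>xs. set xs \<subseteq> carr V \<longrightarrow> linear_map V W (\<lambda>x. g (x # xs)))"

lemma slift_sum_monomial:
  assumes V: "vspace V" and W: "vspace W" and g: "sym_multilinear V W g"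
    and ps: "\<forall>(c, xs)\<in>set ps. set xs \<subseteq> carr V"
  shows "slift V W g (\<Sum>(c, xs)\<leftarrow>ps. fscale c (monomial V xs)) = (\<Sum>(c, xs)\<leftarrow>ps. smult W c (g xs))"
proof -
  let ?m = "\<lambda>ps. \<Sum>(c, xs)\<leftarrow>ps. fscale c (monomial V xs)"
  let ?P = "\<lambda>qs. (\<forall>(c, xs)\<in>set qs. set xs \<subseteq> carr V) \<and> ?m ps = ?m qs"
  define qs where "qs = (SOME qs. ?P qs)"
  have "?P ps" using ps by simp
  then have "?P qs" unfolding qs_def by (rule someI)
  then have qs: "\<forall>(c, xs)\<in>set qs. set xs \<subseteq> carr V" and eq: "?m ps = ?m qs" by auto
  have "(\<Sum>(c, xs)\<leftarrow>ps. smult W c (g xs)) = (\<Sum>(c, xs)\<leftarrow>qs. smult W c (g xs))"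
  proof (rule ccontr)
    define w where "w = (\<Sum>(c, xs)\<leftarrow>ps. smult W c (g xs)) - (\<Sum>(c, xs)\<leftarrow>qs. smult W c (g xs))"
    assume "\<not> ?thesis"
    then have "w \<noteq> 0" by (simp add: w_def)
    have vW: "vector_space (smult W)" using W by (simp add: vspace_def)
    obtain f where f: "Vector_Spaces.linear (smult W) (*) f" "f w \<noteq> 0"
      by (rule separating_functional[OF vW \<open>w \<noteq> 0\<close>])
    obtain p where p: "Vector_Spaces.linear (smult V) (smult V) p" "\<And>x. p x \<in> carr V"
      "\<And>x. x \<in> carr V \<Longrightarrow> p x = x" using subspace_projection[OF V] by blast
    interpret f: Vector_Spaces.linear "smult W" "(*)" f by fact
    interpret p: Vector_Spaces.linear "smult V" "smult V" p by fact
    define F where "F xs = f (g (map p xs))" for xs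
    have pset: "set (map p xs) \<subseteq> carr V" for xs using p(2) by auto
    have "F xs = F ys" if "mset xs = mset ys" for xs ys
    proof -
      have "mset (map p xs) = mset (map p ys)" using that by simp
      then have "g (map p xs) = g (map p ys)"
        using g pset unfolding sym_multilinear_def by blast
      then show ?thesis by (simp add: F_def)
    qed
    moreover have "Vector_Spaces.linear (smult V) (*) (\<lambda>x. F (x # xs))" for xs
    proof -
      have "linear_map V W (\<lambda>x. g (x # map p xs))"
        using g pset unfolding sym_multilinear_def by blast
      then show ?thesis using p(2) unfolding F_def
        by unfold_locales (auto simp: linear_map_def p.add p.scale f.add f.scale)
    qed
    ultimately have form: "sym_form V F" unfolding sym_form_def by blast
    have *: "(?m rs) F = f (\<Sum>(c, xs)\<leftarrow>rs. smult W c (g xs))"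
      if "\<forall>(c, xs)\<in>set rs. set xs \<subseteq> carr V" for rs
    proof -
      have "map p xs = xs" if "set xs \<subseteq> carr V" for xs
        using that p(3) by (intro map_idI) auto
      then show ?thesis using that form
        by (induction rs) (auto simp: f.zero f.add f.scale monomial_def F_def fscale_def)
    qed
    have "f w = 0" using *[OF ps] *[OF qs] eq by (simp add: w_def f.diff)
    with f(2) show False by simp
  qed
  then show ?thesis by (simp add: slift_def Let_def qs_def)
qed

text \<open>All \<open>2\<^sup>n\<close> ways to distribute the entries of a list of length \<open>n\<close> over two lists.\<close>

fun unshuffles :: "'a list \<Rightarrow> ('a list \<times> 'a list) list" where
  "unshuffles [] = [([], [])]"
| "unshuffles (x # xs) =
    map (\<lambda>(ys, zs). (x # ys, zs)) (unshuffles xs) @ map (\<lambda>(ys, zs). (ys, x # zs)) (unshuffles xs)"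

lemma subspace_sum_list:
  assumes "vspace E" "\<And>x. x \<in> set xs \<Longrightarrow> g x \<in> carr E"
  shows "(\<Sum>x\<leftarrow>xs. g x) \<in> carr E"
proof -
  interpret E: vector_space "smult E" using assms(1) by (simp add: vspace_def)
  have "E.subspace (carr E)" using assms(1) by (simp add: vspace_def)
  then show ?thesis using assms(2)
    by (induction xs) (auto simp: E.subspace_0 E.subspace_add)
qed

lemma linear_map_sum_list:
  assumes "vspace E" "\<And>x. x \<in> set xs \<Longrightarrow> linear_map V E (g x)"
  shows "linear_map V E (\<lambda>v. \<Sum>x\<leftarrow>xs. g x v)"
proof -
  interpret E: vector_space "smult E" using assms(1) by (simp add: vspace_def)
  have *: "(\<Sum>x\<leftarrow>xs. smult E c (f x)) = smult E c (\<Sum>x\<leftarrow>xs. f x)" for c f and xs :: "'d list"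
    by (induction xs) (auto simp: E.scale_right_distrib)
  have "(\<Sum>x\<leftarrow>xs. g x (smult V c v)) = smult E c (\<Sum>x\<leftarrow>xs. g x v)" if "v \<in> carr V" for c v
    unfolding *[symmetric] using assms(2) that
    by (intro arg_cong[where f = sum_list] map_cong) (auto simp: linear_map_def)
  moreover have "(\<Sum>x\<leftarrow>xs. g x (v + w)) = (\<Sum>x\<leftarrow>xs. g x v) + (\<Sum>x\<leftarrow>xs. g x w)"
    if "v \<in> carr V" "w \<in> carr V" for v w
    unfolding sum_list_addf[symmetric] using assms(2) that
    by (intro arg_cong[where f = sum_list] map_cong) (auto simp: linear_map_def)
  ultimately show ?thesis
    using assms unfolding linear_map_def by (auto intro!: subspace_sum_list)
qed

lemma vspace_tensor: "vspace (tensor V W)"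
proof -
  interpret F: vector_space fscale by (rule vector_space_fscale)
  show ?thesis by (auto simp: vspace_def tensor_def F.vector_space_axioms F.subspace_span)
qed

lemma vspace_symalg: "vspace (symalg V)"
proof -
  interpret F: vector_space fscale by (rule vector_space_fscale)
  show ?thesis by (auto simp: vspace_def symalg_def F.vector_space_axioms F.subspace_span)
qed

lemma unshuffles_subset: "(ys, zs) \<in> set (unshuffles xs) \<Longrightarrow> set ys \<subseteq> set xs \<and> set zs \<subseteq> set xs"
proof (induction xs arbitrary: ys zs)
  case (Cons x xs)
  from Cons.prems obtain as bs where "(as, bs) \<in> set (unshuffles xs)"
    "(ys, zs) = (x # as, bs) \<or> (ys, zs) = (as, x # bs)" by auto
  then show ?case using Cons.IH[of as bs] by auto
qed simp

lemma monomial_cong: "mset xs = mset ys \<Longrightarrow> monomial V xs = monomial V ys"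
  unfolding monomial_def sym_form_def by (rule ext) metis

lemma monomial_in_symalg: "set xs \<subseteq> carr V \<Longrightarrow> monomial V xs \<in> carr (symalg V)"
proof -
  interpret F: vector_space fscale by (rule vector_space_fscale)
  show "set xs \<subseteq> carr V \<Longrightarrow> monomial V xs \<in> carr (symalg V)"
    by (auto simp: symalg_def intro!: F.span_base)
qed

lemma linear_map_monomial:
  assumes V: "vspace V" and xs: "set xs \<subseteq> carr V"
  shows "linear_map V (symalg V) (\<lambda>x. monomial V (x # xs))"
proof -
  have L: "F ((x + y) # xs) = F (x # xs) + F (y # xs)" "F (smult V c x # xs) = c * F (x # xs)"
    if "sym_form V F" for F x y c
    using that linear_form_simps[of "smult V" "\<lambda>x. F (x # xs)"] by (auto simp: sym_form_def)
  have "monomial V (x # xs) \<in> carr (symalg V)" if "x \<in> carr V" for x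
    using that xs by (intro monomial_in_symalg) auto
  then show ?thesis
    by (auto simp: linear_map_def monomial_def fun_eq_iff fscale_def L symalg_def)
qed

lemma sum_unshuffles_cong:
  fixes f :: "'a multiset \<Rightarrow> 'a multiset \<Rightarrow> 'c::comm_monoid_add"
  assumes "mset xs = mset ys"
  shows "(\<Sum>(a, b)\<leftarrow>unshuffles xs. f (mset a) (mset b)) = (\<Sum>(a, b)\<leftarrow>unshuffles ys. f (mset a) (mset b))"
proof -
  define h :: "'a \<Rightarrow> ('a multiset \<times> 'a multiset) multiset \<Rightarrow> ('a multiset \<times> 'a multiset) multiset" where
    "h x M = image_mset (\<lambda>(a, b). (add_mset x a, b)) M + image_mset (\<lambda>(a, b). (a, add_mset x b)) M" for x M
  interpret comp_fun_commute h
    by unfold_locales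
      (auto simp: h_def fun_eq_iff case_prod_unfold multiset.map_comp comp_def add_mset_commute)
  have fold: "mset (map (\<lambda>(a, b). (mset a, mset b)) (unshuffles xs)) = fold_mset h {#({#}, {#})#} (mset xs)"
    for xs :: "'a list"
  proof (induction xs)
    case (Cons x xs)
    show ?case
      unfolding mset.simps fold_mset_add_mset Cons.IH[symmetric]
      by (simp add: h_def case_prod_unfold multiset.map_comp comp_def)
  qed simp
  have *: "(\<Sum>(a, b)\<leftarrow>unshuffles xs. f (mset a) (mset b)) =
      (\<Sum>(a, b)\<in>#mset (map (\<lambda>(a, b). (mset a, mset b)) (unshuffles xs)). f a b)" for xs :: "'a list"
    unfolding mset_map[symmetric] sum_mset_sum_list map_map by (simp add: case_prod_unfold comp_def)
  show ?thesis unfolding * fold assms ..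
qed

text \<open>The coproduct is the algebra homomorphism for which the elements of \<open>V\<close> are primitive:
  expanding \<open>(v\<^sub>1 \<otimes> 1 + 1 \<otimes> v\<^sub>1) \<cdots> (v\<^sub>n \<otimes> 1 + 1 \<otimes> v\<^sub>n)\<close> yields the sum over all unshuffles.\<close>

definition sym_coalg ::
  "('k::field, 'a::ab_group_add, 'z) vspace_scheme \<Rightarrow> ('k, ('k, 'a) symalg) coalg" where
  "sym_coalg V = (let S = symalg V in
    \<lparr>carr = carr S, smult = smult S,
     comult = slift V (tensor S S)
       (\<lambda>xs. \<Sum>(ys, zs)\<leftarrow>unshuffles xs. tens S S (monomial V ys) (monomial V zs)),
     counit = slift V ground (\<lambda>xs. if xs = [] then 1 else 0)\<rparr>)"

lemma sym_multilinear_coproduct: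
  assumes V: "vspace V"
  defines "S \<equiv> symalg V"
  shows "sym_multilinear V (tensor S S)
    (\<lambda>xs. \<Sum>(ys, zs)\<leftarrow>unshuffles xs. tens S S (monomial V ys) (monomial V zs))" (is "sym_multilinear _ _ ?g")
proof -
  have T: "bilinear_map S S (tensor S S) (tens S S)"
    unfolding S_def by (rule tens_bilinear)
  have mon: "monomial V xs \<in> carr S" if "set xs \<subseteq> carr V" for xs
    using that unfolding S_def by (rule monomial_in_symalg)
  have sel: "monomial V (SOME ys. mset ys = mset xs) = monomial V xs" for xs
    by (rule monomial_cong, rule someI[of "\<lambda>ys. mset ys = mset xs"]) simp
  have "?g xs = ?g ys" if "mset xs = mset ys" for xs ys
    using sum_unshuffles_cong[OF that, of "\<lambda>a b. tens S S (monomial V (SOME ys. mset ys = a))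
      (monomial V (SOME ys. mset ys = b))"] unfolding sel .
  moreover have "?g [] \<in> carr (tensor S S)"
    using T mon[of "[]"] by (auto simp: bilinear_map_def linear_map_def)
  moreover have "linear_map V (tensor S S) (\<lambda>x. ?g (x # xs))" if xs: "set xs \<subseteq> carr V" for xs
  proof -
    have lin: "linear_map V S (\<lambda>x. monomial V (x # ys))" if "set ys \<subseteq> carr V" for ys
      unfolding S_def by (rule linear_map_monomial[OF V that])
    let ?gs = "map (\<lambda>(ys, zs) x. tens S S (monomial V (x # ys)) (monomial V zs)) (unshuffles xs) @
               map (\<lambda>(ys, zs) x. tens S S (monomial V ys) (monomial V (x # zs))) (unshuffles xs)"
    have "linear_map V (tensor S S) h" if "h \<in> set ?gs" for h
    proof -
      from that obtain ys zs where yz: "(ys, zs) \<in> set (unshuffles xs)"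
        and h: "h = (\<lambda>x. tens S S (monomial V (x # ys)) (monomial V zs)) \<or>
                h = (\<lambda>x. tens S S (monomial V ys) (monomial V (x # zs)))" by auto
      have "set ys \<subseteq> carr V" "set zs \<subseteq> carr V" using unshuffles_subset[OF yz] xs by auto
      then show ?thesis
        using h T lin[of ys] lin[of zs] mon[of ys] mon[of zs]
        by (auto simp: bilinear_map_def linear_map_def)
    qed
    then have "linear_map V (tensor S S) (\<lambda>x. \<Sum>h\<leftarrow>?gs. h x)"
      by (intro linear_map_sum_list vspace_tensor)
    also have "(\<lambda>x. \<Sum>h\<leftarrow>?gs. h x) = (\<lambda>x. ?g (x # xs))"
      by (simp add: fun_eq_iff case_prod_unfold comp_def)
    finally show ?thesis .
  qed
  ultimately show ?thesis unfolding sym_multilinear_def by blast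
qed

lemma sym_comult_monomial:
  assumes "vspace V" "set xs \<subseteq> carr V"
  shows "comult (sym_coalg V) (monomial V xs) =
    (\<Sum>(ys, zs)\<leftarrow>unshuffles xs. tens (symalg V) (symalg V) (monomial V ys) (monomial V zs))"
proof -
  show ?thesis
    using slift_sum_monomial[OF assms(1) vspace_tensor sym_multilinear_coproduct[OF assms(1)],
        of "[(1, xs)]"] assms(2)
    by (simp add: sym_coalg_def Let_def fscale_one) (simp add: tensor_def fscale_one)
qed


section \<open>Irreducible unital bialgebras\<close>

record ('k, 'a) bialg = "('k, 'a) coalg" +
  bmult :: "'a \<Rightarrow> 'a \<Rightarrow> 'a"  (infixl \<open>\<cdot>\<index>\<close> 70)
  bunit :: 'a  (\<open>\<one>\<index>\<close>)

definition unital_bialgebra :: "('k::field, 'a::ab_group_add, 'z) bialg_scheme \<Rightarrow> bool" where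
  "unital_bialgebra A \<longleftrightarrow>
    coalgebra A \<and> bilinear_map A A A (bmult A) \<and> bunit A \<in> carr A \<and>
    (\<forall>u\<in>carr A. bunit A \<cdot>\<^bsub>A\<^esub> u = u \<and> u \<cdot>\<^bsub>A\<^esub> bunit A = u) \<and>
    coalg_hom (tensor_coalg A A) A (tlift A A (bmult A)) \<and>
    coalg_hom ground A (\<lambda>c. smult A c (bunit A))"

definition bialg_hom ::
  "('k::field, 'a::ab_group_add, 'y) bialg_scheme \<Rightarrow> ('k, 'b::ab_group_add, 'z) bialg_scheme \<Rightarrow>
    ('a \<Rightarrow> 'b) \<Rightarrow> bool" where
  "bialg_hom A B f \<longleftrightarrow>
    coalg_hom A B f \<and> (\<forall>u\<in>carr A. \<forall>v\<in>carr A. f (u \<cdot>\<^bsub>A\<^esub> v) = f u \<cdot>\<^bsub>B\<^esub> f v) \<and> f (bunit A) = bunit B"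

definition Prim :: "('k::field, 'a::ab_group_add, 'z) bialg_scheme \<Rightarrow> 'a set" where
  "Prim A = {v \<in> carr A. comult A v = tens A A v (bunit A) + tens A A (bunit A) v}"

definition IBialg :: "('k::field, 'a::ab_group_add, 'z) bialg_scheme \<Rightarrow> bool" where
  "IBialg A \<longleftrightarrow>
    unital_bialgebra A \<and>
    (\<exists>\<phi>. coalg_hom (sym_coalg (A\<lparr>carr := Prim A\<rparr>)) A \<phi> \<and>
         bij_betw \<phi> (carr (sym_coalg (A\<lparr>carr := Prim A\<rparr>))) (carr A))"

definition left_division ::
  "('k::field, 'a::ab_group_add, 'z) bialg_scheme \<Rightarrow> ('a \<Rightarrow> 'a \<Rightarrow> 'a) \<Rightarrow> bool" where
  "left_division A d \<longleftrightarrow>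
    bilinear_map A A A d \<and>
    (\<forall>u\<in>carr A. \<forall>v\<in>carr A.
      sw2 A (\<lambda>u1 u2. d u1 (u2 \<cdot>\<^bsub>A\<^esub> v)) u = smult A (counit A u) v \<and>
      sw2 A (\<lambda>u1 u2. u1 \<cdot>\<^bsub>A\<^esub> d u2 v) u = smult A (counit A u) v)"

definition right_division ::
  "('k::field, 'a::ab_group_add, 'z) bialg_scheme \<Rightarrow> ('a \<Rightarrow> 'a \<Rightarrow> 'a) \<Rightarrow> bool" where
  "right_division A d \<longleftrightarrow>
    bilinear_map A A A d \<and>
    (\<forall>u\<in>carr A. \<forall>v\<in>carr A.
      sw2 A (\<lambda>u1 u2. d (v \<cdot>\<^bsub>A\<^esub> u1) u2) u = smult A (counit A u) v \<and>
      sw2 A (\<lambda>u1 u2. d v u1 \<cdot>\<^bsub>A\<^esub> u2) u = smult A (counit A u) v)"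

text \<open>The divisions \<open>u \ v\<close> and \<open>v / u\<close> of an irreducible unital bialgebra are unique on the
  carrier; their values outside the carrier are irrelevant, hence \<open>SOME\<close> rather than \<open>THE\<close>.\<close>

definition ldiv :: "('k::field, 'a::ab_group_add, 'z) bialg_scheme \<Rightarrow> 'a \<Rightarrow> 'a \<Rightarrow> 'a" where
  "ldiv A = (SOME d. left_division A d)"

definition rdiv :: "('k::field, 'a::ab_group_add, 'z) bialg_scheme \<Rightarrow> 'a \<Rightarrow> 'a \<Rightarrow> 'a" where
  "rdiv A = (SOME d. right_division A d)"


section \<open>Products over \<open>B\<close>, abelian group objects, kernels\<close>

definition tensor_bialg ::
  "('k::field, 'a::ab_group_add, 'y) bialg_scheme \<Rightarrow> ('k, 'b::ab_group_add, 'z) bialg_scheme \<Rightarrow>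
    ('k, ('k, 'a, 'b) tensor) bialg" where
  "tensor_bialg A B =
    \<lparr>carr = carr (tensor_coalg A B), smult = smult (tensor_coalg A B),
     comult = comult (tensor_coalg A B), counit = counit (tensor_coalg A B),
     bmult = (\<lambda>s t. tlift A B (\<lambda>a b. tlift A B (\<lambda>a' b'. tens A B (a \<cdot>\<^bsub>A\<^esub> a') (b \<cdot>\<^bsub>B\<^esub> b')) t) s),
     bunit = tens A B (bunit A) (bunit B)\<rparr>"

text \<open>\<open>x \<otimes> y \<mapsto> \<epsilon>(y) f(x)\<close> and \<open>x \<otimes> y \<mapsto> \<epsilon>(x) f(y)\<close>.\<close>

definition on_left ::
  "('k::field, 'a::ab_group_add, 'x) bialg_scheme \<Rightarrow> ('k, 'b::ab_group_add, 'y) bialg_scheme \<Rightarrow>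
    ('k, 'c::ab_group_add, 'z) bialg_scheme \<Rightarrow> ('a \<Rightarrow> 'c) \<Rightarrow> ('k, 'a, 'b) tensor \<Rightarrow> 'c" where
  "on_left A1 A2 B f = tlift A1 A2 (\<lambda>x y. smult B (counit A2 y) (f x))"

definition on_right ::
  "('k::field, 'a::ab_group_add, 'x) bialg_scheme \<Rightarrow> ('k, 'b::ab_group_add, 'y) bialg_scheme \<Rightarrow>
    ('k, 'c::ab_group_add, 'z) bialg_scheme \<Rightarrow> ('b \<Rightarrow> 'c) \<Rightarrow> ('k, 'a, 'b) tensor \<Rightarrow> 'c" where
  "on_right A1 A2 B f = tlift A1 A2 (\<lambda>x y. smult B (counit A1 x) (f y))"

text \<open>\<open>A\<^sub>1 \<otimes>\<^sub>B A\<^sub>2\<close>, the product of \<open>\<pi>\<^sub>1\<close> and \<open>\<pi>\<^sub>2\<close> over \<open>B\<close>. Its structure map to \<open>B\<close> is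
  \<open>on_left A1 A2 B \<pi>1\<close>, its projections are \<open>on_left A1 A2 A1 id\<close> and \<open>on_right A1 A2 A2 id\<close>.\<close>

definition fibre_product ::
  "('k::field, 'c::ab_group_add, 'x) bialg_scheme \<Rightarrow>
    ('k, 'a::ab_group_add, 'y) bialg_scheme \<Rightarrow> ('a \<Rightarrow> 'c) \<Rightarrow>
    ('k, 'b::ab_group_add, 'z) bialg_scheme \<Rightarrow> ('b \<Rightarrow> 'c) \<Rightarrow> ('k, ('k, 'a, 'b) tensor) bialg" where
  "fibre_product B A1 \<pi>1 A2 \<pi>2 =
    (tensor_bialg A1 A2)\<lparr>carr := module.span fscale
      (\<Union>{C. subcoalgebra (tensor_bialg A1 A2) C \<and>
            (\<forall>t\<in>C. on_left A1 A2 B \<pi>1 t = on_right A1 A2 B \<pi>2 t)})\<rparr>"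

text \<open>The morphism \<open>c \<mapsto> \<Sum>f(c\<^sub>(\<^sub>1\<^sub>)) \<otimes> g(c\<^sub>(\<^sub>2\<^sub>))\<close> into the product with components \<open>f\<close> and \<open>g\<close>.\<close>

definition pairing ::
  "('k::field, 'c::ab_group_add, 'x) bialg_scheme \<Rightarrow> ('k, 'a::ab_group_add, 'y) bialg_scheme \<Rightarrow>
    ('k, 'b::ab_group_add, 'z) bialg_scheme \<Rightarrow> ('c \<Rightarrow> 'a) \<Rightarrow> ('c \<Rightarrow> 'b) \<Rightarrow> 'c \<Rightarrow> ('k, 'a, 'b) tensor"
  where
  "pairing C A1 A2 f g c = sw2 C (\<lambda>c1 c2. tens A1 A2 (f c1) (g c2)) c"

text \<open>Abelian group objects over \<open>B\<close>, with addition \<open>pl\<close>, negation \<open>mi\<close> and zero section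
  \<open>z\<close>. The terminal object is the identity of \<open>B\<close>; the last four
  conditions are associativity on \<open>(A \<otimes>\<^sub>B A) \<otimes>\<^sub>B A\<close>, commutativity, unit and inverse.\<close>

definition abelian_group_object ::
  "('k::field, 'b::ab_group_add, 'y) bialg_scheme \<Rightarrow> ('k, 'a::ab_group_add, 'z) bialg_scheme \<Rightarrow>
    ('a \<Rightarrow> 'b) \<Rightarrow> (('k, 'a, 'a) tensor \<Rightarrow> 'a) \<Rightarrow> ('a \<Rightarrow> 'a) \<Rightarrow> ('b \<Rightarrow> 'a) \<Rightarrow> bool" where
  "abelian_group_object B A \<pi> pl mi z \<longleftrightarrow>
    (let P = fibre_product B A \<pi> A \<pi>;
         \<pi>P = on_left A A B \<pi>;
         p1 = on_left A A A id;
         p2 = on_right A A A id;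
         T = fibre_product B P \<pi>P A \<pi>;
         q1 = on_left P A P id;
         q2 = on_right P A A id
     in
      IBialg A \<and> bialg_hom A B \<pi> \<and>
      bialg_hom P A pl \<and> (\<forall>t\<in>carr P. \<pi> (pl t) = \<pi>P t) \<and>
      bialg_hom A A mi \<and> (\<forall>a\<in>carr A. \<pi> (mi a) = \<pi> a) \<and>
      bialg_hom B A z \<and> (\<forall>b\<in>carr B. \<pi> (z b) = b) \<and>
      (\<forall>t\<in>carr T.
        pl (pairing T A A (\<lambda>s. pl (q1 s)) q2 t) =
        pl (pairing T A A (\<lambda>s. p1 (q1 s))
          (\<lambda>s. pl (pairing T A A (\<lambda>s'. p2 (q1 s')) q2 s)) t)) \<and>
      (\<forall>t\<in>carr P. pl (pairing P A A p2 p1 t) = pl t) \<and>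
      (\<forall>a\<in>carr A. pl (pairing A A A (\<lambda>c. z (\<pi> c)) id a) = a) \<and>
      (\<forall>a\<in>carr A. pl (pairing A A A mi id a) = z (\<pi> a)))"

definition kernel ::
  "('k::field, 'a::ab_group_add, 'y) bialg_scheme \<Rightarrow> ('k, 'b::ab_group_add, 'z) bialg_scheme \<Rightarrow>
    ('a \<Rightarrow> 'b) \<Rightarrow> 'a set" where
  "kernel A B \<pi> = module.span (smult A)
    (\<Union>{C. subcoalgebra A C \<and> (\<forall>c\<in>C. \<pi> c = smult B (counit A c) (bunit B))})"


section \<open>The operators \<open>l\<close>, \<open>r\<close>, \<open>s\<close>, \<open>s\<close>-bar\<close>

text \<open>The map \<open>z\<close> is the section \<open>B \<rightarrow> A\<close> through which elements of \<open>B\<close> are viewed in \<open>A\<close>.\<close>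

definition op_l ::
  "('k::field, 'b::ab_group_add, 'y) bialg_scheme \<Rightarrow> ('k, 'a::ab_group_add, 'z) bialg_scheme \<Rightarrow>
    ('b \<Rightarrow> 'a) \<Rightarrow> 'b \<Rightarrow> 'b \<Rightarrow> 'a \<Rightarrow> 'a" where
  "op_l B A z b b' u = sw2 B (\<lambda>b1 b2. sw2 B (\<lambda>b1' b2'.
    ldiv A (z b1 \<cdot>\<^bsub>A\<^esub> z b1') (z b2 \<cdot>\<^bsub>A\<^esub> (z b2' \<cdot>\<^bsub>A\<^esub> u))) b') b"

definition op_r ::
  "('k::field, 'b::ab_group_add, 'y) bialg_scheme \<Rightarrow> ('k, 'a::ab_group_add, 'z) bialg_scheme \<Rightarrow>
    ('b \<Rightarrow> 'a) \<Rightarrow> 'b \<Rightarrow> 'b \<Rightarrow> 'a \<Rightarrow> 'a" where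
  "op_r B A z b b' u = sw2 B (\<lambda>b1 b2. sw2 B (\<lambda>b1' b2'.
    rdiv A ((u \<cdot>\<^bsub>A\<^esub> z b1) \<cdot>\<^bsub>A\<^esub> z b1') (z b2 \<cdot>\<^bsub>A\<^esub> z b2')) b') b"

definition op_s ::
  "('k::field, 'b::ab_group_add, 'y) bialg_scheme \<Rightarrow> ('k, 'a::ab_group_add, 'z) bialg_scheme \<Rightarrow>
    ('b \<Rightarrow> 'a) \<Rightarrow> 'b \<Rightarrow> 'b \<Rightarrow> 'a \<Rightarrow> 'a" where
  "op_s B A z b b' u = sw2 B (\<lambda>b1 b2. sw2 B (\<lambda>b1' b2'.
    rdiv A (z b1 \<cdot>\<^bsub>A\<^esub> (u \<cdot>\<^bsub>A\<^esub> z b1')) (z b2 \<cdot>\<^bsub>A\<^esub> z b2')) b') b"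

definition op_sbar ::
  "('k::field, 'b::ab_group_add, 'y) bialg_scheme \<Rightarrow> ('k, 'a::ab_group_add, 'z) bialg_scheme \<Rightarrow>
    ('b \<Rightarrow> 'a) \<Rightarrow> 'b \<Rightarrow> 'b \<Rightarrow> 'a \<Rightarrow> 'a" where
  "op_sbar B A z b b' u = sw2 B (\<lambda>b1 b2. sw2 B (\<lambda>b1' b2'.
    ldiv A (z b1 \<cdot>\<^bsub>A\<^esub> z b1') ((z b2 \<cdot>\<^bsub>A\<^esub> u) \<cdot>\<^bsub>A\<^esub> z b2')) b') b"

end

theory Submission
  imports Defs
begin

text \<open>For loops instead of bialgebras the theorem is a short computation with the fibrewise addition
  \<open>\<boxplus>\<close>. Since \<open>0\<close> is a unit, \<open>xb = xb \<boxplus> b\<close> and \<open>x'b' = b' \<boxplus> x'b'\<close>, and since \<open>\<boxplus>\<close> is a homomorphism,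
  \<open>(xb)(x'b') = (xb)b' \<boxplus> b(x'b')\<close>. By the definition of \<open>r\<close> and \<open>s\<close> this is
  \<open>(r x)(bb') \<boxplus> (s x')(bb') = (r x \<boxplus> s x')(bb' \<boxplus> bb') = (r x \<boxplus> s x')(bb')\<close>, and on the kernel
  \<open>y \<boxplus> y' = (y \<boxplus> 1)(1 \<boxplus> y') = yy'\<close>.

  For bialgebras \<open>y \<boxplus> y'\<close> becomes the value of \<open>\<boxplus>\<close> at a tensor in \<open>A \<otimes>\<^sub>B A\<close>, so each of these tensors
  must be shown to lie in that sum of subcoalgebras. The tensors \<open>y \<otimes> y'\<close> with \<open>y, y'\<close> in the kernel do
  (\<open>tens_mem_P\<close>), so do the coproducts of elements of \<open>B\<close> (\<open>comult_z_mem_P\<close>), and \<open>A \<otimes>\<^sub>B A\<close> is closed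
  under products (\<open>P_star\<close>). What remains is that \<open>r\<close> and \<open>s\<close> preserve the kernel (\<open>Q_mem_kernel\<close>). This
  requires division to be a morphism of coalgebras (\<open>sw2_d\<close>), and first of all to exist
  (\<open>right_division_exists\<close>): right multiplication \<open>R\<close> is inverted by a geometric series in
  \<open>\<epsilon> - R\<close>, which is locally finite because the coalgebra is a symmetric algebra.

  The pair \<open>(b, b')\<close> is treated as one element \<open>b \<otimes> b'\<close> of the coalgebra \<open>B \<otimes> B\<close>. Everything
  is symmetric under reversing the multiplications of \<open>A\<close> and \<open>B\<close>, which exchanges \<open>r\<close> with \<open>l\<close> and
  \<open>s\<close> with \<open>s\<close>-bar; the second identity is the first one for the opposite bialgebras.\<close>

section \<open>Multilinear maps\<close>

lemma vspaceD:
  assumes "vspace V"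
  shows "vector_space (smult V)" "0 \<in> carr V" "\<And>x y. x \<in> carr V \<Longrightarrow> y \<in> carr V \<Longrightarrow> x + y \<in> carr V"
    "\<And>x y. x \<in> carr V \<Longrightarrow> y \<in> carr V \<Longrightarrow> x - y \<in> carr V"
    "\<And>c x. x \<in> carr V \<Longrightarrow> smult V c x \<in> carr V"
proof -
  show v: "vector_space (smult V)" using assms by (simp add: vspace_def)
  interpret V: vector_space "smult V" by (rule v)
  have s: "V.subspace (carr V)" using assms by (simp add: vspace_def)
  show "0 \<in> carr V" using V.subspace_0[OF s] .
  show "x + y \<in> carr V" if "x \<in> carr V" "y \<in> carr V" for x y using V.subspace_add[OF s that] .
  show "x - y \<in> carr V" if "x \<in> carr V" "y \<in> carr V" for x y using V.subspace_diff[OF s that] .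
  show "smult V c x \<in> carr V" if "x \<in> carr V" for c x using V.subspace_scale[OF s that] .
qed

lemma smult_simps:
  assumes "vspace V"
  shows "smult V c (x + y) = smult V c x + smult V c y" "smult V (c + d) x = smult V c x + smult V d x"
    "smult V c (smult V d x) = smult V (c * d) x" "smult V 1 x = x" "smult V 0 x = 0"
    "smult V c 0 = 0" "smult V c (x - y) = smult V c x - smult V c y"
    "smult V (c - d) x = smult V c x - smult V d x"
proof -
  interpret V: vector_space "smult V" by (rule vspaceD[OF assms])
  show "smult V c (x + y) = smult V c x + smult V c y" "smult V (c + d) x = smult V c x + smult V d x"
    "smult V c (smult V d x) = smult V (c * d) x" "smult V 1 x = x" "smult V 0 x = 0"
    "smult V c 0 = 0" "smult V c (x - y) = smult V c x - smult V c y"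
    "smult V (c - d) x = smult V c x - smult V d x"
    by (simp_all add: V.scale_right_distrib V.scale_left_distrib V.scale_right_diff_distrib
        V.scale_left_diff_distrib)
qed

lemma linear_mapI:
  assumes "\<And>x. x \<in> carr V \<Longrightarrow> f x \<in> carr W"
    "\<And>x y. x \<in> carr V \<Longrightarrow> y \<in> carr V \<Longrightarrow> f (x + y) = f x + f y"
    "\<And>c x. x \<in> carr V \<Longrightarrow> f (smult V c x) = smult W c (f x)"
  shows "linear_map V W f"
  using assms by (simp add: linear_map_def)

lemma linear_mapD:
  assumes "linear_map V W f"
  shows "x \<in> carr V \<Longrightarrow> f x \<in> carr W"
    "x \<in> carr V \<Longrightarrow> y \<in> carr V \<Longrightarrow> f (x + y) = f x + f y"
    "x \<in> carr V \<Longrightarrow> f (smult V c x) = smult W c (f x)"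
  using assms by (simp_all add: linear_map_def)

lemma linear_map_0:
  assumes "vspace V" "vspace W" "linear_map V W f"
  shows "f 0 = 0"
  using linear_mapD(3)[OF assms(3), of 0 0] vspaceD(2)[OF assms(1)]
  by (simp add: smult_simps[OF assms(1)] smult_simps[OF assms(2)])

lemma linear_map_diff:
  assumes "vspace V" "linear_map V W f" "x \<in> carr V" "y \<in> carr V"
  shows "f (x - y) = f x - f y"
  using linear_mapD(2)[OF assms(2), of "x - y" y] vspaceD(4)[OF assms(1)] assms
  by (simp add: algebra_simps)

lemma linear_map_list:
  assumes "vspace V" "vspace W" "linear_map V W h" "\<And>x. x \<in> set xs \<Longrightarrow> f x \<in> carr V"
  shows "h (\<Sum>x\<leftarrow>xs. f x) = (\<Sum>x\<leftarrow>xs. h (f x))"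
  using assms(4)
  by (induction xs) (auto simp: linear_map_0[OF assms(1-3)] linear_mapD[OF assms(3)] subspace_sum_list[OF assms(1)])

lemma linear_map_comp:
  assumes "linear_map V W f" "linear_map U V g"
  shows "linear_map U W (\<lambda>x. f (g x))"
  using assms by (simp add: linear_map_def)

lemma bilinear_mapI:
  assumes "\<And>x y. x \<in> carr U \<Longrightarrow> y \<in> carr V \<Longrightarrow> f x y \<in> carr W"
    "\<And>x y y'. x \<in> carr U \<Longrightarrow> y \<in> carr V \<Longrightarrow> y' \<in> carr V \<Longrightarrow> f x (y + y') = f x y + f x y'"
    "\<And>c x y. x \<in> carr U \<Longrightarrow> y \<in> carr V \<Longrightarrow> f x (smult V c y) = smult W c (f x y)"
    "\<And>x x' y. x \<in> carr U \<Longrightarrow> x' \<in> carr U \<Longrightarrow> y \<in> carr V \<Longrightarrow> f (x + x') y = f x y + f x' y"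
    "\<And>c x y. x \<in> carr U \<Longrightarrow> y \<in> carr V \<Longrightarrow> f (smult U c x) y = smult W c (f x y)"
  shows "bilinear_map U V W f"
  using assms by (auto simp: bilinear_map_def linear_map_def)

lemma bilinear_mapD:
  assumes "bilinear_map U V W f"
  shows "x \<in> carr U \<Longrightarrow> y \<in> carr V \<Longrightarrow> f x y \<in> carr W"
    "x \<in> carr U \<Longrightarrow> y \<in> carr V \<Longrightarrow> y' \<in> carr V \<Longrightarrow> f x (y + y') = f x y + f x y'"
    "x \<in> carr U \<Longrightarrow> y \<in> carr V \<Longrightarrow> f x (smult V c y) = smult W c (f x y)"
    "x \<in> carr U \<Longrightarrow> x' \<in> carr U \<Longrightarrow> y \<in> carr V \<Longrightarrow> f (x + x') y = f x y + f x' y"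
    "x \<in> carr U \<Longrightarrow> y \<in> carr V \<Longrightarrow> f (smult U c x) y = smult W c (f x y)"
    "x \<in> carr U \<Longrightarrow> linear_map V W (f x)"
    "y \<in> carr V \<Longrightarrow> linear_map U W (\<lambda>x. f x y)"
  using assms by (auto simp: bilinear_map_def linear_map_def)

definition trilinear_map ::
  "('k::field, 'a::ab_group_add, 'x) vspace_scheme \<Rightarrow> ('k, 'b::ab_group_add, 'y) vspace_scheme \<Rightarrow>
    ('k, 'c::ab_group_add, 'z) vspace_scheme \<Rightarrow> ('k, 'd::ab_group_add, 'w) vspace_scheme \<Rightarrow>
    ('a \<Rightarrow> 'b \<Rightarrow> 'c \<Rightarrow> 'd) \<Rightarrow> bool" where
  "trilinear_map U V W E f \<longleftrightarrow>
    (\<forall>x\<in>carr U. bilinear_map V W E (f x)) \<and>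
    (\<forall>y\<in>carr V. \<forall>w\<in>carr W. linear_map U E (\<lambda>x. f x y w))"

lemma trilinear_mapI:
  assumes "\<And>x y w. x \<in> carr U \<Longrightarrow> y \<in> carr V \<Longrightarrow> w \<in> carr W \<Longrightarrow> f x y w \<in> carr E"
    "\<And>x y w w'. x \<in> carr U \<Longrightarrow> y \<in> carr V \<Longrightarrow> w \<in> carr W \<Longrightarrow> w' \<in> carr W \<Longrightarrow>
      f x y (w + w') = f x y w + f x y w'"
    "\<And>c x y w. x \<in> carr U \<Longrightarrow> y \<in> carr V \<Longrightarrow> w \<in> carr W \<Longrightarrow> f x y (smult W c w) = smult E c (f x y w)"
    "\<And>x y y' w. x \<in> carr U \<Longrightarrow> y \<in> carr V \<Longrightarrow> y' \<in> carr V \<Longrightarrow> w \<in> carr W \<Longrightarrow>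
      f x (y + y') w = f x y w + f x y' w"
    "\<And>c x y w. x \<in> carr U \<Longrightarrow> y \<in> carr V \<Longrightarrow> w \<in> carr W \<Longrightarrow> f x (smult V c y) w = smult E c (f x y w)"
    "\<And>x x' y w. x \<in> carr U \<Longrightarrow> x' \<in> carr U \<Longrightarrow> y \<in> carr V \<Longrightarrow> w \<in> carr W \<Longrightarrow>
      f (x + x') y w = f x y w + f x' y w"
    "\<And>c x y w. x \<in> carr U \<Longrightarrow> y \<in> carr V \<Longrightarrow> w \<in> carr W \<Longrightarrow> f (smult U c x) y w = smult E c (f x y w)"
  shows "trilinear_map U V W E f"
  using assms by (auto simp: trilinear_map_def bilinear_map_def linear_map_def)

lemma trilinear_mapD:
  assumes "trilinear_map U V W E f"
  shows "x \<in> carr U \<Longrightarrow> y \<in> carr V \<Longrightarrow> w \<in> carr W \<Longrightarrow> f x y w \<in> carr E"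
    "x \<in> carr U \<Longrightarrow> y \<in> carr V \<Longrightarrow> w \<in> carr W \<Longrightarrow> w' \<in> carr W \<Longrightarrow> f x y (w + w') = f x y w + f x y w'"
    "x \<in> carr U \<Longrightarrow> y \<in> carr V \<Longrightarrow> w \<in> carr W \<Longrightarrow> f x y (smult W c w) = smult E c (f x y w)"
    "x \<in> carr U \<Longrightarrow> y \<in> carr V \<Longrightarrow> y' \<in> carr V \<Longrightarrow> w \<in> carr W \<Longrightarrow> f x (y + y') w = f x y w + f x y' w"
    "x \<in> carr U \<Longrightarrow> y \<in> carr V \<Longrightarrow> w \<in> carr W \<Longrightarrow> f x (smult V c y) w = smult E c (f x y w)"
    "x \<in> carr U \<Longrightarrow> x' \<in> carr U \<Longrightarrow> y \<in> carr V \<Longrightarrow> w \<in> carr W \<Longrightarrow> f (x + x') y w = f x y w + f x' y w"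
    "x \<in> carr U \<Longrightarrow> y \<in> carr V \<Longrightarrow> w \<in> carr W \<Longrightarrow> f (smult U c x) y w = smult E c (f x y w)"
    "x \<in> carr U \<Longrightarrow> bilinear_map V W E (f x)"
    "y \<in> carr V \<Longrightarrow> bilinear_map U W E (\<lambda>x. f x y)"
    "w \<in> carr W \<Longrightarrow> bilinear_map U V E (\<lambda>x y. f x y w)"
  using assms by (auto simp: trilinear_map_def bilinear_map_def linear_map_def)

section \<open>Linear maps out of a tensor product\<close>

lemma tens_cong:
  assumes "smult V = smult V'" "smult W = smult W'"
  shows "tens V W = tens V' W'"
  unfolding tens_def bilinear_form_def assms ..

lemma tlift_cong:
  assumes "smult V = smult V'" "smult W = smult W'" "carr V = carr V'" "carr W = carr W'"
  shows "tlift V W = tlift V' W'"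
  unfolding tlift_def tens_cong[OF assms(1,2)] assms(3,4) ..

lemma tensor_cong:
  assumes "smult V = smult V'" "smult W = smult W'" "carr V = carr V'" "carr W = carr W'"
  shows "tensor V W = tensor V' W'"
  unfolding tensor_def tens_cong[OF assms(1,2)] assms(3,4) ..

lemma smult_tensor [simp]: "smult (tensor V W) = fscale"
  by (simp add: tensor_def)

lemma tens_mem [simp]: "a \<in> carr V \<Longrightarrow> b \<in> carr W \<Longrightarrow> tens V W a b \<in> carr (tensor V W)"
  using tens_bilinear[of V W] by (simp add: bilinear_map_def linear_map_def)

lemma tlift_tens:
  assumes "vspace V" "vspace W" "vspace E" "bilinear_map V W E \<beta>" "a \<in> carr V" "b \<in> carr W"
  shows "tlift V W \<beta> (tens V W a b) = \<beta> a b"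
  using tlift_sum_tens[OF assms(1-4), of "[(a, b)]"] assms(5,6) by simp

text \<open>The chosen expression \<open>t = \<Sum>a \<otimes> b\<close> behind \<open>tlift\<close> does not mention the bilinear map. So
  \<open>tlift V W \<beta> t\<close> is a fixed finite sum of values of \<open>\<beta>\<close>, for an arbitrary function \<open>\<beta>\<close>, and finite
  sums, linear maps and further such lifts commute with it.\<close>

definition tlist ::
  "('k::field, 'a::ab_group_add, 'y) vspace_scheme \<Rightarrow> ('k, 'b::ab_group_add, 'z) vspace_scheme \<Rightarrow>
    ('k, 'a, 'b) tensor \<Rightarrow> ('a \<times> 'b) list" where
  "tlist V W t = (SOME ps. set ps \<subseteq> carr V \<times> carr W \<and> t = (\<Sum>(a, b)\<leftarrow>ps. tens V W a b))"

lemma tlift_as_sum: "tlift V W \<beta> t = (\<Sum>(a, b)\<leftarrow>tlist V W t. \<beta> a b)"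
  by (simp add: tlift_def tlist_def Let_def)

lemma tlist:
  assumes "vspace V" "vspace W" "t \<in> carr (tensor V W)"
  shows "set (tlist V W t) \<subseteq> carr V \<times> carr W" "t = (\<Sum>(a, b)\<leftarrow>tlist V W t. tens V W a b)"
proof -
  let ?P = "\<lambda>ps. set ps \<subseteq> carr V \<times> carr W \<and> t = (\<Sum>(a, b)\<leftarrow>ps. tens V W a b)"
  obtain qs where "?P qs" using tensor_sum_tens[OF assms] by metis
  then have "?P (tlist V W t)" unfolding tlist_def by (rule someI)
  then show "set (tlist V W t) \<subseteq> carr V \<times> carr W" "t = (\<Sum>(a, b)\<leftarrow>tlist V W t. tens V W a b)"
    by auto
qed

lemma tlist_mem:
  assumes "vspace V" "vspace W" "t \<in> carr (tensor V W)" "p \<in> set (tlist V W t)"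
  shows "fst p \<in> carr V" "snd p \<in> carr W"
  using tlist(1)[OF assms(1-3)] assms(4) by auto

lemma tlift_mem:
  assumes "vspace V" "vspace W" "vspace E" "t \<in> carr (tensor V W)"
    "\<And>a b. a \<in> carr V \<Longrightarrow> b \<in> carr W \<Longrightarrow> \<beta> a b \<in> carr E"
  shows "tlift V W \<beta> t \<in> carr E"
  unfolding tlift_as_sum case_prod_unfold
  by (intro subspace_sum_list[OF assms(3)] assms(5) tlist_mem[OF assms(1,2,4)])

lemma bilinear_smult_list:
  assumes "vspace E" "bilinear_map V W E \<beta>" "set ps \<subseteq> carr V \<times> carr W"
  shows "(\<Sum>(a, b)\<leftarrow>map (\<lambda>(a, b). (smult V c a, b)) ps. \<beta> a b) = smult E c (\<Sum>(a, b)\<leftarrow>ps. \<beta> a b)"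
  using assms(3)
  by (induction ps) (auto simp: smult_simps[OF assms(1)] bilinear_mapD[OF assms(2)])

lemma tlift_linear:
  assumes V: "vspace V" and W: "vspace W" and E: "vspace E" and b: "bilinear_map V W E \<beta>"
  shows "linear_map (tensor V W) E (tlift V W \<beta>)"
proof (rule linear_mapI)
  show "tlift V W \<beta> t \<in> carr E" if "t \<in> carr (tensor V W)" for t
    by (rule tlift_mem[OF V W E that]) (rule bilinear_mapD(1)[OF b])
next
  fix s t assume s: "s \<in> carr (tensor V W)" and t: "t \<in> carr (tensor V W)"
  obtain ps where ps: "set ps \<subseteq> carr V \<times> carr W" "s = (\<Sum>(a, b)\<leftarrow>ps. tens V W a b)"
    using tensor_sum_tens[OF V W s] .
  obtain qs where qs: "set qs \<subseteq> carr V \<times> carr W" "t = (\<Sum>(a, b)\<leftarrow>qs. tens V W a b)"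
    using tensor_sum_tens[OF V W t] .
  show "tlift V W \<beta> (s + t) = tlift V W \<beta> s + tlift V W \<beta> t"
    using tlift_sum_tens[OF V W E b, of "ps @ qs"] tlift_sum_tens[OF V W E b, of ps]
      tlift_sum_tens[OF V W E b, of qs] ps qs by simp
next
  fix c t assume t: "t \<in> carr (tensor V W)"
  obtain ps where ps: "set ps \<subseteq> carr V \<times> carr W" "t = (\<Sum>(a, b)\<leftarrow>ps. tens V W a b)"
    using tensor_sum_tens[OF V W t] .
  define qs where "qs = map (\<lambda>(a, b). (smult V c a, b)) ps"
  have qs: "set qs \<subseteq> carr V \<times> carr W"
    using ps(1) by (auto simp: qs_def intro!: vspaceD[OF V])
  have "smult (tensor V W) c t = (\<Sum>(a, b)\<leftarrow>qs. tens V W a b)"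
    unfolding ps(2) qs_def by (rule bilinear_smult_list[OF vspace_tensor tens_bilinear ps(1), symmetric])
  then show "tlift V W \<beta> (smult (tensor V W) c t) = smult E c (tlift V W \<beta> t)"
    using tlift_sum_tens[OF V W E b qs] tlift_sum_tens[OF V W E b ps(1)]
      bilinear_smult_list[OF E b ps(1)] ps(2) by (simp add: qs_def)
qed

lemma tlift_cong_on:
  assumes "vspace V" "vspace W" "t \<in> carr (tensor V W)"
    "\<And>a b. a \<in> carr V \<Longrightarrow> b \<in> carr W \<Longrightarrow> \<beta> a b = \<gamma> a b"
  shows "tlift V W \<beta> t = tlift V W \<gamma> t"
  unfolding tlift_as_sum case_prod_unfold
  by (intro arg_cong[where f = sum_list] map_cong refl assms(4) tlist_mem[OF assms(1-3)])

lemma smult_sum_list: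
  assumes "vspace E"
  shows "smult E c (\<Sum>x\<leftarrow>xs. f x) = (\<Sum>x\<leftarrow>xs. smult E c (f x))"
  by (induction xs) (auto simp: smult_simps[OF assms])

lemma linear_tlift:
  assumes "vspace V" "vspace W" "vspace E" "vspace E'" "linear_map E E' h"
    "\<And>a b. a \<in> carr V \<Longrightarrow> b \<in> carr W \<Longrightarrow> \<beta> a b \<in> carr E"
    "t \<in> carr (tensor V W)"
  shows "h (tlift V W \<beta> t) = tlift V W (\<lambda>a b. h (\<beta> a b)) t"
  unfolding tlift_as_sum case_prod_unfold
  by (intro linear_map_list[OF assms(3-5)] assms(6) tlist_mem[OF assms(1,2,7)])

lemma linear_map_tlift_body:
  assumes "vspace V" "vspace W" "vspace E" "t \<in> carr (tensor V W)"
    "\<And>a b. a \<in> carr V \<Longrightarrow> b \<in> carr W \<Longrightarrow> linear_map U E (\<lambda>x. F x a b)"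
  shows "linear_map U E (\<lambda>x. tlift V W (\<lambda>a b. F x a b) t)"
  unfolding tlift_as_sum case_prod_unfold
  by (intro linear_map_sum_list[OF assms(3)] assms(5) tlist_mem[OF assms(1,2,4)])

lemma tensor_linear_eqI:
  assumes "vspace V" "vspace W" "vspace E" "linear_map (tensor V W) E f" "linear_map (tensor V W) E g"
    "\<And>a b. a \<in> carr V \<Longrightarrow> b \<in> carr W \<Longrightarrow> f (tens V W a b) = g (tens V W a b)"
    "t \<in> carr (tensor V W)"
  shows "f t = g t"
proof -
  obtain ps where ps: "set ps \<subseteq> carr V \<times> carr W" "t = (\<Sum>(a, b)\<leftarrow>ps. tens V W a b)"
    using tensor_sum_tens[OF assms(1,2,7)] .
  have "f t = (\<Sum>(a, b)\<leftarrow>ps. f (tens V W a b))" if "linear_map (tensor V W) E f" for f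
    unfolding ps(2) case_prod_unfold using ps(1)
    by (intro linear_map_list[OF vspace_tensor assms(3) that]) (auto intro!: tens_mem)
  then have "f t = (\<Sum>(a, b)\<leftarrow>ps. f (tens V W a b))" "g t = (\<Sum>(a, b)\<leftarrow>ps. g (tens V W a b))"
    using assms(4,5) by auto
  moreover have "(\<Sum>(a, b)\<leftarrow>ps. f (tens V W a b)) = (\<Sum>(a, b)\<leftarrow>ps. g (tens V W a b))"
    using ps(1) assms(6) by (intro arg_cong[where f = sum_list] map_cong) auto
  ultimately show ?thesis by simp
qed

section \<open>Sweedler sums\<close>

lemma sw2_as_sum: "sw2 C f u = (\<Sum>(a, b)\<leftarrow>tlist C C (comult C u). f a b)"
  by (simp add: sw2_def tlift_as_sum)

lemma sw2_add: "sw2 C (\<lambda>a b. f a b + g a b) u = sw2 C f u + sw2 C g u"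
  by (simp add: sw2_as_sum case_prod_unfold sum_list_addf)

lemma sw2_diff: "sw2 C (\<lambda>a b. f a b - g a b) u = sw2 C f u - sw2 C g u"
  by (simp add: sw2_as_sum case_prod_unfold sum_list_subtractf)

lemma sw2_smult: "vspace E \<Longrightarrow> sw2 C (\<lambda>a b. smult E c (f a b)) u = smult E c (sw2 C f u)"
  by (simp add: sw2_as_sum case_prod_unfold smult_sum_list)

lemma sum_list_exchange:
  "(\<Sum>x\<leftarrow>xs. \<Sum>y\<leftarrow>ys. f x y) = (\<Sum>y\<leftarrow>ys. \<Sum>x\<leftarrow>xs. f x y :: 'c::comm_monoid_add)"
  by (induction xs) (auto simp: sum_list_addf)

lemma sw2_exchange:
  "sw2 C (\<lambda>a b. sw2 D (\<lambda>c d. f a b c d) v) u = sw2 D (\<lambda>c d. sw2 C (\<lambda>a b. f a b c d) u) v"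
  unfolding sw2_as_sum case_prod_unfold by (rule sum_list_exchange)

definition quadrilinear_map ::
  "('k::field, 'a::ab_group_add, 'x) vspace_scheme \<Rightarrow> ('k, 'b::ab_group_add, 'y) vspace_scheme \<Rightarrow>
    ('a \<Rightarrow> 'a \<Rightarrow> 'a \<Rightarrow> 'a \<Rightarrow> 'b) \<Rightarrow> bool" where
  "quadrilinear_map V E f \<longleftrightarrow>
    (\<forall>a\<in>carr V. trilinear_map V V V E (f a)) \<and>
    (\<forall>b\<in>carr V. \<forall>c\<in>carr V. \<forall>d\<in>carr V. linear_map V E (\<lambda>a. f a b c d))"

text \<open>These are the axioms behind the purely linear rules for Sweedler sums. They stand alone because
  those rules serve to prove that the tensor product of two coalgebras is again a coalgebra.\<close>
locale coproduct_space =
  fixes C :: "('k::field, 'a::ab_group_add, 'z) coalg_scheme"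
  assumes vspace: "vspace C" and comult_linear: "linear_map C (tensor C C) (comult C)"
begin

lemmas vs [simp] = vspaceD(2-)[OF vspace]

lemmas comult_simps [simp] = linear_mapD(1)[OF comult_linear]

lemma sw2_cong:
  "u \<in> carr C \<Longrightarrow> (\<And>a b. a \<in> carr C \<Longrightarrow> b \<in> carr C \<Longrightarrow> f a b = g a b) \<Longrightarrow> sw2 C f u = sw2 C g u"
  unfolding sw2_def by (rule tlift_cong_on) (auto intro: vspace)

lemma sw2_mem:
  "vspace E \<Longrightarrow> u \<in> carr C \<Longrightarrow> (\<And>a b. a \<in> carr C \<Longrightarrow> b \<in> carr C \<Longrightarrow> f a b \<in> carr E) \<Longrightarrow>
    sw2 C f u \<in> carr E"
  unfolding sw2_def by (rule tlift_mem) (auto intro: vspace)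

lemma linear_sw2:
  "vspace E \<Longrightarrow> vspace E' \<Longrightarrow> linear_map E E' h \<Longrightarrow> u \<in> carr C \<Longrightarrow>
    (\<And>a b. a \<in> carr C \<Longrightarrow> b \<in> carr C \<Longrightarrow> f a b \<in> carr E) \<Longrightarrow>
    h (sw2 C f u) = sw2 C (\<lambda>a b. h (f a b)) u"
  unfolding sw2_def by (rule linear_tlift) (auto intro: vspace)

lemma sw2_linear: "vspace E \<Longrightarrow> bilinear_map C C E f \<Longrightarrow> linear_map C E (sw2 C f)"
  unfolding sw2_def
  by (rule linear_map_comp[OF tlift_linear[OF vspace vspace] comult_linear])

lemma sw2_eq_sum:
  assumes "vspace E" "bilinear_map C C E f" "set ps \<subseteq> carr C \<times> carr C"
    "comult C u = (\<Sum>(a, b)\<leftarrow>ps. tens C C a b)"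
  shows "sw2 C f u = (\<Sum>(a, b)\<leftarrow>ps. f a b)"
  unfolding sw2_def assms(4) by (rule tlift_sum_tens[OF vspace vspace assms(1-3)])

lemma sw2_tens: "u \<in> carr C \<Longrightarrow> sw2 C (tens C C) u = comult C u"
  unfolding sw2_as_sum using tlist(2)[OF vspace vspace comult_simps] by simp

lemma linear_map_sw2_body:
  assumes "vspace E" "u \<in> carr C" "\<And>a b. a \<in> carr C \<Longrightarrow> b \<in> carr C \<Longrightarrow> linear_map V E (\<lambda>x. F x a b)"
  shows "linear_map V E (\<lambda>x. sw2 C (\<lambda>a b. F x a b) u)"
  unfolding sw2_def by (rule linear_map_tlift_body[OF vspace vspace assms(1)]) (use assms(2,3) in auto)

lemma bilinear_map_sw2_body:
  assumes "vspace E" "u \<in> carr C"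
    "\<And>a b. a \<in> carr C \<Longrightarrow> b \<in> carr C \<Longrightarrow> bilinear_map V W E (\<lambda>x y. F x y a b)"
  shows "bilinear_map V W E (\<lambda>x y. sw2 C (\<lambda>a b. F x y a b) u)"
  unfolding bilinear_map_def
  by (intro conjI ballI linear_map_sw2_body[OF assms(1,2)])
    (use assms(3) in \<open>auto simp: bilinear_map_def\<close>)

lemma bilinear_iterated_sw2:
  assumes E: "vspace E" and f: "trilinear_map C C C E f"
  shows "bilinear_map C C E (\<lambda>w c. sw2 C (\<lambda>a b. f a b c) w)"
    "bilinear_map C C E (\<lambda>a w. sw2 C (\<lambda>b c. f a b c) w)"
proof -
  have lin: "linear_map C E (f a b)" "linear_map C E (\<lambda>x. f x a b)" if "a \<in> carr C" "b \<in> carr C" for a b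
    using f that by (auto simp: trilinear_map_def bilinear_map_def)
  show "bilinear_map C C E (\<lambda>w c. sw2 C (\<lambda>a b. f a b c) w)"
    unfolding bilinear_map_def
    by (intro conjI ballI sw2_linear[OF E] trilinear_mapD(10)[OF f] linear_map_sw2_body[OF E] lin)
  show "bilinear_map C C E (\<lambda>a w. sw2 C (\<lambda>b c. f a b c) w)"
    unfolding bilinear_map_def
    by (intro conjI ballI sw2_linear[OF E] trilinear_mapD(8)[OF f] linear_map_sw2_body[OF E] lin)
qed

end

locale cocomm_coalgebra =
  fixes C :: "('k::field, 'a::ab_group_add, 'z) coalg_scheme"
  assumes coalgebra: "coalgebra C"
begin

sublocale coproduct_space
  using coalgebra by unfold_locales (simp_all add: coalgebra_def)

lemma counit_simps [simp]:
  "x \<in> carr C \<Longrightarrow> y \<in> carr C \<Longrightarrow> counit C (x + y) = counit C x + counit C y"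
  "x \<in> carr C \<Longrightarrow> counit C (smult C c x) = c * counit C x"
proof -
  have "linear_map C ground (counit C)" using coalgebra by (simp add: coalgebra_def)
  then show "x \<in> carr C \<Longrightarrow> y \<in> carr C \<Longrightarrow> counit C (x + y) = counit C x + counit C y"
    "x \<in> carr C \<Longrightarrow> counit C (smult C c x) = c * counit C x"
    by (auto simp: linear_map_def ground_def Let_def)
qed

lemma counit_left:
  assumes "vspace E" "linear_map C E h" "u \<in> carr C"
  shows "sw2 C (\<lambda>a b. smult E (counit C a) (h b)) u = h u"
proof -
  have "h (sw2 C (\<lambda>a b. smult C (counit C a) b) u) = sw2 C (\<lambda>a b. h (smult C (counit C a) b)) u"
    by (rule linear_sw2[OF vspace assms]) simp
  also have "sw2 C (\<lambda>a b. smult C (counit C a) b) u = u"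
    using coalgebra assms(3) by (simp add: coalgebra_def)
  also have "sw2 C (\<lambda>a b. h (smult C (counit C a) b)) u = sw2 C (\<lambda>a b. smult E (counit C a) (h b)) u"
    by (rule sw2_cong[OF assms(3)]) (simp add: linear_mapD[OF assms(2)])
  finally show ?thesis ..
qed

lemma cocomm:
  assumes "vspace E" "bilinear_map C C E f" "u \<in> carr C"
  shows "sw2 C (\<lambda>a b. f b a) u = sw2 C f u"
proof -
  have "tlift C C f (sw2 C (\<lambda>a b. tens C C b a) u) = sw2 C (\<lambda>a b. tlift C C f (tens C C b a)) u"
    by (rule linear_sw2[OF vspace_tensor assms(1) tlift_linear[OF vspace vspace assms(1,2)] assms(3)])
      simp
  also have "\<dots> = sw2 C (\<lambda>a b. f b a) u"
    by (rule sw2_cong[OF assms(3)]) (rule tlift_tens[OF vspace vspace assms(1,2)])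
  also have "sw2 C (\<lambda>a b. tens C C b a) u = comult C u"
    using coalgebra assms(3) by (simp add: coalgebra_def)
  finally show ?thesis by (simp add: sw2_def)
qed

lemma counit_right:
  assumes "vspace E" "linear_map C E h" "u \<in> carr C"
  shows "sw2 C (\<lambda>a b. smult E (counit C b) (h a)) u = h u"
proof -
  have "bilinear_map C C E (\<lambda>a b. smult E (counit C a) (h b))"
    by (rule bilinear_mapI)
      (auto simp: linear_mapD[OF assms(2)] smult_simps[OF assms(1)] vspaceD[OF assms(1)] mult.commute)
  from cocomm[OF assms(1) this assms(3)] counit_left[OF assms] show ?thesis by simp
qed

text \<open>The coassociativity axiom speaks of the one trilinear map that sends \<open>(a, b, c)\<close> to
  \<open>a \<otimes> (b \<otimes> c)\<close>; every other trilinear map factors through it.\<close>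
lemma coassoc:
  assumes E: "vspace E" and f: "trilinear_map C C C E f" and u: "u \<in> carr C"
  shows "sw2 C (\<lambda>w c. sw2 C (\<lambda>a b. f a b c) w) u = sw2 C (\<lambda>a w. sw2 C (\<lambda>b c. f a b c) w) u"
proof -
  let ?T = "tensor C C" and ?t = "\<lambda>a b c. tens C (tensor C C) a (tens C C b c)"
  let ?g = "\<lambda>a. tlift C C (f a)"
  have lin: "linear_map ?T E (?g a)" if "a \<in> carr C" for a
    by (rule tlift_linear[OF vspace vspace E trilinear_mapD(8)[OF f that]])
  have bil: "bilinear_map C ?T E ?g"
    unfolding bilinear_map_def
  proof (intro conjI ballI)
    fix t assume t: "t \<in> carr ?T"
    show "linear_map C E (\<lambda>a. ?g a t)"
      by (rule linear_map_tlift_body[OF vspace vspace E t]) (auto intro!: linear_mapI trilinear_mapD[OF f])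
  qed (rule lin)
  let ?h = "tlift C ?T ?g"
  have h: "linear_map (tensor C ?T) E ?h"
    by (rule tlift_linear[OF vspace vspace_tensor E bil])
  have ht: "?h (?t a b c) = f a b c" if "a \<in> carr C" "b \<in> carr C" "c \<in> carr C" for a b c
    using that tlift_tens[OF vspace vspace_tensor E bil]
      tlift_tens[OF vspace vspace E trilinear_mapD(8)[OF f]] by simp
  have hs: "?h (sw2 C (\<lambda>x y. g x y) w) = sw2 C (\<lambda>x y. ?h (g x y)) w"
    if "w \<in> carr C" "\<And>x y. x \<in> carr C \<Longrightarrow> y \<in> carr C \<Longrightarrow> g x y \<in> carr (tensor C ?T)" for g w
    by (rule linear_sw2[OF vspace_tensor E h that])
  have mem: "sw2 C g w \<in> carr (tensor C ?T)"
    if "w \<in> carr C" "\<And>x y. x \<in> carr C \<Longrightarrow> y \<in> carr C \<Longrightarrow> g x y \<in> carr (tensor C ?T)" for g w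
    by (rule sw2_mem[OF vspace_tensor that])
  have "?h (sw2 C (\<lambda>w c. sw2 C (\<lambda>a b. ?t a b c) w) u) = ?h (sw2 C (\<lambda>a w. sw2 C (\<lambda>b c. ?t a b c) w) u)"
    using coalgebra u by (simp add: coalgebra_def)
  moreover have "?h (sw2 C (\<lambda>w c. sw2 C (\<lambda>a b. ?t a b c) w) u) = sw2 C (\<lambda>w c. sw2 C (\<lambda>a b. f a b c) w) u"
    using u by (subst hs) (auto intro!: mem sw2_cong simp: hs ht)
  moreover have "?h (sw2 C (\<lambda>a w. sw2 C (\<lambda>b c. ?t a b c) w) u) = sw2 C (\<lambda>a w. sw2 C (\<lambda>b c. f a b c) w) u"
    using u by (subst hs) (auto intro!: mem sw2_cong simp: hs ht)
  ultimately show ?thesis by simp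
qed

text \<open>By coassociativity the two inner entries of \<open>\<Sum>f u\<^sub>(\<^sub>1\<^sub>) u\<^sub>(\<^sub>2\<^sub>) u\<^sub>(\<^sub>3\<^sub>) u\<^sub>(\<^sub>4\<^sub>)\<close> are the coproduct of a single
  entry, to which cocommutativity applies. Every verification that a composite of morphisms of
  coalgebras and \<open>\<Delta>\<close> is again a morphism reduces to this exchange.\<close>
lemma middle_exchange:
  assumes E: "vspace E" and f: "quadrilinear_map C E f" and u: "u \<in> carr C"
  shows "sw2 C (\<lambda>p q. sw2 C (\<lambda>a b. sw2 C (\<lambda>c d. f a b c d) q) p) u =
    sw2 C (\<lambda>p q. sw2 C (\<lambda>a b. sw2 C (\<lambda>c d. f a c b d) q) p) u"
proof -
  have split: "sw2 C (\<lambda>p q. sw2 C (\<lambda>a b. sw2 C (\<lambda>c d. g a b c d) q) p) u =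
      sw2 C (\<lambda>a w. sw2 C (\<lambda>r d. sw2 C (\<lambda>b c. g a b c d) r) w) u"
    if g: "quadrilinear_map C E g" for g
  proof -
    have tri: "trilinear_map C C C E (g a)" if "a \<in> carr C" for a
      using g that by (simp add: quadrilinear_map_def)
    have lin: "linear_map C E (\<lambda>a. g a b c d)" if "b \<in> carr C" "c \<in> carr C" "d \<in> carr C" for b c d
      using g that by (simp add: quadrilinear_map_def)
    have "trilinear_map C C C E (\<lambda>a b q. sw2 C (\<lambda>c d. g a b c d) q)"
      unfolding trilinear_map_def bilinear_map_def
      by (intro conjI ballI sw2_linear[OF E] linear_map_sw2_body[OF E])
        (auto intro: trilinear_mapD(8)[OF tri] lin bilinear_mapD(7) trilinear_mapD(9)[OF tri]
          trilinear_mapD(10)[OF tri])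
    from coassoc[OF E this u]
    have "sw2 C (\<lambda>p q. sw2 C (\<lambda>a b. sw2 C (\<lambda>c d. g a b c d) q) p) u =
      sw2 C (\<lambda>a w. sw2 C (\<lambda>b q. sw2 C (\<lambda>c d. g a b c d) q) w) u" .
    also have "\<dots> = sw2 C (\<lambda>a w. sw2 C (\<lambda>r d. sw2 C (\<lambda>b c. g a b c d) r) w) u"
      by (rule sw2_cong[OF u]) (rule coassoc[OF E tri, symmetric])
    finally show ?thesis .
  qed
  have f': "quadrilinear_map C E (\<lambda>a b c d. f a c b d)"
    using f by (auto simp: quadrilinear_map_def trilinear_map_def bilinear_map_def)
  have "sw2 C (\<lambda>a w. sw2 C (\<lambda>r d. sw2 C (\<lambda>b c. f a b c d) r) w) u =
      sw2 C (\<lambda>a w. sw2 C (\<lambda>r d. sw2 C (\<lambda>b c. f a c b d) r) w) u"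
  proof (rule sw2_cong[OF u], rule sw2_cong)
    fix a w r d assume "a \<in> carr C" "r \<in> carr C" "d \<in> carr C"
    then show "sw2 C (\<lambda>b c. f a b c d) r = sw2 C (\<lambda>b c. f a c b d) r"
      using f by (intro cocomm[OF E, symmetric]) (auto simp: quadrilinear_map_def intro: trilinear_mapD)
  qed
  then show ?thesis unfolding split[OF f] split[OF f'] .
qed

end

lemma coalg_homD:
  assumes "coalg_hom C D f"
  shows "linear_map C D f" "u \<in> carr C \<Longrightarrow> f u \<in> carr D" "u \<in> carr C \<Longrightarrow> counit D (f u) = counit C u"
    "u \<in> carr C \<Longrightarrow> v \<in> carr C \<Longrightarrow> f (u + v) = f u + f v" "u \<in> carr C \<Longrightarrow> f (smult C c u) = smult D c (f u)"
    "u \<in> carr C \<Longrightarrow> comult D (f u) = sw2 C (\<lambda>u1 u2. tens D D (f u1) (f u2)) u"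
  using assms by (auto simp: coalg_hom_def linear_map_def)

lemma sw2_coalg_hom:
  assumes C: "vspace C" "linear_map C (tensor C C) (comult C)" and D: "vspace D" and f: "coalg_hom C D f"
    and E: "vspace E" and F: "bilinear_map D D E F" and u: "u \<in> carr C"
  shows "sw2 D F (f u) = sw2 C (\<lambda>a b. F (f a) (f b)) u"
proof -
  have t: "comult C u \<in> carr (tensor C C)" using C(2) u by (rule linear_mapD)
  note lm = tlift_linear[OF D D E F]
  have "sw2 D F (f u) = tlift D D F (tlift C C (\<lambda>a b. tens D D (f a) (f b)) (comult C u))"
    by (simp add: sw2_def coalg_homD(6)[OF f u])
  also have "\<dots> = tlift C C (\<lambda>a b. tlift D D F (tens D D (f a) (f b))) (comult C u)"
    by (rule linear_tlift[OF C(1) C(1) vspace_tensor E lm _ t]) (simp add: coalg_homD(2)[OF f])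
  also have "\<dots> = tlift C C (\<lambda>a b. F (f a) (f b)) (comult C u)"
    by (rule tlift_cong_on[OF C(1) C(1) t]) (intro tlift_tens[OF D D E F] coalg_homD(2)[OF f])
  finally show ?thesis by (simp add: sw2_def)
qed

section \<open>The tensor product of two coalgebras\<close>

locale coalgebra_pair = C: cocomm_coalgebra C + D: cocomm_coalgebra D
  for C :: "('k::field, 'a::ab_group_add, 'y) coalg_scheme"
    and D :: "('k, 'b::ab_group_add, 'z) coalg_scheme"
begin

text \<open>The products, divisions and actions below are all bilinear maps \<open>f\<close> that are morphisms of
  coalgebras. This turns a formula for their coproduct into one for arbitrary Sweedler sums.\<close>
lemma sw2_bilinear_morphism:
  assumes A: "vspace A" and E: "vspace E" and F: "bilinear_map A A E F"
    and f: "\<And>c d. c \<in> carr C \<Longrightarrow> d \<in> carr D \<Longrightarrow> f c d \<in> carr A"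
    and c: "c \<in> carr C" and d: "d \<in> carr D"
    and w: "comult A w = sw2 C (\<lambda>c1 c2. sw2 D (\<lambda>d1 d2. tens A A (f c1 d1) (f c2 d2)) d) c"
  shows "sw2 A F w = sw2 C (\<lambda>c1 c2. sw2 D (\<lambda>d1 d2. F (f c1 d1) (f c2 d2)) d) c"
proof -
  note lm = tlift_linear[OF A A E F]
  have "sw2 A F w = tlift A A F (sw2 C (\<lambda>c1 c2. sw2 D (\<lambda>d1 d2. tens A A (f c1 d1) (f c2 d2)) d) c)"
    by (simp only: sw2_def[of A] w)
  also have "\<dots> = sw2 C (\<lambda>c1 c2. tlift A A F (sw2 D (\<lambda>d1 d2. tens A A (f c1 d1) (f c2 d2)) d)) c"
    by (rule C.linear_sw2[OF vspace_tensor E lm c], rule D.sw2_mem[OF vspace_tensor d]) (simp add: f)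
  also have "\<dots> = sw2 C (\<lambda>c1 c2. sw2 D (\<lambda>d1 d2. tlift A A F (tens A A (f c1 d1) (f c2 d2))) d) c"
    by (rule C.sw2_cong[OF c], rule D.linear_sw2[OF vspace_tensor E lm d]) (simp add: f)
  also have "\<dots> = sw2 C (\<lambda>c1 c2. sw2 D (\<lambda>d1 d2. F (f c1 d1) (f c2 d2)) d) c"
    by (rule C.sw2_cong[OF c], rule D.sw2_cong[OF d], rule tlift_tens[OF A A E F]) (simp_all add: f)
  finally show ?thesis .
qed

abbreviation T :: "('k, ('k, 'a, 'b) tensor) coalg" where "T \<equiv> tensor_coalg C D"
abbreviation t (infix \<open>\<otimes>\<close> 70) where "a \<otimes> b \<equiv> tens C D a b"

lemma T_simps [simp]: "carr T = carr (tensor C D)" "smult T = fscale"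
  by (simp_all add: tensor_coalg_def)

lemma vspace_T: "vspace T"
  using vspace_tensor[of C D] by (simp add: vspace_def)

lemma T_cong: "tens T T = tens (tensor C D) (tensor C D)" "tensor T T = tensor (tensor C D) (tensor C D)"
  by (rule tens_cong; simp) (rule tensor_cong; simp)

lemma linear_T: "linear_map T E f \<longleftrightarrow> linear_map (tensor C D) E f"
  by (simp add: linear_map_def)

lemma tens_simps [simp]:
  "a \<in> carr C \<Longrightarrow> b \<in> carr D \<Longrightarrow> b' \<in> carr D \<Longrightarrow> a \<otimes> (b + b') = a \<otimes> b + a \<otimes> b'"
  "a \<in> carr C \<Longrightarrow> b \<in> carr D \<Longrightarrow> a \<otimes> (smult D c b) = fscale c (a \<otimes> b)"
  "a \<in> carr C \<Longrightarrow> a' \<in> carr C \<Longrightarrow> b \<in> carr D \<Longrightarrow> (a + a') \<otimes> b = a \<otimes> b + a' \<otimes> b"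
  "a \<in> carr C \<Longrightarrow> b \<in> carr D \<Longrightarrow> (smult C c a) \<otimes> b = fscale c (a \<otimes> b)"
  using bilinear_mapD(2-5)[OF tens_bilinear[of C D]] by simp_all

lemma bilinear_pure_tensors:
  assumes "bilinear_map T T E F" "c \<in> carr C" "d \<in> carr D" "c' \<in> carr C" "d' \<in> carr D"
  shows "bilinear_map D D E (\<lambda>d1 d2. F (c \<otimes> d1) (c' \<otimes> d2))"
    "bilinear_map C C E (\<lambda>c1 c2. F (c1 \<otimes> d) (c2 \<otimes> d'))"
  using assms(2-) bilinear_mapD[OF assms(1)] by (auto intro!: bilinear_mapI)

lemma bilinear_twofold_sw2:
  assumes E: "vspace E" and F: "bilinear_map T T E F"
  shows "bilinear_map C D E
    (\<lambda>c d. sw2 C (\<lambda>c1 c2. sw2 D (\<lambda>d1 d2. F (c1 \<otimes> d1) (c2 \<otimes> d2)) d) c)"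
  unfolding bilinear_map_def
proof (intro conjI ballI)
  show "linear_map D E (\<lambda>d. sw2 C (\<lambda>c1 c2. sw2 D (\<lambda>d1 d2. F (c1 \<otimes> d1) (c2 \<otimes> d2)) d) c)"
    if "c \<in> carr C" for c
    using D.vs(1)
    by (intro C.linear_map_sw2_body[OF E that] D.sw2_linear[OF E] bilinear_pure_tensors[OF F])
next
  fix d assume d: "d \<in> carr D"
  show "linear_map C E (\<lambda>c. sw2 C (\<lambda>c1 c2. sw2 D (\<lambda>d1 d2. F (c1 \<otimes> d1) (c2 \<otimes> d2)) d) c)"
    using C.vs(1)
    by (intro C.sw2_linear[OF E] D.bilinear_map_sw2_body[OF E d] bilinear_pure_tensors[OF F])
qed

lemma comult_T: "comult T = tlift C D (\<lambda>c d. sw2 C (\<lambda>c1 c2. sw2 D (\<lambda>d1 d2. tens T T (c1 \<otimes> d1) (c2 \<otimes> d2)) d) c)"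
  unfolding T_cong unfolding tensor_coalg_def by simp

lemma comult_T_linear: "linear_map T (tensor T T) (comult T)"
  unfolding comult_T linear_T
  by (intro tlift_linear C.vspace D.vspace vspace_tensor bilinear_twofold_sw2 tens_bilinear)

sublocale T: coproduct_space T
  by unfold_locales (rule vspace_T comult_T_linear)+

lemma comult_T_tens:
  assumes "c \<in> carr C" "d \<in> carr D"
  shows "comult T (c \<otimes> d) = sw2 C (\<lambda>c1 c2. sw2 D (\<lambda>d1 d2. tens T T (c1 \<otimes> d1) (c2 \<otimes> d2)) d) c"
  unfolding comult_T using assms
  by (rule tlift_tens[OF C.vspace D.vspace vspace_tensor bilinear_twofold_sw2[OF vspace_tensor tens_bilinear]])

lemma sw2_T_tens:
  assumes E: "vspace E" and F: "bilinear_map T T E F" and c: "c \<in> carr C" and d: "d \<in> carr D"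
  shows "sw2 T F (c \<otimes> d) = sw2 C (\<lambda>c1 c2. sw2 D (\<lambda>d1 d2. F (c1 \<otimes> d1) (c2 \<otimes> d2)) d) c"
  by (rule sw2_bilinear_morphism[OF vspace_T E F _ c d comult_T_tens[OF c d]]) simp

lemma bilinear_counits: "bilinear_map C D ground (\<lambda>c d. counit C c * counit D d)"
  by (rule bilinear_mapI) (auto simp: ground_def Let_def algebra_simps)

lemma vspace_ground: "vspace (ground :: ('k, 'k) coalg)"
proof -
  interpret K: vector_space "(*) :: 'k \<Rightarrow> 'k \<Rightarrow> 'k" by (rule vector_space_times)
  show ?thesis by (simp add: vspace_def ground_def Let_def K.vector_space_axioms K.subspace_UNIV)
qed

lemma counit_T: "counit T = tlift C D (\<lambda>c d. counit C c * counit D d)"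
  by (simp add: tensor_coalg_def)

lemma counit_T_linear: "linear_map T ground (counit T)"
  unfolding linear_T counit_T by (rule tlift_linear[OF C.vspace D.vspace vspace_ground bilinear_counits])

lemma counit_T_tens [simp]: "c \<in> carr C \<Longrightarrow> d \<in> carr D \<Longrightarrow> counit T (c \<otimes> d) = counit C c * counit D d"
  using tlift_tens[OF C.vspace D.vspace vspace_ground bilinear_counits] by (simp add: counit_T)

lemma T_eqI:
  assumes "vspace E" "linear_map T E f" "linear_map T E g"
    "\<And>a b. a \<in> carr C \<Longrightarrow> b \<in> carr D \<Longrightarrow> f (a \<otimes> b) = g (a \<otimes> b)" "s \<in> carr (tensor C D)"
  shows "f s = g s"
  using tensor_linear_eqI[OF C.vspace D.vspace assms(1) assms(2)[unfolded linear_T] assms(3)[unfolded linear_T]]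
    assms(4,5) by blast

lemma T_coassoc:
  assumes E: "vspace E" and f: "trilinear_map T T T E f" and s: "s \<in> carr (tensor C D)"
  shows "sw2 T (\<lambda>w z. sw2 T (\<lambda>x y. f x y z) w) s = sw2 T (\<lambda>x w. sw2 T (\<lambda>y z. f x y z) w) s"
proof (rule T_eqI[OF E T.sw2_linear[OF E T.bilinear_iterated_sw2(1)[OF E f]]
      T.sw2_linear[OF E T.bilinear_iterated_sw2(2)[OF E f]] _ s])
  fix c d assume c: "c \<in> carr C" and d: "d \<in> carr D"
  have f1: "bilinear_map T T E (\<lambda>x y. f x y z)" if "z \<in> carr T" for z using trilinear_mapD(10)[OF f that] .
  have f2: "bilinear_map T T E (\<lambda>y z. f x y z)" if "x \<in> carr T" for x using trilinear_mapD(8)[OF f that] .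
  note fs = trilinear_mapD(1-7)[OF f, unfolded T_simps]
  have triD: "trilinear_map D D D E (\<lambda>r s d2. f (p \<otimes> r) (q \<otimes> s) (c2 \<otimes> d2))"
    if "p \<in> carr C" "q \<in> carr C" "c2 \<in> carr C" for p q c2
    using that by (intro trilinear_mapI) (simp_all add: fs)
  have linC: "linear_map C E (\<lambda>p. f (p \<otimes> r) (q \<otimes> s) (c2 \<otimes> d2))"
    "linear_map C E (\<lambda>p. f (q \<otimes> s) (p \<otimes> r) (c2 \<otimes> d2))"
    "linear_map C E (\<lambda>p. f (q \<otimes> s) (c2 \<otimes> d2) (p \<otimes> r))"
    if "q \<in> carr C" "c2 \<in> carr C" "r \<in> carr D" "s \<in> carr D" "d2 \<in> carr D" for r q s c2 d2
    using that by (auto intro!: linear_mapI simp: fs)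
  have triC: "trilinear_map C C C E (\<lambda>p q c2. sw2 D (\<lambda>d1 d2. sw2 D (\<lambda>r s. f (p \<otimes> r) (q \<otimes> s) (c2 \<otimes> d2)) d1) d)"
    unfolding trilinear_map_def bilinear_map_def
    by (intro conjI ballI D.linear_map_sw2_body[OF E] linC d)
  have "sw2 T (\<lambda>w z. sw2 T (\<lambda>x y. f x y z) w) (c \<otimes> d) =
      sw2 C (\<lambda>c1 c2. sw2 D (\<lambda>d1 d2. sw2 T (\<lambda>x y. f x y (c2 \<otimes> d2)) (c1 \<otimes> d1)) d) c"
    by (rule sw2_T_tens[OF E T.bilinear_iterated_sw2(1)[OF E f] c d])
  also have "\<dots> = sw2 C (\<lambda>c1 c2. sw2 D (\<lambda>d1 d2. sw2 C (\<lambda>p q. sw2 D (\<lambda>r s.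
      f (p \<otimes> r) (q \<otimes> s) (c2 \<otimes> d2)) d1) c1) d) c"
    by (rule C.sw2_cong[OF c], rule D.sw2_cong[OF d], rule sw2_T_tens[OF E f1]) auto
  also have "\<dots> = sw2 C (\<lambda>c1 c2. sw2 C (\<lambda>p q. sw2 D (\<lambda>d1 d2. sw2 D (\<lambda>r s.
      f (p \<otimes> r) (q \<otimes> s) (c2 \<otimes> d2)) d1) d) c1) c"
    by (subst sw2_exchange) (rule refl)
  also have "\<dots> = sw2 C (\<lambda>p c1. sw2 C (\<lambda>q c2. sw2 D (\<lambda>d1 d2. sw2 D (\<lambda>r s.
      f (p \<otimes> r) (q \<otimes> s) (c2 \<otimes> d2)) d1) d) c1) c"
    by (rule C.coassoc[OF E triC c])
  also have "\<dots> = sw2 C (\<lambda>p c1. sw2 C (\<lambda>q c2. sw2 D (\<lambda>r d1. sw2 D (\<lambda>s d2.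
      f (p \<otimes> r) (q \<otimes> s) (c2 \<otimes> d2)) d1) d) c1) c"
    by (rule C.sw2_cong[OF c], rule C.sw2_cong, assumption, rule D.coassoc[OF E triD d])
  also have "\<dots> = sw2 C (\<lambda>p c1. sw2 D (\<lambda>r d1. sw2 C (\<lambda>q c2. sw2 D (\<lambda>s d2.
      f (p \<otimes> r) (q \<otimes> s) (c2 \<otimes> d2)) d1) c1) d) c"
    by (subst sw2_exchange) (rule refl)
  also have "\<dots> = sw2 C (\<lambda>p c1. sw2 D (\<lambda>r d1. sw2 T (\<lambda>y z. f (p \<otimes> r) y z) (c1 \<otimes> d1)) d) c"
    by (rule C.sw2_cong[OF c], rule D.sw2_cong[OF d], rule sw2_T_tens[OF E f2, symmetric]) auto
  also have "\<dots> = sw2 T (\<lambda>x w. sw2 T (\<lambda>y z. f x y z) w) (c \<otimes> d)"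
    by (rule sw2_T_tens[OF E T.bilinear_iterated_sw2(2)[OF E f] c d, symmetric])
  finally show "sw2 T (\<lambda>w z. sw2 T (\<lambda>x y. f x y z) w) (c \<otimes> d) =
    sw2 T (\<lambda>x w. sw2 T (\<lambda>y z. f x y z) w) (c \<otimes> d)" .
qed

lemma T_cocomm:
  assumes E: "vspace E" and f: "bilinear_map T T E f" and s: "s \<in> carr (tensor C D)"
  shows "sw2 T (\<lambda>x y. f y x) s = sw2 T f s"
proof -
  have f': "bilinear_map T T E (\<lambda>x y. f y x)" using f by (auto simp: bilinear_map_def)
  show ?thesis
  proof (rule T_eqI[OF E T.sw2_linear[OF E f'] T.sw2_linear[OF E f] _ s])
    fix c d assume c: "c \<in> carr C" and d: "d \<in> carr D"
    have "bilinear_map C C E (\<lambda>c1 c2. sw2 D (\<lambda>d1 d2. f (c1 \<otimes> d2) (c2 \<otimes> d1)) d)"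
      by (intro D.bilinear_map_sw2_body[OF E d] bilinear_pure_tensors(2)[OF f C.vs(1) _ C.vs(1)])
    from C.cocomm[OF E this c]
    have "sw2 C (\<lambda>c1 c2. sw2 D (\<lambda>d1 d2. f (c2 \<otimes> d2) (c1 \<otimes> d1)) d) c =
        sw2 C (\<lambda>c1 c2. sw2 D (\<lambda>d1 d2. f (c1 \<otimes> d2) (c2 \<otimes> d1)) d) c" .
    also have "\<dots> = sw2 C (\<lambda>c1 c2. sw2 D (\<lambda>d1 d2. f (c1 \<otimes> d1) (c2 \<otimes> d2)) d) c"
      by (rule C.sw2_cong[OF c], rule D.cocomm[OF E bilinear_pure_tensors(1)[OF f _ D.vs(1) _ D.vs(1)] d])
    finally show "sw2 T (\<lambda>x y. f y x) (c \<otimes> d) = sw2 T f (c \<otimes> d)"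
      by (simp add: sw2_T_tens[OF E f' c d] sw2_T_tens[OF E f c d])
  qed
qed

lemma T_counit_left:
  assumes s: "s \<in> carr (tensor C D)"
  shows "sw2 T (\<lambda>x y. smult T (counit T x) y) s = s"
proof -
  have f: "bilinear_map T T T (\<lambda>x y. smult T (counit T x) y)"
    using linear_mapD[OF counit_T_linear] smult_simps[OF vspace_T] vspaceD[OF vspace_T]
    by (intro bilinear_mapI) (simp_all add: ground_def Let_def mult.commute)
  have id: "linear_map T T (\<lambda>s. s)" by (simp add: linear_map_def)
  show ?thesis
  proof (rule T_eqI[OF vspace_T T.sw2_linear[OF vspace_T f] id _ s])
    fix c d assume c: "c \<in> carr C" and d: "d \<in> carr D"
    have lC: "linear_map C T (\<lambda>c. c \<otimes> d)" and lD: "linear_map D T (\<lambda>d'. c' \<otimes> d')" if "c' \<in> carr C" for c'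
      using that d by (auto intro!: linear_mapI)
    have "sw2 T (\<lambda>x y. smult T (counit T x) y) (c \<otimes> d) =
        sw2 C (\<lambda>c1 c2. sw2 D (\<lambda>d1 d2. smult T (counit T (c1 \<otimes> d1)) (c2 \<otimes> d2)) d) c"
      by (rule sw2_T_tens[OF vspace_T f c d])
    also have "\<dots> = sw2 C (\<lambda>c1 c2. sw2 D (\<lambda>d1 d2. smult T (counit C c1) (smult T (counit D d1) (c2 \<otimes> d2))) d) c"
      by (rule C.sw2_cong[OF c], rule D.sw2_cong[OF d]) (simp add: smult_simps[OF vspace_T, simplified])
    also have "\<dots> = sw2 C (\<lambda>c1 c2. smult T (counit C c1) (c2 \<otimes> d)) c"
      unfolding sw2_smult[OF vspace_T]
      by (rule C.sw2_cong[OF c]) (simp only: D.counit_left[OF vspace_T lD d])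
    also have "\<dots> = c \<otimes> d" by (rule C.counit_left[OF vspace_T lC[OF c] c])
    finally show "sw2 T (\<lambda>x y. smult T (counit T x) y) (c \<otimes> d) = c \<otimes> d" .
  qed
qed

lemma T_counit_right:
  assumes s: "s \<in> carr (tensor C D)"
  shows "sw2 T (\<lambda>x y. smult T (counit T y) x) s = s"
proof -
  have "bilinear_map T T T (\<lambda>x y. smult T (counit T x) y)"
    using linear_mapD[OF counit_T_linear] smult_simps[OF vspace_T] vspaceD[OF vspace_T]
    by (intro bilinear_mapI) (simp_all add: ground_def Let_def mult.commute)
  from T_cocomm[OF vspace_T this s] T_counit_left[OF s] show ?thesis by simp
qed

sublocale T: cocomm_coalgebra T
proof
  have tri: "trilinear_map T T T (tensor T (tensor T T)) (\<lambda>x y z. tens T (tensor T T) x (tens T T y z))"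
    using bilinear_mapD[OF tens_bilinear[of T "tensor T T"]] bilinear_mapD[OF tens_bilinear[of T T]]
    by (intro trilinear_mapI) simp_all
  show "coalgebra T"
    unfolding coalgebra_def
  proof (intro conjI ballI)
    fix s assume s: "s \<in> carr T"
    then have s': "s \<in> carr (tensor C D)" by simp
    show "sw2 T (\<lambda>x y. smult T (counit T x) y) s = s" by (rule T_counit_left[OF s'])
    show "sw2 T (\<lambda>x y. smult T (counit T y) x) s = s" by (rule T_counit_right[OF s'])
    show "sw2 T (\<lambda>w z. sw2 T (\<lambda>x y. tens T (tensor T T) x (tens T T y z)) w) s =
      sw2 T (\<lambda>x w. sw2 T (\<lambda>y z. tens T (tensor T T) x (tens T T y z)) w) s"
      by (rule T_coassoc[OF vspace_tensor tri s'])
    have "sw2 T (tens T T) s = comult T s" by (rule T.sw2_tens[OF s])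
    then show "sw2 T (\<lambda>x y. tens T T y x) s = comult T s"
      using T_cocomm[OF vspace_tensor tens_bilinear s'] by simp
  qed (rule vspace_T comult_T_linear counit_T_linear)+
qed

end

section \<open>Nonassociative bialgebras and their divisions\<close>

locale nonassoc_bialgebra = cocomm_coalgebra C
  for C :: "('k::field, 'a::ab_group_add, 'z) coalg_scheme" +
  fixes m :: "'a \<Rightarrow> 'a \<Rightarrow> 'a" (infixl \<open>\<odot>\<close> 70) and one :: 'a
  assumes m_bilinear: "bilinear_map C C C m" and one_mem [simp]: "one \<in> carr C"
    and one_m [simp]: "u \<in> carr C \<Longrightarrow> one \<odot> u = u" and m_one [simp]: "u \<in> carr C \<Longrightarrow> u \<odot> one = u"
    and comult_m: "u \<in> carr C \<Longrightarrow> v \<in> carr C \<Longrightarrow>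
      comult C (u \<odot> v) = sw2 C (\<lambda>u1 u2. sw2 C (\<lambda>v1 v2. tens C C (u1 \<odot> v1) (u2 \<odot> v2)) v) u"
    and counit_m [simp]: "u \<in> carr C \<Longrightarrow> v \<in> carr C \<Longrightarrow> counit C (u \<odot> v) = counit C u * counit C v"
    and comult_one: "comult C one = tens C C one one" and counit_one [simp]: "counit C one = 1"
begin

lemmas m_simps [simp] = bilinear_mapD(1-5)[OF m_bilinear]

lemma sw2_m:
  assumes E: "vspace E" and F: "bilinear_map C C E F" and u: "u \<in> carr C" and v: "v \<in> carr C"
  shows "sw2 C F (u \<odot> v) = sw2 C (\<lambda>u1 u2. sw2 C (\<lambda>v1 v2. F (u1 \<odot> v1) (u2 \<odot> v2)) v) u"
proof -
  interpret coalgebra_pair C C ..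
  show ?thesis by (rule sw2_bilinear_morphism[OF vspace E F _ u v comult_m[OF u v]]) simp
qed

lemma sw2_one: "vspace E \<Longrightarrow> bilinear_map C C E F \<Longrightarrow> sw2 C F one = F one one"
  using sw2_eq_sum[of E F "[(one, one)]" one] comult_one by simp

text \<open>The source of the left-right symmetry: the coproduct of a product does not see the order of
  the two nested sums.\<close>
lemma opposite: "nonassoc_bialgebra C (\<lambda>u v. v \<odot> u) one"
proof
  show "bilinear_map C C C (\<lambda>u v. v \<odot> u)"
    using m_bilinear by (auto simp: bilinear_map_def)
  show "comult C (v \<odot> u) = sw2 C (\<lambda>u1 u2. sw2 C (\<lambda>v1 v2. tens C C (v1 \<odot> u1) (v2 \<odot> u2)) v) u"
    if "u \<in> carr C" "v \<in> carr C" for u v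
    using that by (subst sw2_exchange) (rule comult_m)
qed (simp_all add: comult_one)

end

text \<open>Up to cocommutativity, a left division for \<open>m\<close> is a right division for the opposite of \<open>m\<close>, so
  this notion covers both.\<close>
definition divides_right ::
  "('k::field, 'a::ab_group_add, 'z) coalg_scheme \<Rightarrow> ('a \<Rightarrow> 'a \<Rightarrow> 'a) \<Rightarrow> ('a \<Rightarrow> 'a \<Rightarrow> 'a) \<Rightarrow> bool" where
  "divides_right C m d \<longleftrightarrow>
    bilinear_map C C C d \<and>
    (\<forall>u\<in>carr C. \<forall>v\<in>carr C.
      sw2 C (\<lambda>u1 u2. d (m v u1) u2) u = smult C (counit C u) v \<and>
      sw2 C (\<lambda>u1 u2. m (d v u1) u2) u = smult C (counit C u) v)"

locale right_loop_bialgebra = nonassoc_bialgebra C m one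
  for C :: "('k::field, 'a::ab_group_add, 'z) coalg_scheme" and m (infixl \<open>\<odot>\<close> 70) and one +
  fixes d :: "'a \<Rightarrow> 'a \<Rightarrow> 'a" (infixl \<open>\<oslash>\<close> 70)
  assumes divides: "divides_right C m d"
begin

lemma d_bilinear: "bilinear_map C C C d"
  using divides by (simp add: divides_right_def)

lemmas d_simps [simp] = bilinear_mapD(1-5)[OF d_bilinear]

lemma d_m: "u \<in> carr C \<Longrightarrow> v \<in> carr C \<Longrightarrow> sw2 C (\<lambda>u1 u2. (v \<odot> u1) \<oslash> u2) u = smult C (counit C u) v"
  and m_d: "u \<in> carr C \<Longrightarrow> v \<in> carr C \<Longrightarrow> sw2 C (\<lambda>u1 u2. (v \<oslash> u1) \<odot> u2) u = smult C (counit C u) v"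
  using divides by (auto simp: divides_right_def)

text \<open>Uniqueness of quotients makes division a morphism of coalgebras: \<open>\<Delta>(v / u)\<close> solves
  \<open>\<Sum>X(v, u\<^sub>(\<^sub>1\<^sub>)) \<Delta>(u\<^sub>(\<^sub>2\<^sub>)) = \<epsilon>(u) \<Delta>(v)\<close>, and dividing componentwise by \<open>\<Delta>(u)\<close> turns this
  equation into \<open>X(v, u) = \<Sum>v\<^sub>(\<^sub>1\<^sub>) / u\<^sub>(\<^sub>1\<^sub>) \<otimes> v\<^sub>(\<^sub>2\<^sub>) / u\<^sub>(\<^sub>2\<^sub>)\<close>. Below, \<open>\<Phi> p q w\<close> is the componentwise
  quotient of \<open>p \<otimes> q\<close> by \<open>\<Delta>(w)\<close>, fed into a bilinear map \<open>F\<close>.\<close>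
lemma sw2_d:
  assumes E: "vspace E" and F: "bilinear_map C C E F" and v: "v \<in> carr C" and u: "u \<in> carr C"
  shows "sw2 C F (v \<oslash> u) = sw2 C (\<lambda>v1 v2. sw2 C (\<lambda>u1 u2. F (v1 \<oslash> u1) (v2 \<oslash> u2)) u) v"
proof -
  note F_simps [simp] = bilinear_mapD(1-5)[OF F]
  note E_simps [simp] = vspaceD(2-)[OF E] smult_simps[OF E]
  define \<Phi> where "\<Phi> p q w = sw2 C (\<lambda>a b. F (p \<oslash> a) (q \<oslash> b)) w" for p q w
  have tri: "trilinear_map C C C E \<Phi>"
    unfolding \<Phi>_def trilinear_map_def bilinear_map_def
    by (intro conjI ballI linear_map_sw2_body[OF E] sw2_linear[OF E] bilinear_mapI)
      (simp_all add: linear_map_def)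
  note \<Phi> = trilinear_mapD[OF tri]
  have cancel: "sw2 C (\<lambda>r s. sw2 C (\<lambda>a b. \<Phi> (p \<odot> a) (q \<odot> b) s) r) w = smult E (counit C w) (F p q)"
    if p: "p \<in> carr C" and q: "q \<in> carr C" and w: "w \<in> carr C" for p q w
  proof -
    have quad: "quadrilinear_map C E (\<lambda>a b c e. F ((p \<odot> a) \<oslash> c) ((q \<odot> b) \<oslash> e))"
      using p q unfolding quadrilinear_map_def by (auto intro!: trilinear_mapI linear_mapI)
    have "sw2 C (\<lambda>r s. sw2 C (\<lambda>a b. \<Phi> (p \<odot> a) (q \<odot> b) s) r) w =
        sw2 C (\<lambda>r s. sw2 C (\<lambda>a b. sw2 C (\<lambda>c e. F ((p \<odot> a) \<oslash> b) ((q \<odot> c) \<oslash> e)) s) r) w"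
      unfolding \<Phi>_def by (rule middle_exchange[OF E quad w])
    also have "\<dots> = sw2 C (\<lambda>r s. F (sw2 C (\<lambda>a b. (p \<odot> a) \<oslash> b) r) (sw2 C (\<lambda>c e. (q \<odot> c) \<oslash> e) s)) w"
    proof (rule sw2_cong[OF w])
      fix r s assume r: "r \<in> carr C" and s: "s \<in> carr C"
      let ?y = "sw2 C (\<lambda>c e. (q \<odot> c) \<oslash> e) s"
      have y: "?y \<in> carr C" by (rule sw2_mem[OF vspace s]) (simp add: q)
      have "F (sw2 C (\<lambda>a b. (p \<odot> a) \<oslash> b) r) ?y = sw2 C (\<lambda>a b. F ((p \<odot> a) \<oslash> b) ?y) r"
        by (rule linear_sw2[OF vspace E bilinear_mapD(7)[OF F y] r]) (simp add: p)
      also have "\<dots> = sw2 C (\<lambda>a b. sw2 C (\<lambda>c e. F ((p \<odot> a) \<oslash> b) ((q \<odot> c) \<oslash> e)) s) r"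
        by (rule sw2_cong[OF r], rule linear_sw2[OF vspace E bilinear_mapD(6)[OF F] s])
          (simp_all add: p q)
      finally show "sw2 C (\<lambda>a b. sw2 C (\<lambda>c e. F ((p \<odot> a) \<oslash> b) ((q \<odot> c) \<oslash> e)) s) r =
        F (sw2 C (\<lambda>a b. (p \<odot> a) \<oslash> b) r) ?y" ..
    qed
    also have "\<dots> = sw2 C (\<lambda>r s. smult E (counit C r) (smult E (counit C s) (F p q))) w"
      by (rule sw2_cong[OF w]) (simp add: d_m p q, simp only: mult.commute)
    also have "\<dots> = smult E (counit C w) (F p q)"
      by (rule counit_left[OF E _ w]) (auto intro!: linear_mapI simp: p q mult.commute)
    finally show ?thesis .
  qed
  have "sw2 C F (v \<oslash> u) = sw2 C (\<lambda>r s. smult E (counit C s) (sw2 C F (v \<oslash> r))) u"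
    using v by (intro counit_right[OF E _ u, symmetric] linear_map_comp[OF sw2_linear[OF E F]])
      (auto intro: linear_mapI)
  \<comment> \<open>Multiply \<open>\<Delta>(v / r)\<close> by \<open>\<Delta>(s\<^sub>(\<^sub>1\<^sub>))\<close> and divide it by \<open>\<Delta>(s\<^sub>(\<^sub>2\<^sub>))\<close> again.\<close>
  also have "\<dots> = sw2 C (\<lambda>r s. sw2 C (\<lambda>p q. sw2 C (\<lambda>s1 s2. sw2 C (\<lambda>a b. \<Phi> (p \<odot> a) (q \<odot> b) s2) s1) s) (v \<oslash> r)) u"
    unfolding sw2_smult[OF E, symmetric]
    by (rule sw2_cong[OF u], rule sw2_cong) (simp_all only: d_simps v cancel)
  also have "\<dots> = sw2 C (\<lambda>r s. sw2 C (\<lambda>s1 s2. sw2 C (\<lambda>p q. sw2 C (\<lambda>a b. \<Phi> (p \<odot> a) (q \<odot> b) s2) s1) (v \<oslash> r)) s) u"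
    by (subst sw2_exchange) (rule refl)
  also have "\<dots> = sw2 C (\<lambda>r s. sw2 C (\<lambda>s1 s2. sw2 C (\<lambda>p q. \<Phi> p q s2) ((v \<oslash> r) \<odot> s1)) s) u"
    by (rule sw2_cong[OF u], rule sw2_cong, assumption, rule sw2_m[OF E \<Phi>(10), symmetric])
      (use v in simp_all)
  also have "\<dots> = sw2 C (\<lambda>w s2. sw2 C (\<lambda>r s1. sw2 C (\<lambda>p q. \<Phi> p q s2) ((v \<oslash> r) \<odot> s1)) w) u"
  proof (rule coassoc[OF E _ u, symmetric])
    have lin: "linear_map C E (\<lambda>s2. sw2 C (\<lambda>p q. \<Phi> p q s2) x)" if "x \<in> carr C" for x
      using \<Phi>(8) bilinear_mapD(6) by (intro linear_map_sw2_body[OF E that]) blast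
    show "trilinear_map C C C E (\<lambda>r s1 s2. sw2 C (\<lambda>p q. \<Phi> p q s2) ((v \<oslash> r) \<odot> s1))"
      using v lin linear_mapD[OF sw2_linear[OF E \<Phi>(10)]]
      unfolding trilinear_map_def bilinear_map_def
      by (auto intro!: linear_mapI)
  qed
  also have "\<dots> = sw2 C (\<lambda>w s2. sw2 C (\<lambda>p q. \<Phi> p q s2) (sw2 C (\<lambda>r s1. (v \<oslash> r) \<odot> s1) w)) u"
    by (rule sw2_cong[OF u], rule linear_sw2[OF vspace E sw2_linear[OF E \<Phi>(10)], symmetric])
      (use v in simp_all)
  also have "\<dots> = sw2 C (\<lambda>w s2. smult E (counit C w) (sw2 C (\<lambda>p q. \<Phi> p q s2) v)) u"
    by (rule sw2_cong[OF u]) (simp add: m_d v linear_mapD(3)[OF sw2_linear[OF E \<Phi>(10)]])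
  also have "\<dots> = sw2 C (\<lambda>p q. \<Phi> p q u) v"
    using \<Phi>(8) bilinear_mapD(6) by (intro counit_left[OF E _ u] linear_map_sw2_body[OF E v]) blast
  finally show ?thesis unfolding \<Phi>_def .
qed

end

section \<open>Existence of divisions\<close>

text \<open>A bilinear \<open>N\<close> is a linear map from the coalgebra to the endomorphisms of \<open>E\<close>; these are its powers
  in the convolution algebra of such maps.\<close>
primrec conv_power ::
  "('k::field, 'a::ab_group_add, 'y) coalg_scheme \<Rightarrow> ('k, 'e::ab_group_add, 'z) vspace_scheme \<Rightarrow>
    ('a \<Rightarrow> 'e \<Rightarrow> 'e) \<Rightarrow> nat \<Rightarrow> 'a \<Rightarrow> 'e \<Rightarrow> 'e" where
  "conv_power C E N 0 u w = smult E (counit C u) w"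
| "conv_power C E N (Suc n) u w = sw2 C (\<lambda>a b. conv_power C E N n a (N b w)) u"

context cocomm_coalgebra
begin

lemma conv_power_bilinear:
  assumes E: "vspace E" and N: "bilinear_map C E E N"
  shows "bilinear_map C E E (conv_power C E N n)"
proof (induction n)
  case 0
  show ?case
    by (intro bilinear_mapI) (auto simp: smult_simps[OF E] vspaceD[OF E] mult.commute)
next
  case (Suc n)
  note N_simps = bilinear_mapD(1-5)[OF N] and P = bilinear_mapD(1-5)[OF Suc]
  show ?case
    unfolding bilinear_map_def conv_power.simps
    by (intro conjI ballI linear_map_sw2_body[OF E] sw2_linear[OF E] bilinear_mapI linear_mapI)
      (simp_all add: N_simps P)
qed

lemma conv_power_Suc_left:
  assumes E: "vspace E" and N: "bilinear_map C E E N" and u: "u \<in> carr C" and w: "w \<in> carr E"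
  shows "conv_power C E N (Suc n) u w = sw2 C (\<lambda>a b. N a (conv_power C E N n b w)) u"
  using u w
proof (induction n arbitrary: u w)
  case (0 u w)
  note N_simps = bilinear_mapD(1-5)[OF N]
  have lin: "linear_map C E (\<lambda>x. N x w)" by (rule bilinear_mapD(7)[OF N 0(2)])
  have "sw2 C (\<lambda>a b. N a (smult E (counit C b) w)) u = sw2 C (\<lambda>a b. smult E (counit C b) (N a w)) u"
    by (rule sw2_cong[OF 0(1)]) (simp add: N_simps 0(2))
  then show ?case
    by (simp add: counit_left[OF E lin 0(1)] counit_right[OF E lin 0(1)])
next
  case (Suc n u w)
  note N_simps = bilinear_mapD(1-5)[OF N]
  note P = conv_power_bilinear[OF E N]
  note P_simps = bilinear_mapD(1-5)[OF P]
  have "conv_power C E N (Suc (Suc n)) u w = sw2 C (\<lambda>a b. sw2 C (\<lambda>c e. N c (conv_power C E N n e (N b w))) a) u"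
    unfolding conv_power.simps(2)[of _ _ _ "Suc n"]
    by (rule sw2_cong[OF Suc.prems(1)], rule Suc.IH) (simp_all add: N_simps Suc.prems)
  also have "\<dots> = sw2 C (\<lambda>c a. sw2 C (\<lambda>e b. N c (conv_power C E N n e (N b w))) a) u"
    by (rule coassoc[OF E _ Suc.prems(1)], rule trilinear_mapI) (simp_all add: N_simps P_simps Suc.prems)
  also have "\<dots> = sw2 C (\<lambda>c a. N c (conv_power C E N (Suc n) a w)) u"
    unfolding conv_power.simps
    by (rule sw2_cong[OF Suc.prems(1)], rule linear_sw2[OF E E bilinear_mapD(6)[OF N], symmetric])
      (simp_all add: N_simps P_simps Suc.prems)
  finally show ?case .
qed

end

lemma sum_list_unshuffles_zero:
  assumes "\<And>ys zs. (ys, zs) \<in> set (unshuffles xs) \<Longrightarrow> length ys + length zs = length xs \<Longrightarrow> f ys zs = 0"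
  shows "(\<Sum>(ys, zs)\<leftarrow>unshuffles xs. f ys zs) = (0 :: 'c::comm_monoid_add)"
proof -
  have len: "length ys + length zs = length xs" if "(ys, zs) \<in> set (unshuffles xs)" for ys zs
    using that by (induction xs arbitrary: ys zs) fastforce+
  then have "(\<Sum>(ys, zs)\<leftarrow>unshuffles xs. f ys zs) = (\<Sum>(ys, zs)\<leftarrow>unshuffles xs. 0)"
    using assms by (intro arg_cong[where f = sum_list] map_cong) auto
  then show ?thesis by (simp add: case_prod_unfold)
qed

locale irreducible_bialgebra = nonassoc_bialgebra C m one
  for C :: "('k::field, 'a::ab_group_add, 'z) coalg_scheme" and m (infixl \<open>\<odot>\<close> 70) and one +
  fixes V :: "('k, 'b::ab_group_add, 'y) vspace_scheme" and \<phi> :: "('k, 'b) symalg \<Rightarrow> 'a"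
  assumes V: "vspace V" and \<phi>: "coalg_hom (sym_coalg V) C \<phi>"
    and \<phi>_surj: "\<phi> ` carr (sym_coalg V) = carr C"
begin

abbreviation mon :: "'b list \<Rightarrow> 'a" where "mon xs \<equiv> \<phi> (monomial V xs)"

lemma sym_simps [simp]: "carr (sym_coalg V) = carr (symalg V)" "smult (sym_coalg V) = fscale"
  by (simp_all add: sym_coalg_def Let_def symalg_def)

lemma mon_mem [simp]: "set xs \<subseteq> carr V \<Longrightarrow> mon xs \<in> carr C"
  using coalg_homD(2)[OF \<phi>] monomial_in_symalg[of xs V] by simp

lemma comult_mon:
  assumes xs: "set xs \<subseteq> carr V"
  shows "comult C (mon xs) = (\<Sum>(ys, zs)\<leftarrow>unshuffles xs. tens C C (mon ys) (mon zs))"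
proof -
  let ?S = "symalg V"
  have S: "smult (sym_coalg V) = smult ?S" "carr (sym_coalg V) = carr ?S"
    by (simp_all add: symalg_def)
  have bil: "bilinear_map ?S ?S (tensor C C) (\<lambda>a b. tens C C (\<phi> a) (\<phi> b))"
    using coalg_homD(2,4,5)[OF \<phi>] bilinear_mapD(2-5)[OF tens_bilinear[of C C]]
    by (intro bilinear_mapI) (simp_all add: symalg_def)
  let ?ps = "map (\<lambda>(ys, zs). (monomial V ys, monomial V zs)) (unshuffles xs)"
  have ps: "set ?ps \<subseteq> carr ?S \<times> carr ?S"
    using xs unshuffles_subset by (fastforce intro!: monomial_in_symalg)
  have "comult C (mon xs) = tlift ?S ?S (\<lambda>a b. tens C C (\<phi> a) (\<phi> b)) (comult (sym_coalg V) (monomial V xs))"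
    using coalg_homD(6)[OF \<phi>, of "monomial V xs"] monomial_in_symalg[OF xs]
      by (simp add: sw2_def tlift_cong[OF S(1) S(1) S(2) S(2)])
  also have "comult (sym_coalg V) (monomial V xs) = (\<Sum>(a, b)\<leftarrow>?ps. tens ?S ?S a b)"
    by (simp add: sym_comult_monomial[OF V xs] case_prod_unfold comp_def)
  also have "tlift ?S ?S (\<lambda>a b. tens C C (\<phi> a) (\<phi> b)) \<dots> = (\<Sum>(a, b)\<leftarrow>?ps. tens C C (\<phi> a) (\<phi> b))"
    by (rule tlift_sum_tens[OF vspace_symalg vspace_symalg vspace_tensor bil ps])
  finally show ?thesis by (simp add: case_prod_unfold comp_def)
qed

lemma sw2_mon:
  assumes E: "vspace E" and F: "bilinear_map C C E F" and xs: "set xs \<subseteq> carr V"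
  shows "sw2 C F (mon xs) = (\<Sum>(ys, zs)\<leftarrow>unshuffles xs. F (mon ys) (mon zs))"
proof -
  let ?ps = "map (\<lambda>(ys, zs). (mon ys, mon zs)) (unshuffles xs)"
  have ps: "set ?ps \<subseteq> carr C \<times> carr C"
    using xs unshuffles_subset by (fastforce intro!: mon_mem)
  have "comult C (mon xs) = (\<Sum>(a, b)\<leftarrow>?ps. tens C C a b)"
    by (simp add: comult_mon[OF xs] case_prod_unfold comp_def)
  from sw2_eq_sum[OF E F ps this] show ?thesis by (simp add: case_prod_unfold comp_def)
qed

lemma counit_mon_Nil: "counit C (mon []) = 1"
proof -
  interpret P: coalgebra_pair C C ..
  have g: "sym_multilinear V (ground :: ('k, 'k) coalg) (\<lambda>xs. if xs = [] then 1 else 0)"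
    by (auto simp: sym_multilinear_def linear_map_def ground_def Let_def)
  have "counit (sym_coalg V) (monomial V []) = 1"
    using slift_sum_monomial[OF V P.vspace_ground g, of "[(1, [])]"]
    by (simp add: sym_coalg_def Let_def fscale_one) (simp add: ground_def Let_def)
  then show ?thesis using coalg_homD(3)[OF \<phi>, of "monomial V []"] monomial_in_symalg[of "[]" V] by simp
qed

lemma sum_of_monomials:
  assumes "u \<in> carr C"
  obtains ps where "\<forall>(c, xs)\<in>set ps. set xs \<subseteq> carr V" "u = (\<Sum>(c, xs)\<leftarrow>ps. smult C c (mon xs))"
proof -
  interpret F: vector_space "fscale :: 'k \<Rightarrow> ('k, 'b) symalg \<Rightarrow> _" by (rule vector_space_fscale)
  obtain p where p: "p \<in> carr (symalg V)" "u = \<phi> p" using \<phi>_surj assms by auto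
  have "p \<in> F.span {monomial V xs | xs. set xs \<subseteq> carr V}" using p(1) by (simp add: symalg_def)
  then have "\<exists>ps. (\<forall>(c, xs)\<in>set ps. set xs \<subseteq> carr V) \<and> p \<in> carr (symalg V) \<and>
      \<phi> p = (\<Sum>(c, xs)\<leftarrow>ps. smult C c (mon xs))"
  proof (induction rule: F.span_induct_alt)
    case base
    have "\<phi> 0 = 0" using linear_map_0[OF _ vspace coalg_homD(1)[OF \<phi>]] vspace_symalg[of V]
      by (simp add: vspace_def symalg_def)
    then show ?case using vspaceD(2)[OF vspace_symalg[of V]]
      by (intro exI[of _ "[]"]) (simp add: zero_fun_def[symmetric])
  next
    case (step c x y)
    then obtain xs ps where x: "x = monomial V xs" "set xs \<subseteq> carr V"
      and ps: "\<forall>(c, xs)\<in>set ps. set xs \<subseteq> carr V" "y \<in> carr (symalg V)"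
        "\<phi> y = (\<Sum>(c, xs)\<leftarrow>ps. smult C c (mon xs))" by auto
    have xm: "x \<in> carr (symalg V)" using x monomial_in_symalg by simp
    have cx: "fscale c x \<in> carr (symalg V)"
      using vspaceD(5)[OF vspace_symalg xm] by (simp add: symalg_def)
    have "\<phi> (fscale c x + y) = \<phi> (fscale c x) + \<phi> y" "\<phi> (fscale c x) = smult C c (\<phi> x)"
      using coalg_homD(4,5)[OF \<phi>] cx ps(2) xm by simp_all
    then show ?case using x ps cx vspaceD(3)[OF vspace_symalg cx ps(2)]
      by (intro exI[of _ "(c, xs) # ps"]) (auto simp del: plus_fun_apply)
  qed
  then show thesis using that p(2) by blast
qed

text \<open>An operator-valued function that vanishes at the empty monomial is locally nilpotent for
  convolution: each application of it takes away at least one factor of a monomial.\<close>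
lemma conv_power_mon:
  assumes E: "vspace E" and N: "bilinear_map C E E N" and N0: "\<And>w. w \<in> carr E \<Longrightarrow> N (mon []) w = 0"
    and "set xs \<subseteq> carr V" "length xs < n" "w \<in> carr E"
  shows "conv_power C E N n (mon xs) w = 0"
  using assms(4-)
proof (induction n arbitrary: xs w)
  case (Suc n)
  note N_simps = bilinear_mapD(1-5)[OF N]
  note P = conv_power_bilinear[OF E N]
  note P_simps = bilinear_mapD(1-5)[OF P]
  have bil: "bilinear_map C C E (\<lambda>a b. conv_power C E N n a (N b w))"
    by (intro bilinear_mapI) (simp_all add: N_simps P_simps Suc.prems)
  have "(\<Sum>(ys, zs)\<leftarrow>unshuffles xs. conv_power C E N n (mon ys) (N (mon zs) w)) = 0"
  proof (rule sum_list_unshuffles_zero)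
    fix ys zs assume yz: "(ys, zs) \<in> set (unshuffles xs)" "length ys + length zs = length xs"
    have sub: "set ys \<subseteq> carr V" "set zs \<subseteq> carr V" using unshuffles_subset[OF yz(1)] Suc.prems(1) by auto
    show "conv_power C E N n (mon ys) (N (mon zs) w) = 0"
    proof (cases "zs = []")
      case True
      have "conv_power C E N n (mon ys) 0 = 0"
        by (rule linear_map_0[OF E E bilinear_mapD(6)[OF P]]) (simp add: sub)
      then show ?thesis using True N0 Suc.prems by simp
    next
      case False
      then have "length ys < n" using yz(2) Suc.prems(2) by (cases zs) auto
      then show ?thesis using Suc.IH[OF sub(1)] N_simps(1) sub Suc.prems(3) by simp
    qed
  qed
  then show ?case by (simp add: sw2_mon[OF E bil Suc.prems(1)])
qed simp

lemma conv_power_nilpotent: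
  assumes E: "vspace E" and N: "bilinear_map C E E N" and N0: "\<And>w. w \<in> carr E \<Longrightarrow> N (mon []) w = 0"
    and u: "u \<in> carr C"
  shows "\<exists>n0. \<forall>n\<ge>n0. \<forall>w\<in>carr E. conv_power C E N n u w = 0"
proof -
  obtain ps where ps: "\<forall>(c, xs)\<in>set ps. set xs \<subseteq> carr V" "u = (\<Sum>(c, xs)\<leftarrow>ps. smult C c (mon xs))"
    using sum_of_monomials[OF u] .
  define n0 where "n0 = Suc (\<Sum>(c, xs)\<leftarrow>ps. length xs)"
  have "conv_power C E N n u w = 0" if n: "n \<ge> n0" and w: "w \<in> carr E" for n w
  proof -
    note P = conv_power_bilinear[OF E N, of n]
    have "conv_power C E N n u w = (\<Sum>(c, xs)\<leftarrow>ps. conv_power C E N n (smult C c (mon xs)) w)"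
      unfolding ps(2) case_prod_unfold using ps(1)
      by (intro linear_map_list[OF vspace E bilinear_mapD(7)[OF P w]]) (auto simp: case_prod_unfold)
    also have "\<dots> = (\<Sum>(c, xs)\<leftarrow>ps. 0)"
    proof (intro arg_cong[where f = sum_list] map_cong refl)
      fix p assume p: "p \<in> set ps"
      obtain c xs where [simp]: "p = (c, xs)" by (cases p)
      have "length xs \<le> (\<Sum>(c, xs)\<leftarrow>ps. length xs)"
        using member_le_sum_list[of "length xs" "map (\<lambda>(c, xs). length xs) ps"] p by force
      then have "length xs < n" using n by (simp add: n0_def)
      moreover have "set xs \<subseteq> carr V" using ps(1) p by auto
      ultimately show "(case p of (c, xs) \<Rightarrow> conv_power C E N n (smult C c (mon xs)) w) = (case p of (c, xs) \<Rightarrow> 0)"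
        using conv_power_mon[OF E N N0] w bilinear_mapD(5)[OF P] by (simp add: smult_simps[OF E])
    qed
    finally show ?thesis by (simp add: case_prod_unfold)
  qed
  then show ?thesis by blast
qed

text \<open>Both elements are group-like, and there is room for only one. Otherwise some linear functional \<open>\<lambda>\<close> would vanish at
  the empty monomial but not at the unit; its convolution powers take the value \<open>\<lambda>(1)\<^sup>n\<close> at the unit
  and so would never vanish there.\<close>
lemma mon_Nil: "mon [] = one"
proof (rule ccontr)
  interpret P: coalgebra_pair C C ..
  let ?K = "ground :: ('k, 'k) coalg"
  have K: "carr ?K = UNIV" "smult ?K = (*)" by (simp_all add: ground_def Let_def)
  let ?e = "mon []"
  assume "?e \<noteq> one"
  then have "one - ?e \<noteq> 0" by simp
  then obtain f where f: "Vector_Spaces.linear (smult C) (*) f" "f (one - ?e) \<noteq> 0"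
    by (rule separating_functional[OF vspaceD(1)[OF vspace]])
  note f_simps = linear_form_simps[OF f(1)]
  have f_diff: "f (x - y) = f x - f y" for x y
    using f_simps(1)[of "x - y" y] by simp
  define l where "l u = f (u - smult C (counit C u) ?e)" for u
  define N where "N u c = l u * c" for u and c :: 'k
  have N: "bilinear_map C ?K ?K N"
    unfolding N_def l_def
    by (intro bilinear_mapI) (simp_all add: K f_simps f_diff algebra_simps)
  have "l ?e = 0" using f_diff[of ?e ?e] by (simp add: l_def counit_mon_Nil smult_simps[OF vspace])
  then have N0: "N ?e c = 0" for c by (simp add: N_def)
  have l_one: "l one \<noteq> 0" using f(2) by (simp add: l_def smult_simps[OF vspace])
  have "conv_power C ?K N n one c = l one ^ n * c" for n c
  proof (induction n arbitrary: c)
    case (Suc n)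
    note P = bilinear_mapD(1-5)[OF conv_power_bilinear[OF P.vspace_ground N]]
    have "bilinear_map C C ?K (\<lambda>a b. conv_power C ?K N n a (N b c))"
      by (intro bilinear_mapI) (simp_all add: bilinear_mapD(1-5)[OF N, unfolded K] P[unfolded K] K)
    from sw2_one[OF P.vspace_ground this] show ?case
      using Suc[of "N one c"] by (simp add: N_def[of one] ac_simps)
  qed (simp add: K)
  moreover obtain n where "conv_power C ?K N n one 1 = 0"
    using conv_power_nilpotent[OF P.vspace_ground N N0 one_mem] by (auto simp: K)
  ultimately show False using l_one by simp
qed

text \<open>Right multiplication is a convolution-invertible function with values in the endomorphisms
  of \<open>C\<close>: it is the identity at the unit, so the inverse is a geometric series that is finite at
  each element.\<close>
lemma right_division_exists: "\<exists>d. divides_right C m d"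
proof -
  \<comment> \<open>With \<open>R\<close> for right multiplication, \<open>N = \<epsilon> - R\<close>, and \<open>d\<close> is the sum of all convolution powers of \<open>N\<close>.\<close>
  define N where "N u v = smult C (counit C u) v - v \<odot> u" for u v
  have N: "bilinear_map C C C N"
    unfolding N_def by (intro bilinear_mapI) (simp_all add: smult_simps[OF vspace] mult.commute)
  have N0: "N (mon []) w = 0" if "w \<in> carr C" for w
    using that by (simp add: N_def mon_Nil smult_simps[OF vspace])
  let ?p = "conv_power C C N"
  note P = conv_power_bilinear[OF vspace N]
  note P_simps [simp] = bilinear_mapD(1-5)[OF P] bilinear_mapD(1-5)[OF N]
  obtain h where h: "?p n u w = 0" if "u \<in> carr C" "h u \<le> n" "w \<in> carr C" for u n w
    using conv_power_nilpotent[OF vspace N N0] by metis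
  define d where "d v u = (\<Sum>n<h u. ?p n u v)" for v u
  have d_eq: "d v u = (\<Sum>n<M. ?p n u v)" if "h u \<le> M" "u \<in> carr C" "v \<in> carr C" for u v M
    unfolding d_def by (rule sum.mono_neutral_left) (use that h in auto)
  have sum_mem: "(\<Sum>n<M. g n) \<in> carr C" if "\<And>n. g n \<in> carr C" for g and M :: nat
    using that by (induction M) auto
  have smult_sum: "smult C c (\<Sum>n<M. g n) = (\<Sum>n<M. smult C c (g n))" for c g and M :: nat
    by (induction M) (simp_all add: smult_simps[OF vspace])
  have d: "bilinear_map C C C d"
  proof (rule bilinear_mapI)
    fix c x y y' assume *: "x \<in> carr C" "y \<in> carr C" "y' \<in> carr C"
    show "d x (y + y') = d x y + d x y'"
      using * d_eq[of "y + y'" "max (h (y + y')) (max (h y) (h y'))" x]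
        d_eq[of y "max (h (y + y')) (max (h y) (h y'))" x]
        d_eq[of y' "max (h (y + y')) (max (h y) (h y'))" x] by (simp add: sum.distrib)
  next
    fix c x y assume *: "x \<in> carr C" "y \<in> carr C"
    show "d x y \<in> carr C" using * by (simp add: d_def sum_mem)
    show "d x (smult C c y) = smult C c (d x y)"
      using * d_eq[of "smult C c y" "max (h (smult C c y)) (h y)" x]
        d_eq[of y "max (h (smult C c y)) (h y)" x] by (simp add: smult_sum)
    show "d (smult C c x) y = smult C c (d x y)"
      using * by (simp add: d_def smult_sum)
  qed (simp add: d_def sum.distrib)
  have sw2_sum: "sw2 C (\<lambda>a b. \<Sum>n<M. g n a b) u = (\<Sum>n<M. sw2 C (g n) u)" for g u and M :: nat
    by (induction M) (simp_all add: sw2_add, simp add: sw2_as_sum case_prod_unfold)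
  \<comment> \<open>A Sweedler sum has finitely many terms, so one truncation of the series serves all of them.\<close>
  have bound: "\<exists>M\<ge>h u. \<forall>p\<in>set (tlist C C (comult C u)). h (fst p) \<le> M \<and> h (snd p) \<le> M" for u
  proof -
    let ?L = "set (tlist C C (comult C u))"
    let ?A = "insert (h u) ((\<lambda>p. h (fst p)) ` ?L \<union> (\<lambda>p. h (snd p)) ` ?L)"
    have "\<forall>n\<in>?A. n \<le> Max ?A" by (intro ballI Max_ge) auto
    then show ?thesis by (intro exI[of _ "Max ?A"]) simp
  qed
  have telescope: "(\<Sum>n<M. ?p n u v - ?p (Suc n) u v) = smult C (counit C u) v"
    if "h u \<le> M" "u \<in> carr C" "v \<in> carr C" for M u v
    using sum_lessThan_telescope'[of "\<lambda>n. ?p n u v" M] h[OF that(2,1,3)] by simp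
  have sw2_list_cong: "sw2 C f u = sw2 C g u"
    if "u \<in> carr C" "\<And>p. p \<in> set (tlist C C (comult C u)) \<Longrightarrow> fst p \<in> carr C \<Longrightarrow> snd p \<in> carr C \<Longrightarrow>
      f (fst p) (snd p) = g (fst p) (snd p)" for f g :: "'a \<Rightarrow> 'a \<Rightarrow> 'a" and u
    unfolding sw2_as_sum case_prod_unfold using that tlist_mem[OF vspace vspace comult_simps[OF that(1)]]
    by (intro arg_cong[where f = sum_list] map_cong refl) blast
  have "sw2 C (\<lambda>a b. d (v \<odot> a) b) u = smult C (counit C u) v" if u: "u \<in> carr C" and v: "v \<in> carr C" for u v
  proof -
    obtain M where M: "h u \<le> M" "\<And>p. p \<in> set (tlist C C (comult C u)) \<Longrightarrow> h (fst p) \<le> M \<and> h (snd p) \<le> M"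
      using bound by blast
    have "sw2 C (\<lambda>a b. d (v \<odot> a) b) u = sw2 C (\<lambda>a b. \<Sum>n<M. ?p n b (v \<odot> a)) u"
      by (rule sw2_list_cong[OF u], rule d_eq) (use M(2) v in auto)
    also have "\<dots> = (\<Sum>n<M. sw2 C (\<lambda>a b. ?p n b (v \<odot> a)) u)" by (rule sw2_sum)
    also have "\<dots> = (\<Sum>n<M. ?p n u v - ?p (Suc n) u v)"
    proof (rule sum.cong[OF refl])
      fix n
      have "?p n b (v \<odot> a) = smult C (counit C a) (?p n b v) - ?p n b (N a v)"
        if a: "a \<in> carr C" and b: "b \<in> carr C" for a b
      proof -
        have "v \<odot> a = smult C (counit C a) v - N a v" by (simp add: N_def)
        then show ?thesis
          using linear_map_diff[OF vspace bilinear_mapD(6)[OF P b]] a b v by simp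
      qed
      then have "sw2 C (\<lambda>a b. ?p n b (v \<odot> a)) u =
          sw2 C (\<lambda>a b. smult C (counit C a) (?p n b v)) u - sw2 C (\<lambda>a b. ?p n b (N a v)) u"
        unfolding sw2_diff[symmetric] by (rule sw2_cong[OF u])
      moreover have "sw2 C (\<lambda>a b. smult C (counit C a) (?p n b v)) u = ?p n u v"
        by (rule counit_left[OF vspace bilinear_mapD(7)[OF P v] u])
      moreover have "sw2 C (\<lambda>a b. ?p n b (N a v)) u = ?p (Suc n) u v"
        unfolding conv_power.simps by (rule cocomm[OF vspace _ u], rule bilinear_mapI) (simp_all add: v)
      ultimately show "sw2 C (\<lambda>a b. ?p n b (v \<odot> a)) u = ?p n u v - ?p (Suc n) u v" by simp
    qed
    also have "\<dots> = smult C (counit C u) v" by (rule telescope[OF M(1) u v])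
    finally show ?thesis .
  qed
  moreover have "sw2 C (\<lambda>a b. d v a \<odot> b) u = smult C (counit C u) v" if u: "u \<in> carr C" and v: "v \<in> carr C" for u v
  proof -
    obtain M where M: "h u \<le> M" "\<And>p. p \<in> set (tlist C C (comult C u)) \<Longrightarrow> h (fst p) \<le> M \<and> h (snd p) \<le> M"
      using bound by blast
    have m_sum: "(\<Sum>n<M. g n) \<odot> b = (\<Sum>n<M. g n \<odot> b)" if "b \<in> carr C" "\<And>n. g n \<in> carr C" for g b and M :: nat
      using that linear_map_0[OF vspace vspace bilinear_mapD(7)[OF m_bilinear that(1)]]
      by (induction M) (simp_all add: sum_mem)
    have "sw2 C (\<lambda>a b. d v a \<odot> b) u = sw2 C (\<lambda>a b. \<Sum>n<M. ?p n a v \<odot> b) u"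
    proof (rule sw2_list_cong[OF u])
      fix p assume p: "p \<in> set (tlist C C (comult C u))" "fst p \<in> carr C" "snd p \<in> carr C"
      have "d v (fst p) = (\<Sum>n<M. ?p n (fst p) v)" by (rule d_eq) (use M(2) p v in auto)
      then show "d v (fst p) \<odot> snd p = (\<Sum>n<M. ?p n (fst p) v \<odot> snd p)"
        using m_sum p v by simp
    qed
    also have "\<dots> = (\<Sum>n<M. sw2 C (\<lambda>a b. ?p n a v \<odot> b) u)" by (rule sw2_sum)
    also have "\<dots> = (\<Sum>n<M. ?p n u v - ?p (Suc n) u v)"
    proof (rule sum.cong[OF refl])
      fix n
      have "sw2 C (\<lambda>a b. ?p n a v \<odot> b) u =
          sw2 C (\<lambda>a b. smult C (counit C b) (?p n a v)) u - sw2 C (\<lambda>a b. N b (?p n a v)) u"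
        unfolding sw2_diff[symmetric] by (rule sw2_cong[OF u]) (simp add: N_def)
      moreover have "sw2 C (\<lambda>a b. smult C (counit C b) (?p n a v)) u = ?p n u v"
        by (rule counit_right[OF vspace bilinear_mapD(7)[OF P v] u])
      moreover have "sw2 C (\<lambda>a b. N b (?p n a v)) u = ?p (Suc n) u v"
        unfolding conv_power_Suc_left[OF vspace N u v]
        by (rule cocomm[OF vspace _ u], rule bilinear_mapI) (simp_all add: v)
      ultimately show "sw2 C (\<lambda>a b. ?p n a v \<odot> b) u = ?p n u v - ?p (Suc n) u v" by simp
    qed
    also have "\<dots> = smult C (counit C u) v" by (rule telescope[OF M(1) u v])
    finally show ?thesis .
  qed
  ultimately show ?thesis using d unfolding divides_right_def by blast
qed

end

section \<open>Subcoalgebras\<close>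

lemma span_induct_subset:
  assumes "vspace V" "X \<subseteq> carr V" "x \<in> module.span (smult V) X"
    and "\<And>x. x \<in> X \<Longrightarrow> Q x" "Q 0"
    "\<And>x y. x \<in> carr V \<Longrightarrow> y \<in> carr V \<Longrightarrow> Q x \<Longrightarrow> Q y \<Longrightarrow> Q (x + y)"
    "\<And>c x. x \<in> carr V \<Longrightarrow> Q x \<Longrightarrow> Q (smult V c x)"
  shows "x \<in> carr V \<and> Q x"
proof -
  interpret V: vector_space "smult V" by (rule vspaceD[OF assms(1)])
  have "x \<in> V.span X" by (rule assms(3))
  then show ?thesis
    by (induction rule: V.span_induct_alt) (use assms vspaceD[OF assms(1)] in auto)
qed

lemma span_superset': "vspace V \<Longrightarrow> X \<subseteq> module.span (smult V) X"
proof -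
  assume V: "vspace V"
  interpret V: vector_space "smult V" by (rule vspaceD[OF V])
  show ?thesis by (rule V.span_superset)
qed

lemma tensor_mono:
  assumes "S \<subseteq> S'"
  shows "carr (tensor (V\<lparr>carr := S\<rparr>) (V\<lparr>carr := S\<rparr>)) \<subseteq> carr (tensor (V\<lparr>carr := S'\<rparr>) (V\<lparr>carr := S'\<rparr>))"
proof -
  interpret F: vector_space fscale by (rule vector_space_fscale)
  have *: "tens (V\<lparr>carr := S\<rparr>) (V\<lparr>carr := S\<rparr>) = tens (V\<lparr>carr := S'\<rparr>) (V\<lparr>carr := S'\<rparr>)"
    by (rule tens_cong) simp_all
  show ?thesis using assms unfolding tensor_def * by (auto intro!: F.span_mono)
qed

lemma tens_sub: "tens (V\<lparr>carr := S\<rparr>) (V\<lparr>carr := S\<rparr>) = tens V V"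
  by (rule tens_cong) simp_all

lemma tens_mem_span:
  assumes "vspace C" "a \<in> X" "b \<in> X"
  shows "tens C C a b \<in> carr (tensor (C\<lparr>carr := module.span (smult C) X\<rparr>) (C\<lparr>carr := module.span (smult C) X\<rparr>))"
proof -
  let ?S = "C\<lparr>carr := module.span (smult C) X\<rparr>"
  have "a \<in> carr ?S" "b \<in> carr ?S" using span_superset'[OF assms(1), of X] assms(2,3) by auto
  then show ?thesis using tens_mem[of a ?S b ?S] by (simp add: tens_sub)
qed

lemma subcoalgebraD:
  assumes "subcoalgebra C S" "vspace C"
  shows "S \<subseteq> carr C" "vspace (C\<lparr>carr := S\<rparr>)"
    "x \<in> S \<Longrightarrow> comult C x \<in> carr (tensor (C\<lparr>carr := S\<rparr>) (C\<lparr>carr := S\<rparr>))"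
  using assms by (auto simp: subcoalgebra_def vspace_def)

text \<open>For linear \<open>f\<close> and \<open>g\<close>, the largest subcoalgebra on which they agree. Both the kernel of \<open>\<pi>\<close> and the fibre product
  are of this form.\<close>
definition equalizer ::
  "('k::field, 'a::ab_group_add, 'z) coalg_scheme \<Rightarrow> ('a \<Rightarrow> 'b) \<Rightarrow> ('a \<Rightarrow> 'b) \<Rightarrow> 'a set" where
  "equalizer C f g = module.span (smult C) (\<Union>{S. subcoalgebra C S \<and> (\<forall>c\<in>S. f c = g c)})"

context coproduct_space
begin

lemma subcoalgebra_as_sum:
  assumes "subcoalgebra C S" "x \<in> S"
  obtains ps where "set ps \<subseteq> S \<times> S" "comult C x = (\<Sum>(a, b)\<leftarrow>ps. tens C C a b)"
  using tensor_sum_tens[OF subcoalgebraD(2)[OF assms(1) vspace] subcoalgebraD(2)[OF assms(1) vspace]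
      subcoalgebraD(3)[OF assms(1) vspace assms(2)]] that
  by (auto simp: tens_sub)

lemma sw2_subcoalgebra_mem:
  assumes S: "subcoalgebra C S" and x: "x \<in> S" and E: "vspace E" and F: "bilinear_map C C E F"
    and E': "vspace E'" "\<And>a b. a \<in> S \<Longrightarrow> b \<in> S \<Longrightarrow> F a b \<in> carr E'"
  shows "sw2 C F x \<in> carr E'"
proof -
  obtain ps where ps: "set ps \<subseteq> S \<times> S" "comult C x = (\<Sum>(a, b)\<leftarrow>ps. tens C C a b)"
    using subcoalgebra_as_sum[OF S x] .
  have "set ps \<subseteq> carr C \<times> carr C" using ps(1) subcoalgebraD(1)[OF S vspace] by auto
  from sw2_eq_sum[OF E F this ps(2)] show ?thesis
    using ps(1) E'(2) by (auto intro!: subspace_sum_list[OF E'(1)])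
qed

lemma sw2_subcoalgebra_cong:
  assumes S: "subcoalgebra C S" and x: "x \<in> S" and E: "vspace E"
    and F: "bilinear_map C C E F" "bilinear_map C C E G" "\<And>a b. a \<in> S \<Longrightarrow> b \<in> S \<Longrightarrow> F a b = G a b"
  shows "sw2 C F x = sw2 C G x"
proof -
  obtain ps where ps: "set ps \<subseteq> S \<times> S" "comult C x = (\<Sum>(a, b)\<leftarrow>ps. tens C C a b)"
    using subcoalgebra_as_sum[OF S x] .
  have ps': "set ps \<subseteq> carr C \<times> carr C" using ps(1) subcoalgebraD(1)[OF S vspace] by auto
  show ?thesis
    unfolding sw2_eq_sum[OF E F(1) ps' ps(2)] sw2_eq_sum[OF E F(2) ps' ps(2)]
    using ps(1) F(3) by (intro arg_cong[where f = sum_list] map_cong) auto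
qed

text \<open>The record of a subcoalgebra expands coproducts in its own, smaller carrier; the Sweedler sums
  are nevertheless those of the ambient coalgebra.\<close>
lemma sw2_restrict:
  assumes S: "subcoalgebra C S" and x: "x \<in> S" and E: "vspace E" and F: "bilinear_map C C E F"
  shows "sw2 (C\<lparr>carr := S\<rparr>) F x = sw2 C F x"
proof -
  obtain ps where ps: "set ps \<subseteq> S \<times> S" "comult C x = (\<Sum>(a, b)\<leftarrow>ps. tens C C a b)"
    using subcoalgebra_as_sum[OF S x] .
  have ps': "set ps \<subseteq> carr C \<times> carr C" using ps(1) subcoalgebraD(1)[OF S vspace] by auto
  have F': "bilinear_map (C\<lparr>carr := S\<rparr>) (C\<lparr>carr := S\<rparr>) E F"
    using F subcoalgebraD(1)[OF S vspace] by (auto simp: bilinear_map_def linear_map_def subset_iff)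
  show ?thesis
    unfolding sw2_eq_sum[OF E F ps' ps(2)]
    using tlift_sum_tens[OF subcoalgebraD(2)[OF S vspace] subcoalgebraD(2)[OF S vspace] E F', of ps] ps
    by (simp add: sw2_def tens_sub)
qed

lemma subcoalgebra_span:
  assumes X: "X \<subseteq> carr C" and
    D: "\<And>x. x \<in> X \<Longrightarrow> comult C x \<in> carr (tensor (C\<lparr>carr := module.span (smult C) X\<rparr>)
      (C\<lparr>carr := module.span (smult C) X\<rparr>))" (is "\<And>x. _ \<Longrightarrow> _ \<in> carr ?T")
  shows "subcoalgebra C (module.span (smult C) X)"
proof -
  interpret V: vector_space "smult C" by (rule vspaceD[OF vspace])
  have "x \<in> carr C \<and> comult C x \<in> carr ?T" if "x \<in> V.span X" for x
  proof (rule span_induct_subset[OF vspace X that])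
    show "comult C 0 \<in> carr ?T"
      using linear_map_0[OF vspace vspace_tensor comult_linear] vspaceD(2)[OF vspace_tensor] by simp
    show "comult C (x + y) \<in> carr ?T"
      if "x \<in> carr C" "y \<in> carr C" "comult C x \<in> carr ?T" "comult C y \<in> carr ?T" for x y
      using that vspaceD(3)[OF vspace_tensor] linear_mapD(2)[OF comult_linear] by simp
    show "comult C (smult C c x) \<in> carr ?T" if "x \<in> carr C" "comult C x \<in> carr ?T" for c x
      using that vspaceD(5)[OF vspace_tensor that(2)] linear_mapD(3)[OF comult_linear] by simp
  qed (use D in auto)
  then show ?thesis by (auto simp: subcoalgebra_def)
qed

lemma equal_on_span:
  assumes "vspace E" "linear_map C E f" "linear_map C E g" "X \<subseteq> carr C" "\<And>x. x \<in> X \<Longrightarrow> f x = g x"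
    "x \<in> module.span (smult C) X"
  shows "f x = g x"
  using span_induct_subset[OF vspace assms(4,6), of "\<lambda>x. f x = g x"] assms(5)
    linear_mapD(2,3)[OF assms(2)] linear_mapD(2,3)[OF assms(3)]
    linear_map_0[OF vspace assms(1,2)] linear_map_0[OF vspace assms(1,3)]
  by simp

lemma subcoalgebra_equalizer: "subcoalgebra C (equalizer C f g)"
  unfolding equalizer_def
proof (rule subcoalgebra_span)
  let ?U = "\<Union>{S. subcoalgebra C S \<and> (\<forall>c\<in>S. f c = g c)}"
  fix x assume "x \<in> ?U"
  then obtain S where S: "subcoalgebra C S" "\<forall>c\<in>S. f c = g c" "x \<in> S" by auto
  have "S \<subseteq> ?U" using S by auto
  also have "?U \<subseteq> module.span (smult C) ?U" by (rule span_superset'[OF vspace])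
  finally have "S \<subseteq> module.span (smult C) ?U" .
  from tensor_mono[OF this] subcoalgebraD(3)[OF S(1) vspace S(3)]
  show "comult C x \<in> carr (tensor (C\<lparr>carr := module.span (smult C) ?U\<rparr>)
      (C\<lparr>carr := module.span (smult C) ?U\<rparr>))" by (rule subsetD)
qed (auto simp: subcoalgebra_def)

lemma equalizer_eq:
  assumes "vspace E" "linear_map C E f" "linear_map C E g" "x \<in> equalizer C f g"
  shows "f x = g x"
  using assms(4) unfolding equalizer_def
  by (rule equal_on_span[OF assms(1-3), rotated 2]) (auto simp: subcoalgebra_def)

text \<open>All membership proofs for kernels and fibre products go through this criterion: it suffices that
  the coproducts of the elements of \<open>X\<close> can be written with elements of \<open>X\<close>, for then the span of
  \<open>X\<close> is one of the subcoalgebras in question.\<close>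
lemma subset_equalizer:
  assumes "vspace E" "linear_map C E f" "linear_map C E g" "X \<subseteq> carr C"
    "\<And>x. x \<in> X \<Longrightarrow> comult C x \<in> carr (tensor (C\<lparr>carr := module.span (smult C) X\<rparr>)
      (C\<lparr>carr := module.span (smult C) X\<rparr>))"
    "\<And>x. x \<in> X \<Longrightarrow> f x = g x"
  shows "X \<subseteq> equalizer C f g"
proof -
  let ?S = "module.span (smult C) X"
  have "subcoalgebra C ?S" by (rule subcoalgebra_span[OF assms(4,5)])
  moreover have "\<forall>c\<in>?S. f c = g c" using equal_on_span[OF assms(1-4,6)] by blast
  ultimately have "?S \<subseteq> \<Union>{S. subcoalgebra C S \<and> (\<forall>c\<in>S. f c = g c)}" by auto
  also have "\<dots> \<subseteq> equalizer C f g" unfolding equalizer_def by (rule span_superset'[OF vspace])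
  finally have "?S \<subseteq> equalizer C f g" .
  then show ?thesis using span_superset'[OF vspace, of X] by (rule order_trans[rotated])
qed

end

section \<open>Irreducible unital bialgebras\<close>

lemma unital_bialgebra_nonassoc:
  assumes "unital_bialgebra A"
  shows "nonassoc_bialgebra A (bmult A) (bunit A)"
proof -
  interpret cocomm_coalgebra A using assms by unfold_locales (simp add: unital_bialgebra_def)
  interpret P: coalgebra_pair A A ..
  let ?K = "ground :: ('a, 'a) coalg" and ?m = "tlift A A (bmult A)"
  have bil: "bilinear_map A A A (bmult A)" and one: "bunit A \<in> carr A"
    and hom: "coalg_hom (tensor_coalg A A) A ?m" and unit: "coalg_hom ?K A (\<lambda>c. smult A c (bunit A))"
    using assms by (auto simp: unital_bialgebra_def)
  have mt: "?m (tens A A u v) = bmult A u v" if "u \<in> carr A" "v \<in> carr A" for u v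
    by (rule tlift_tens[OF vspace vspace vspace bil that])
  note T = bilinear_mapD(2-5)[OF tens_bilinear[of A A]]
  show ?thesis
  proof
    show "bilinear_map A A A (bmult A)" "bunit A \<in> carr A" by fact+
    show "bmult A (bunit A) u = u" "bmult A u (bunit A) = u" if "u \<in> carr A" for u
      using assms that by (simp_all add: unital_bialgebra_def)
    fix u v assume u: "u \<in> carr A" and v: "v \<in> carr A"
    have uv: "tens A A u v \<in> carr (tensor_coalg A A)" using u v by simp
    have "bilinear_map (tensor_coalg A A) (tensor_coalg A A) (tensor A A) (\<lambda>s t. tens A A (?m s) (?m t))"
      using coalg_homD(2,4,5)[OF hom] by (intro bilinear_mapI) (simp_all add: T)
    from P.sw2_T_tens[OF vspace_tensor this u v]
    have "comult A (bmult A u v) = sw2 A (\<lambda>u1 u2. sw2 A (\<lambda>v1 v2.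
        tens A A (?m (tens A A u1 v1)) (?m (tens A A u2 v2))) v) u"
      using coalg_homD(6)[OF hom uv] mt[OF u v] by simp
    also have "\<dots> = sw2 A (\<lambda>u1 u2. sw2 A (\<lambda>v1 v2. tens A A (bmult A u1 v1) (bmult A u2 v2)) v) u"
      by (rule sw2_cong[OF u], rule sw2_cong[OF v]) (simp add: mt)
    finally show "comult A (bmult A u v) = sw2 A (\<lambda>u1 u2. sw2 A (\<lambda>v1 v2. tens A A (bmult A u1 v1) (bmult A u2 v2)) v) u" .
    show "counit A (bmult A u v) = counit A u * counit A v"
      using coalg_homD(3)[OF hom uv] by (simp add: mt u v)
  next
    have K: "carr ?K = UNIV" "smult ?K = (*)" "counit ?K = (\<lambda>c. c)" by (simp_all add: ground_def Let_def)
    have "\<exists>L :: ('a, 'a) vspace. smult L = (*) \<and> comult ?K 1 = tens L L 1 1"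
      by (simp add: ground_def Let_def) (metis vspace.select_convs(2))
    then have c1: "comult ?K 1 = tens ?K ?K 1 1" using tens_cong K(2) by metis
    have F: "bilinear_map ?K ?K (tensor A A) (\<lambda>c d. tens A A (smult A c (bunit A)) (smult A d (bunit A)))"
      using one by (intro bilinear_mapI)
        (simp_all add: K T smult_simps[OF vspace] smult_simps[OF vspace_tensor, simplified]
          vspaceD(5)[OF vspace_tensor, simplified] ac_simps)
    have "comult A (smult A 1 (bunit A)) = tens A A (smult A 1 (bunit A)) (smult A 1 (bunit A))"
      using coalg_homD(6)[OF unit, of 1] tlift_tens[OF P.vspace_ground P.vspace_ground vspace_tensor F, of 1 1]
      by (simp add: sw2_def c1 K)
    then show "comult A (bunit A) = tens A A (bunit A) (bunit A)" by (simp add: smult_simps[OF vspace])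
    show "counit A (bunit A) = 1"
      using coalg_homD(3)[OF unit, of 1] by (simp add: K smult_simps[OF vspace])
  qed
qed

lemma IBialg_irreducible:
  assumes "IBialg A"
  obtains \<phi> where "irreducible_bialgebra A (bmult A) (bunit A) (A\<lparr>carr := Prim A\<rparr>) \<phi>"
proof -
  interpret nonassoc_bialgebra A "bmult A" "bunit A"
    using assms by (intro unital_bialgebra_nonassoc) (simp add: IBialg_def)
  let ?V = "A\<lparr>carr := Prim A\<rparr>"
  obtain \<phi> where \<phi>: "coalg_hom (sym_coalg ?V) A \<phi>" "bij_betw \<phi> (carr (sym_coalg ?V)) (carr A)"
    using assms by (auto simp: IBialg_def)
  interpret vs: vector_space "smult A" by (rule vspaceD[OF vspace])
  note T = bilinear_mapD(2-5)[OF tens_bilinear[of A A]]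
  have t0: "tens A A 0 (bunit A) = 0" "tens A A (bunit A) 0 = 0"
    using linear_map_0[OF vspace vspace_tensor bilinear_mapD(7)[OF tens_bilinear[of A A]]]
      linear_map_0[OF vspace vspace_tensor bilinear_mapD(6)[OF tens_bilinear[of A A]]] by auto
  have "vs.subspace (Prim A)"
    using linear_map_0[OF vspace vspace_tensor comult_linear] linear_mapD(2,3)[OF comult_linear]
      smult_simps(1)[OF vspace_tensor[of A A]]
    by (auto simp: vs.subspace_def Prim_def T t0 ac_simps simp del: plus_fun_apply)
  then have "vspace ?V" using vspace by (simp add: vspace_def)
  then have "irreducible_bialgebra A (bmult A) (bunit A) ?V \<phi>"
    using \<phi> by unfold_locales (auto simp: bij_betw_def)
  then show thesis by (rule that)
qed

lemma rdiv_divides_right: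
  assumes "IBialg A"
  shows "divides_right A (bmult A) (rdiv A)"
proof -
  obtain \<phi> where "irreducible_bialgebra A (bmult A) (bunit A) (A\<lparr>carr := Prim A\<rparr>) \<phi>"
    using IBialg_irreducible[OF assms] .
  then interpret irreducible_bialgebra A "bmult A" "bunit A" "A\<lparr>carr := Prim A\<rparr>" \<phi> .
  have "\<exists>d. right_division A d"
    using right_division_exists unfolding divides_right_def right_division_def by blast
  then have "right_division A (rdiv A)" unfolding rdiv_def by (rule someI_ex)
  then show ?thesis by (auto simp: divides_right_def right_division_def)
qed

lemma ldiv_divides_right:
  assumes "IBialg A"
  shows "divides_right A (\<lambda>u v. bmult A v u) (\<lambda>v u. ldiv A u v)"
proof -
  obtain \<phi> where "irreducible_bialgebra A (bmult A) (bunit A) (A\<lparr>carr := Prim A\<rparr>) \<phi>"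
    using IBialg_irreducible[OF assms] .
  then interpret irreducible_bialgebra A "bmult A" "bunit A" "A\<lparr>carr := Prim A\<rparr>" \<phi> .
  interpret op: nonassoc_bialgebra A "\<lambda>u v. bmult A v u" "bunit A" by (rule opposite)
  interpret op: irreducible_bialgebra A "\<lambda>u v. bmult A v u" "bunit A" "A\<lparr>carr := Prim A\<rparr>" \<phi>
    by unfold_locales (rule V \<phi> \<phi>_surj)+
  have swap: "bilinear_map A A A d \<longleftrightarrow> bilinear_map A A A (\<lambda>u v. d v u)" for d
    by (auto simp: bilinear_map_def)
  have comm: "sw2 A (\<lambda>u1 u2. d u1 (bmult A u2 v)) u = sw2 A (\<lambda>u1 u2. d u2 (bmult A u1 v)) u"
    "sw2 A (\<lambda>u1 u2. bmult A u1 (d u2 v)) u = sw2 A (\<lambda>u1 u2. bmult A u2 (d u1 v)) u"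
    if d: "bilinear_map A A A d" and u: "u \<in> carr A" and v: "v \<in> carr A" for d u v
    using v bilinear_mapD(1-5)[OF d]
    by (auto intro!: cocomm[OF vspace _ u, symmetric] bilinear_mapI)
  have iff: "left_division A d \<longleftrightarrow> divides_right A (\<lambda>u v. bmult A v u) (\<lambda>v u. d u v)" for d
    unfolding left_division_def divides_right_def swap[of d] using comm[of d] swap[of d] by auto
  obtain d' where "divides_right A (\<lambda>u v. bmult A v u) d'" using op.right_division_exists by blast
  then have "left_division A (\<lambda>u v. d' v u)" unfolding iff by simp
  then have "left_division A (ldiv A)" unfolding ldiv_def by (rule someI[of "left_division A"])
  then show ?thesis unfolding iff .
qed

section \<open>The product on the tensor square\<close>

context nonassoc_bialgebra
begin

sublocale SQ: coalgebra_pair C C ..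

abbreviation tt (infix \<open>\<otimes>\<close> 70) where "a \<otimes> b \<equiv> tens C C a b"

definition star (infixl \<open>\<star>\<close> 70) where
  "s \<star> t = tlift C C (\<lambda>a b. tlift C C (\<lambda>a' b'. (a \<odot> a') \<otimes> (b \<odot> b')) t) s"

lemma star_bilinear: "bilinear_map SQ.T SQ.T SQ.T star"
proof -
  have lin: "linear_map SQ.T SQ.T (\<lambda>t. tlift C C (\<lambda>a' b'. (a \<odot> a') \<otimes> (b \<odot> b')) t)"
    if "a \<in> carr C" "b \<in> carr C" for a b
    unfolding SQ.linear_T
    by (rule tlift_linear[OF vspace vspace SQ.vspace_T], rule bilinear_mapI) (simp_all add: that)
  show ?thesis
    unfolding bilinear_map_def star_def
  proof (intro conjI ballI)
    fix s assume "s \<in> carr SQ.T"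
    then show "linear_map SQ.T SQ.T (\<lambda>t. tlift C C (\<lambda>a b. tlift C C (\<lambda>a' b'. (a \<odot> a') \<otimes> (b \<odot> b')) t) s)"
      by (intro linear_map_tlift_body[OF vspace vspace SQ.vspace_T] lin) simp_all
  next
    fix t assume "t \<in> carr SQ.T"
    then have "bilinear_map C C SQ.T (\<lambda>a b. tlift C C (\<lambda>a' b'. (a \<odot> a') \<otimes> (b \<odot> b')) t)"
      unfolding bilinear_map_def
      by (intro conjI ballI linear_map_tlift_body[OF vspace vspace SQ.vspace_T] linear_mapI) simp_all
    then show "linear_map SQ.T SQ.T (\<lambda>s. tlift C C (\<lambda>a b. tlift C C (\<lambda>a' b'. (a \<odot> a') \<otimes> (b \<odot> b')) t) s)"
      unfolding SQ.linear_T by (rule tlift_linear[OF vspace vspace SQ.vspace_T])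
  qed
qed

lemmas star_simps [simp] = bilinear_mapD(1-5)[OF star_bilinear, unfolded SQ.T_simps]

lemma star_tens [simp]:
  assumes "a \<in> carr C" "b \<in> carr C" "a' \<in> carr C" "b' \<in> carr C"
  shows "(a \<otimes> b) \<star> (a' \<otimes> b') = (a \<odot> a') \<otimes> (b \<odot> b')"
proof -
  have b2: "bilinear_map C C SQ.T (\<lambda>a' b'. (a \<odot> a') \<otimes> (b \<odot> b'))" if "a \<in> carr C" "b \<in> carr C" for a b
    by (rule bilinear_mapI) (simp_all add: that)
  have "bilinear_map C C SQ.T (\<lambda>a b. tlift C C (\<lambda>a' b'. (a \<odot> a') \<otimes> (b \<odot> b')) (a' \<otimes> b'))"
    using assms(3,4) unfolding bilinear_map_def
    by (intro conjI ballI linear_map_tlift_body[OF vspace vspace SQ.vspace_T] linear_mapI) simp_all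
  from tlift_tens[OF vspace vspace SQ.vspace_T this assms(1,2)]
    tlift_tens[OF vspace vspace SQ.vspace_T b2[OF assms(1,2)] assms(3,4)]
  show ?thesis by (simp add: star_def)
qed

lemma sw2_star:
  assumes E: "vspace E" and F: "bilinear_map SQ.T SQ.T E F"
    and s: "s \<in> carr (tensor C C)" and t: "t \<in> carr (tensor C C)"
  shows "sw2 SQ.T F (s \<star> t) = sw2 SQ.T (\<lambda>s1 s2. sw2 SQ.T (\<lambda>t1 t2. F (s1 \<star> t1) (s2 \<star> t2)) t) s"
proof -
  note F_simps [simp] = bilinear_mapD(1-5)[OF F, unfolded SQ.T_simps]
  have bil: "bilinear_map SQ.T SQ.T E (\<lambda>t1 t2. F (s1 \<star> t1) (s2 \<star> t2))"
    if "s1 \<in> carr (tensor C C)" "s2 \<in> carr (tensor C C)" for s1 s2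
    by (rule bilinear_mapI) (simp_all add: that)
  have bil': "bilinear_map SQ.T SQ.T E (\<lambda>s1 s2. F (s1 \<star> t1) (s2 \<star> t2))"
    if "t1 \<in> carr (tensor C C)" "t2 \<in> carr (tensor C C)" for t1 t2
    by (rule bilinear_mapI) (simp_all add: that)
  have lin_r: "linear_map SQ.T E (\<lambda>t. sw2 SQ.T (\<lambda>s1 s2. sw2 SQ.T (\<lambda>t1 t2. F (s1 \<star> t1) (s2 \<star> t2)) t) s)"
    if "s \<in> carr (tensor C C)" for s
    using that by (intro SQ.T.linear_map_sw2_body[OF E] SQ.T.sw2_linear[OF E] bil) simp_all
  have lin_l: "linear_map SQ.T E (\<lambda>s. sw2 SQ.T (\<lambda>s1 s2. sw2 SQ.T (\<lambda>t1 t2. F (s1 \<star> t1) (s2 \<star> t2)) t) s)"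
    using t by (intro SQ.T.sw2_linear[OF E] SQ.T.bilinear_map_sw2_body[OF E] bil') simp_all
  show ?thesis
  proof (rule SQ.T_eqI[OF E _ lin_l _ s])
    show "linear_map SQ.T E (\<lambda>s. sw2 SQ.T F (s \<star> t))"
      using t by (intro linear_map_comp[OF SQ.T.sw2_linear[OF E F]] linear_mapI) simp_all
    fix a b assume a: "a \<in> carr C" and b: "b \<in> carr C"
    have ab: "a \<otimes> b \<in> carr (tensor C C)" using a b by simp
    show "sw2 SQ.T F ((a \<otimes> b) \<star> t) =
      sw2 SQ.T (\<lambda>s1 s2. sw2 SQ.T (\<lambda>t1 t2. F (s1 \<star> t1) (s2 \<star> t2)) t) (a \<otimes> b)"
    proof (rule SQ.T_eqI[OF E _ lin_r[OF ab] _ t])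
      show "linear_map SQ.T E (\<lambda>t. sw2 SQ.T F ((a \<otimes> b) \<star> t))"
        using ab by (intro linear_map_comp[OF SQ.T.sw2_linear[OF E F]] linear_mapI) simp_all
      fix a' b' assume a': "a' \<in> carr C" and b': "b' \<in> carr C"
      have t': "a' \<otimes> b' \<in> carr (tensor C C)" using a' b' by simp
      have "sw2 SQ.T F ((a \<otimes> b) \<star> (a' \<otimes> b')) =
          sw2 C (\<lambda>x1 x2. sw2 C (\<lambda>y1 y2. F (x1 \<otimes> y1) (x2 \<otimes> y2)) (b \<odot> b')) (a \<odot> a')"
        using a b a' b' by (simp add: SQ.sw2_T_tens[OF E F])
      also have "\<dots> = sw2 C (\<lambda>x1 x2. sw2 C (\<lambda>b1 b2. sw2 C (\<lambda>c1 c2.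
          F (x1 \<otimes> (b1 \<odot> c1)) (x2 \<otimes> (b2 \<odot> c2))) b') b) (a \<odot> a')"
        by (rule sw2_cong, simp add: a a',
            rule sw2_m[OF E SQ.bilinear_pure_tensors(1)[OF F _ vs(1) _ vs(1)] b b'])
      also have "\<dots> = sw2 C (\<lambda>a1 a2. sw2 C (\<lambda>e1 e2. sw2 C (\<lambda>b1 b2. sw2 C (\<lambda>c1 c2.
          F ((a1 \<odot> e1) \<otimes> (b1 \<odot> c1)) ((a2 \<odot> e2) \<otimes> (b2 \<odot> c2))) b') b) a') a"
        using b b' by (intro sw2_m[OF E _ a a'] bilinear_map_sw2_body[OF E] bilinear_mapI) simp_all
      also have "\<dots> = sw2 C (\<lambda>a1 a2. sw2 C (\<lambda>b1 b2. sw2 C (\<lambda>e1 e2. sw2 C (\<lambda>c1 c2.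
          F ((a1 \<odot> e1) \<otimes> (b1 \<odot> c1)) ((a2 \<odot> e2) \<otimes> (b2 \<odot> c2))) b') a') b) a"
        by (subst (2) sw2_exchange) (rule refl)
      also have "\<dots> = sw2 C (\<lambda>a1 a2. sw2 C (\<lambda>b1 b2. sw2 SQ.T (\<lambda>t1 t2.
          F ((a1 \<otimes> b1) \<star> t1) ((a2 \<otimes> b2) \<star> t2)) (a' \<otimes> b')) b) a"
      proof (rule sw2_cong[OF a], rule sw2_cong[OF b])
        fix a1 a2 b1 b2 assume *: "a1 \<in> carr C" "a2 \<in> carr C" "b1 \<in> carr C" "b2 \<in> carr C"
        have "sw2 SQ.T (\<lambda>t1 t2. F ((a1 \<otimes> b1) \<star> t1) ((a2 \<otimes> b2) \<star> t2)) (a' \<otimes> b') =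
          sw2 C (\<lambda>e1 e2. sw2 C (\<lambda>c1 c2. F ((a1 \<otimes> b1) \<star> (e1 \<otimes> c1)) ((a2 \<otimes> b2) \<star> (e2 \<otimes> c2))) b') a'"
          using * by (intro SQ.sw2_T_tens[OF E bil a' b']) simp_all
        also have "\<dots> = sw2 C (\<lambda>e1 e2. sw2 C (\<lambda>c1 c2.
            F ((a1 \<odot> e1) \<otimes> (b1 \<odot> c1)) ((a2 \<odot> e2) \<otimes> (b2 \<odot> c2))) b') a'"
          by (rule sw2_cong[OF a'], rule sw2_cong[OF b']) (simp add: *)
        finally show "sw2 C (\<lambda>e1 e2. sw2 C (\<lambda>c1 c2.
            F ((a1 \<odot> e1) \<otimes> (b1 \<odot> c1)) ((a2 \<odot> e2) \<otimes> (b2 \<odot> c2))) b') a' =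
          sw2 SQ.T (\<lambda>t1 t2. F ((a1 \<otimes> b1) \<star> t1) ((a2 \<otimes> b2) \<star> t2)) (a' \<otimes> b')" ..
      qed
      also have "\<dots> = sw2 SQ.T (\<lambda>s1 s2. sw2 SQ.T (\<lambda>t1 t2. F (s1 \<star> t1) (s2 \<star> t2)) (a' \<otimes> b')) (a \<otimes> b)"
        using t' by (intro SQ.sw2_T_tens[OF E _ a b, symmetric] SQ.T.bilinear_map_sw2_body[OF E] bil') simp_all
      finally show "sw2 SQ.T F ((a \<otimes> b) \<star> (a' \<otimes> b')) =
        sw2 SQ.T (\<lambda>s1 s2. sw2 SQ.T (\<lambda>t1 t2. F (s1 \<star> t1) (s2 \<star> t2)) (a' \<otimes> b')) (a \<otimes> b)" .
    qed
  qed
qed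

text \<open>The products of the elements of two subcoalgebras span a subcoalgebra, on which multiplicative
  maps agree if they agree on the factors.\<close>
lemma star_equalizer:
  assumes E: "vspace E" and f: "linear_map SQ.T E f" and g: "linear_map SQ.T E g"
    and mult: "\<And>s t. s \<in> carr (tensor C C) \<Longrightarrow> t \<in> carr (tensor C C) \<Longrightarrow> f (s \<star> t) = n (f s) (f t)"
      "\<And>s t. s \<in> carr (tensor C C) \<Longrightarrow> t \<in> carr (tensor C C) \<Longrightarrow> g (s \<star> t) = n (g s) (g t)"
    and s: "s \<in> equalizer SQ.T f g" and t: "t \<in> equalizer SQ.T f g"
  shows "s \<star> t \<in> equalizer SQ.T f g"
proof -
  let ?P = "equalizer SQ.T f g"
  let ?X = "{s \<star> t | s t. s \<in> ?P \<and> t \<in> ?P}"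
  note P = SQ.T.subcoalgebra_equalizer[of f g]
  have sub: "?P \<subseteq> carr (tensor C C)" using subcoalgebraD(1)[OF P SQ.vspace_T] by simp
  let ?S = "SQ.T\<lparr>carr := module.span (smult SQ.T) ?X\<rparr>"
  have "?X \<subseteq> ?P"
  proof (rule SQ.T.subset_equalizer[OF E f g])
    show "?X \<subseteq> carr SQ.T" using sub by (auto simp: subset_iff)
    fix w assume "w \<in> ?X"
    then obtain s t where st: "w = s \<star> t" "s \<in> ?P" "t \<in> ?P" by auto
    have st': "s \<in> carr (tensor C C)" "t \<in> carr (tensor C C)" using st sub by auto
    show "f w = g w"
      using st mult st' SQ.T.equalizer_eq[OF E f g] by simp
    let ?F = "tens SQ.T SQ.T"
    note F = tens_bilinear[of SQ.T SQ.T]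
    note F_simps = bilinear_mapD(1-5)[OF F, unfolded SQ.T_simps]
    have "comult SQ.T w = sw2 SQ.T (\<lambda>s1 s2. sw2 SQ.T (\<lambda>t1 t2. ?F (s1 \<star> t1) (s2 \<star> t2)) t) s"
      using SQ.T.sw2_tens[of w] sw2_star[OF vspace_tensor F st'] st st' by simp
    also have "\<dots> \<in> carr (tensor ?S ?S)"
    proof (rule SQ.T.sw2_subcoalgebra_mem[OF P st(2) vspace_tensor _ vspace_tensor])
      show "bilinear_map SQ.T SQ.T (tensor SQ.T SQ.T) (\<lambda>s1 s2. sw2 SQ.T (\<lambda>t1 t2. ?F (s1 \<star> t1) (s2 \<star> t2)) t)"
        using st' by (intro SQ.T.bilinear_map_sw2_body[OF vspace_tensor] bilinear_mapI) (simp_all add: F_simps)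
      fix s1 s2 assume s12: "s1 \<in> ?P" "s2 \<in> ?P"
      show "sw2 SQ.T (\<lambda>t1 t2. ?F (s1 \<star> t1) (s2 \<star> t2)) t \<in> carr (tensor ?S ?S)"
      proof (rule SQ.T.sw2_subcoalgebra_mem[OF P st(3) vspace_tensor _ vspace_tensor])
        show "bilinear_map SQ.T SQ.T (tensor SQ.T SQ.T) (\<lambda>t1 t2. ?F (s1 \<star> t1) (s2 \<star> t2))"
          using s12 sub by (intro bilinear_mapI) (auto simp: F_simps subset_iff)
        fix t1 t2 assume "t1 \<in> ?P" "t2 \<in> ?P"
        then have "s1 \<star> t1 \<in> ?X" "s2 \<star> t2 \<in> ?X" using s12 by auto
        then show "?F (s1 \<star> t1) (s2 \<star> t2) \<in> carr (tensor ?S ?S)" by (rule tens_mem_span[OF SQ.vspace_T])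
      qed
    qed
    finally show "comult SQ.T w \<in> carr (tensor ?S ?S)" .
  qed
  then show ?thesis using s t by blast
qed

end

lemma star_opposite:
  "nonassoc_bialgebra C m one \<Longrightarrow>
    nonassoc_bialgebra.star C (\<lambda>u v. m v u) s t = nonassoc_bialgebra.star C m t s"
proof -
  assume "nonassoc_bialgebra C m one"
  then interpret nonassoc_bialgebra C m one .
  interpret op: nonassoc_bialgebra C "\<lambda>u v. m v u" one by (rule opposite)
  show ?thesis unfolding star_def op.star_def tlift_as_sum case_prod_unfold by (rule sum_list_exchange)
qed

section \<open>Quotients of families by a morphism\<close>

text \<open>Both \<open>r\<close> and \<open>s\<close> have the form \<open>Q(x, \<delta>) = \<Sum>G(x, \<delta>\<^sub>(\<^sub>1\<^sub>)) / \<mu>(\<delta>\<^sub>(\<^sub>2\<^sub>))\<close>, where \<open>\<delta> = b \<otimes> b'\<close> and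
  \<open>\<mu>(\<delta>) = bb'\<close>: for \<open>r\<close> one takes \<open>G(x, \<delta>) = (xb)b'\<close> and for \<open>s\<close> one takes \<open>G(x, \<delta>) = b(xb')\<close>.\<close>
locale morphism_quotient = right_loop_bialgebra C m one d + D: cocomm_coalgebra D
  for C :: "('k::field, 'a::ab_group_add, 'z) coalg_scheme" and m (infixl \<open>\<odot>\<close> 70) and one
    and d (infixl \<open>\<oslash>\<close> 70) and D :: "('k, 'd::ab_group_add, 'y) coalg_scheme" +
  fixes \<mu> :: "'d \<Rightarrow> 'a" and G :: "'a \<Rightarrow> 'd \<Rightarrow> 'a"
  assumes \<mu>: "coalg_hom D C \<mu>" and G_bilinear: "bilinear_map C D C G"
    and comult_G: "x \<in> carr C \<Longrightarrow> \<delta> \<in> carr D \<Longrightarrow>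
      comult C (G x \<delta>) = sw2 C (\<lambda>x1 x2. sw2 D (\<lambda>\<delta>1 \<delta>2. tens C C (G x1 \<delta>1) (G x2 \<delta>2)) \<delta>) x"
begin

sublocale CD: coalgebra_pair C D ..

lemmas \<mu>_simps [simp] = coalg_homD(2-5)[OF \<mu>]
lemmas G_simps [simp] = bilinear_mapD(1-5)[OF G_bilinear]

lemma sw2_\<mu>:
  "vspace E \<Longrightarrow> bilinear_map C C E F \<Longrightarrow> \<delta> \<in> carr D \<Longrightarrow>
    sw2 C F (\<mu> \<delta>) = sw2 D (\<lambda>\<delta>1 \<delta>2. F (\<mu> \<delta>1) (\<mu> \<delta>2)) \<delta>"
  by (rule sw2_coalg_hom[OF D.vspace D.comult_linear vspace \<mu>])

lemma sw2_G:
  assumes "vspace E" "bilinear_map C C E F" "x \<in> carr C" "\<delta> \<in> carr D"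
  shows "sw2 C F (G x \<delta>) = sw2 C (\<lambda>x1 x2. sw2 D (\<lambda>\<delta>1 \<delta>2. F (G x1 \<delta>1) (G x2 \<delta>2)) \<delta>) x"
  by (rule CD.sw2_bilinear_morphism[OF vspace assms(1,2) _ assms(3,4) comult_G[OF assms(3,4)]]) simp

definition Q :: "'a \<Rightarrow> 'd \<Rightarrow> 'a" where
  "Q x \<delta> = sw2 D (\<lambda>\<delta>1 \<delta>2. G x \<delta>1 \<oslash> \<mu> \<delta>2) \<delta>"

lemma Q_bilinear: "bilinear_map C D C Q"
  unfolding bilinear_map_def Q_def
  by (intro conjI ballI D.sw2_linear[OF vspace] D.linear_map_sw2_body[OF vspace] bilinear_mapI linear_mapI)
    simp_all

lemmas Q_simps [simp] = bilinear_mapD(1-5)[OF Q_bilinear]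

text \<open>The maps \<open>f\<close> and \<open>g\<close> are multiplication and division in either order. If \<open>f\<close> is division, this says
  that multiplication undoes it; if \<open>f\<close> is multiplication, that \<open>H\<close> is determined by its products
  with \<open>\<mu>\<close>.\<close>
lemma cancel_\<mu>:
  assumes f: "bilinear_map C C C f" and g: "bilinear_map C C C g"
    and gf: "\<And>u v. u \<in> carr C \<Longrightarrow> v \<in> carr C \<Longrightarrow> sw2 C (\<lambda>u1 u2. g (f v u1) u2) u = smult C (counit C u) v"
    and H: "linear_map D C H" and \<delta>: "\<delta> \<in> carr D"
  shows "sw2 D (\<lambda>w c. g (sw2 D (\<lambda>a b. f (H a) (\<mu> b)) w) (\<mu> c)) \<delta> = H \<delta>"
proof -
  note [simp] = linear_mapD[OF H] bilinear_mapD(1-5)[OF f] bilinear_mapD(1-5)[OF g]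
  have "sw2 D (\<lambda>w c. g (sw2 D (\<lambda>a b. f (H a) (\<mu> b)) w) (\<mu> c)) \<delta> =
      sw2 D (\<lambda>w c. sw2 D (\<lambda>a b. g (f (H a) (\<mu> b)) (\<mu> c)) w) \<delta>"
    by (rule D.sw2_cong[OF \<delta>], rule D.linear_sw2[OF vspace vspace bilinear_mapD(7)[OF g]]) simp_all
  also have "\<dots> = sw2 D (\<lambda>a w. sw2 D (\<lambda>b c. g (f (H a) (\<mu> b)) (\<mu> c)) w) \<delta>"
    by (rule D.coassoc[OF vspace _ \<delta>], rule trilinear_mapI) simp_all
  also have "\<dots> = sw2 D (\<lambda>a w. smult C (counit D w) (H a)) \<delta>"
  proof (rule D.sw2_cong[OF \<delta>])
    fix a w assume a: "a \<in> carr D" and w: "w \<in> carr D"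
    have "sw2 D (\<lambda>b c. g (f (H a) (\<mu> b)) (\<mu> c)) w = sw2 C (\<lambda>u v. g (f (H a) u) v) (\<mu> w)"
      using a by (intro sw2_\<mu>[OF vspace _ w, symmetric] bilinear_mapI) simp_all
    then show "sw2 D (\<lambda>b c. g (f (H a) (\<mu> b)) (\<mu> c)) w = smult C (counit D w) (H a)"
      using gf[of "\<mu> w" "H a"] a w by simp
  qed
  also have "\<dots> = H \<delta>"
    by (rule D.counit_right[OF vspace H \<delta>])
  finally show ?thesis .
qed

lemma G_eq_Q:
  "x \<in> carr C \<Longrightarrow> \<delta> \<in> carr D \<Longrightarrow> G x \<delta> = sw2 D (\<lambda>\<delta>1 \<delta>2. Q x \<delta>1 \<odot> \<mu> \<delta>2) \<delta>"
  unfolding Q_def by (rule cancel_\<mu>[OF d_bilinear m_bilinear m_d bilinear_mapD(6)[OF G_bilinear], symmetric])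

lemma sw2_Q:
  assumes E: "vspace E" and F: "bilinear_map C C E F" and x: "x \<in> carr C" and \<delta>: "\<delta> \<in> carr D"
  shows "sw2 C F (Q x \<delta>) = sw2 C (\<lambda>x1 x2. sw2 D (\<lambda>\<delta>1 \<delta>2. F (Q x1 \<delta>1) (Q x2 \<delta>2)) \<delta>) x"
proof -
  note F_simps [simp] = bilinear_mapD(1-5)[OF F]
  have "sw2 C F (Q x \<delta>) = sw2 D (\<lambda>p q. sw2 C F (G x p \<oslash> \<mu> q)) \<delta>"
    unfolding Q_def by (rule D.linear_sw2[OF vspace E sw2_linear[OF E F] \<delta>]) (simp add: x)
  also have "\<dots> = sw2 D (\<lambda>p q. sw2 C (\<lambda>v1 v2. sw2 D (\<lambda>c e. F (v1 \<oslash> \<mu> c) (v2 \<oslash> \<mu> e)) q) (G x p)) \<delta>"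
  proof (rule D.sw2_cong[OF \<delta>])
    fix p q assume p: "p \<in> carr D" and q: "q \<in> carr D"
    have "sw2 C F (G x p \<oslash> \<mu> q) = sw2 C (\<lambda>v1 v2. sw2 C (\<lambda>u1 u2. F (v1 \<oslash> u1) (v2 \<oslash> u2)) (\<mu> q)) (G x p)"
      using p q x by (intro sw2_d[OF E F]) simp_all
    also have "\<dots> = sw2 C (\<lambda>v1 v2. sw2 D (\<lambda>c e. F (v1 \<oslash> \<mu> c) (v2 \<oslash> \<mu> e)) q) (G x p)"
      using p q x by (intro sw2_cong sw2_\<mu>[OF E] bilinear_mapI) simp_all
    finally show "sw2 C F (G x p \<oslash> \<mu> q) =
      sw2 C (\<lambda>v1 v2. sw2 D (\<lambda>c e. F (v1 \<oslash> \<mu> c) (v2 \<oslash> \<mu> e)) q) (G x p)" .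
  qed
  also have "\<dots> = sw2 D (\<lambda>p q. sw2 C (\<lambda>x1 x2. sw2 D (\<lambda>a b. sw2 D (\<lambda>c e.
      F (G x1 a \<oslash> \<mu> c) (G x2 b \<oslash> \<mu> e)) q) p) x) \<delta>"
    by (rule D.sw2_cong[OF \<delta>], rule sw2_G[OF E _ x], rule D.bilinear_map_sw2_body[OF E])
      (auto intro!: bilinear_mapI)
  also have "\<dots> = sw2 C (\<lambda>x1 x2. sw2 D (\<lambda>p q. sw2 D (\<lambda>a b. sw2 D (\<lambda>c e.
      F (G x1 a \<oslash> \<mu> c) (G x2 b \<oslash> \<mu> e)) q) p) \<delta>) x"
    by (rule sw2_exchange)
  also have "\<dots> = sw2 C (\<lambda>x1 x2. sw2 D (\<lambda>p q. sw2 D (\<lambda>a c. sw2 D (\<lambda>b e.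
      F (G x1 a \<oslash> \<mu> c) (G x2 b \<oslash> \<mu> e)) q) p) \<delta>) x"
    by (rule sw2_cong[OF x], rule D.middle_exchange[OF E _ \<delta>])
      (auto simp: quadrilinear_map_def intro!: trilinear_mapI linear_mapI)
  also have "\<dots> = sw2 C (\<lambda>x1 x2. sw2 D (\<lambda>p q. F (Q x1 p) (Q x2 q)) \<delta>) x"
  proof (rule sw2_cong[OF x], rule D.sw2_cong[OF \<delta>])
    fix x1 x2 p q assume *: "x1 \<in> carr C" "x2 \<in> carr C" "p \<in> carr D" "q \<in> carr D"
    have "F (Q x1 p) (Q x2 q) = sw2 D (\<lambda>a c. F (G x1 a \<oslash> \<mu> c) (Q x2 q)) p"
      unfolding Q_def[of x1]
      by (rule D.linear_sw2[OF vspace E bilinear_mapD(7)[OF F]]) (simp_all add: *)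
    also have "\<dots> = sw2 D (\<lambda>a c. sw2 D (\<lambda>b e. F (G x1 a \<oslash> \<mu> c) (G x2 b \<oslash> \<mu> e)) q) p"
      unfolding Q_def[of x2]
      by (rule D.sw2_cong[OF *(3)], rule D.linear_sw2[OF vspace E bilinear_mapD(6)[OF F]])
        (simp_all add: *)
    finally show "sw2 D (\<lambda>a c. sw2 D (\<lambda>b e. F (G x1 a \<oslash> \<mu> c) (G x2 b \<oslash> \<mu> e)) q) p = F (Q x1 p) (Q x2 q)" ..
  qed
  finally show ?thesis .
qed

text \<open>The map \<open>h\<close> stands for \<open>\<pi>\<close> followed by its section. It turns \<open>\<Sum>Q(x, \<delta>\<^sub>(\<^sub>1\<^sub>)) \<mu>(\<delta>\<^sub>(\<^sub>2\<^sub>)) = G(x, \<delta>)\<close>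
  into \<open>\<Sum>h(Q(x, \<delta>\<^sub>(\<^sub>1\<^sub>))) \<mu>(\<delta>\<^sub>(\<^sub>2\<^sub>)) = \<epsilon>(x) \<mu>(\<delta>)\<close>, whose only solution is \<open>h(Q(x, \<delta>)) = \<epsilon>(x)\<epsilon>(\<delta>)1\<close>. So \<open>\<pi>\<close> is
  trivial on the quotients, and these span a subcoalgebra by \<open>sw2_Q\<close>.\<close>
lemma Q_mem_kernel:
  fixes \<pi> :: "'a \<Rightarrow> 'e::ab_group_add" and E :: "('k, 'e, 'w) vspace_scheme"
  assumes E: "vspace E" and \<pi>: "linear_map C E \<pi>" and h: "linear_map C C h"
    and h_m: "\<And>u v. u \<in> carr C \<Longrightarrow> v \<in> carr C \<Longrightarrow> h (u \<odot> v) = h u \<odot> h v"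
    and h_counit: "\<And>u. u \<in> carr C \<Longrightarrow> counit C (h u) = counit C u"
    and h_\<pi>: "\<And>u. u \<in> carr C \<Longrightarrow> \<pi> (h u) = \<pi> u"
    and h_\<mu>: "\<And>\<delta>. \<delta> \<in> carr D \<Longrightarrow> h (\<mu> \<delta>) = \<mu> \<delta>"
    and h_G: "\<And>x \<delta>. x \<in> K \<Longrightarrow> \<delta> \<in> carr D \<Longrightarrow> h (G x \<delta>) = smult C (counit C x) (\<mu> \<delta>)"
    and K: "K = equalizer C \<pi> (\<lambda>c. smult E (counit C c) (\<pi> one))"
    and x: "x \<in> K" and \<delta>: "\<delta> \<in> carr D"
  shows "Q x \<delta> \<in> K"
proof -
  note h_simps [simp] = linear_mapD[OF h] and \<pi>_simps [simp] = linear_mapD[OF \<pi>]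
  have sub: "K \<subseteq> carr C" and Ksub: "subcoalgebra C K"
    unfolding K using subcoalgebraD(1)[OF subcoalgebra_equalizer vspace] subcoalgebra_equalizer by auto
  have hQ: "h (Q x \<delta>) = smult C (counit C x * counit D \<delta>) one" if x: "x \<in> K" and \<delta>: "\<delta> \<in> carr D" for x \<delta>
  proof -
    have xC: "x \<in> carr C" using x sub by auto
    have lin: "linear_map D C (\<lambda>\<delta>. h (Q x \<delta>))"
      using xC by (intro linear_mapI) simp_all
    have hQ_\<mu>: "sw2 D (\<lambda>a b. h (Q x a) \<odot> \<mu> b) w = smult C (counit C x) (\<mu> w)" if w: "w \<in> carr D" for w
    proof -
      have "smult C (counit C x) (\<mu> w) = h (G x w)" by (simp add: h_G[OF x w])
      also have "\<dots> = sw2 D (\<lambda>a b. h (Q x a \<odot> \<mu> b)) w"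
        unfolding G_eq_Q[OF xC w] by (rule D.linear_sw2[OF vspace vspace h w]) (simp add: xC)
      also have "\<dots> = sw2 D (\<lambda>a b. h (Q x a) \<odot> \<mu> b) w"
        by (rule D.sw2_cong[OF w]) (simp add: h_m h_\<mu> xC)
      finally show ?thesis ..
    qed
    have "h (Q x \<delta>) = sw2 D (\<lambda>w c. sw2 D (\<lambda>a b. h (Q x a) \<odot> \<mu> b) w \<oslash> \<mu> c) \<delta>"
      by (rule cancel_\<mu>[OF m_bilinear d_bilinear d_m lin \<delta>, symmetric])
    also have "\<dots> = sw2 D (\<lambda>w c. smult C (counit C x) (\<mu> w) \<oslash> \<mu> c) \<delta>"
      by (rule D.sw2_cong[OF \<delta>]) (simp add: hQ_\<mu>)
    also have "\<dots> = sw2 D (\<lambda>w c. smult C (counit C x) (\<mu> w \<oslash> \<mu> c)) \<delta>"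
      by (rule D.sw2_cong[OF \<delta>]) simp
    also have "\<dots> = smult C (counit C x) (sw2 C (\<lambda>u v. u \<oslash> v) (\<mu> \<delta>))"
      by (simp add: sw2_smult[OF vspace] sw2_\<mu>[OF vspace d_bilinear \<delta>])
    also have "sw2 C (\<lambda>u v. u \<oslash> v) (\<mu> \<delta>) = sw2 C (\<lambda>u v. (one \<odot> u) \<oslash> v) (\<mu> \<delta>)"
      using \<delta> by (intro sw2_cong) simp_all
    also have "\<dots> = smult C (counit D \<delta>) one" using d_m[of "\<mu> \<delta>" one] \<delta> by simp
    finally show ?thesis by (simp add: smult_simps[OF vspace])
  qed
  let ?X = "{Q x \<delta> | x \<delta>. x \<in> K \<and> \<delta> \<in> carr D}"
  let ?S = "C\<lparr>carr := module.span (smult C) ?X\<rparr>"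
  have "?X \<subseteq> equalizer C \<pi> (\<lambda>c. smult E (counit C c) (\<pi> one))"
  proof (rule subset_equalizer[OF E \<pi>])
    show "linear_map C E (\<lambda>c. smult E (counit C c) (\<pi> one))"
      by (intro linear_mapI) (simp_all add: smult_simps[OF E] vspaceD[OF E])
    show "?X \<subseteq> carr C" using sub by (auto simp: subset_iff)
    fix u assume "u \<in> ?X"
    then obtain x \<delta> where u: "u = Q x \<delta>" and x: "x \<in> K" and \<delta>: "\<delta> \<in> carr D" by auto
    have xC: "x \<in> carr C" using x sub by auto
    have eps: "counit C u = counit C x * counit D \<delta>"
      using h_counit[of u] hQ[OF x \<delta>] xC \<delta> by (simp add: u)
    have "\<pi> u = \<pi> (h u)" using h_\<pi>[of u] xC \<delta> by (simp add: u)
    also have "h u = smult C (counit C u) one" unfolding eps unfolding u by (rule hQ[OF x \<delta>])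
    finally show "\<pi> u = smult E (counit C u) (\<pi> one)" by simp
    note F = tens_bilinear[of C C]
    note F_simps = bilinear_mapD(1-5)[OF F]
    have "comult C u = sw2 C (\<lambda>x1 x2. sw2 D (\<lambda>\<delta>1 \<delta>2. tens C C (Q x1 \<delta>1) (Q x2 \<delta>2)) \<delta>) x"
      using sw2_tens[of u] sw2_Q[OF vspace_tensor F xC \<delta>] xC \<delta> by (simp add: u)
    also have "\<dots> \<in> carr (tensor ?S ?S)"
    proof (rule sw2_subcoalgebra_mem[OF Ksub x vspace_tensor _ vspace_tensor])
      show "bilinear_map C C (tensor C C) (\<lambda>x1 x2. sw2 D (\<lambda>\<delta>1 \<delta>2. tens C C (Q x1 \<delta>1) (Q x2 \<delta>2)) \<delta>)"
        by (intro D.bilinear_map_sw2_body[OF vspace_tensor \<delta>] bilinear_mapI) (simp_all add: F_simps)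
      fix x1 x2 assume x12: "x1 \<in> K" "x2 \<in> K"
      show "sw2 D (\<lambda>\<delta>1 \<delta>2. tens C C (Q x1 \<delta>1) (Q x2 \<delta>2)) \<delta> \<in> carr (tensor ?S ?S)"
      proof (rule D.sw2_mem[OF vspace_tensor \<delta>])
        fix \<delta>1 \<delta>2 assume "\<delta>1 \<in> carr D" "\<delta>2 \<in> carr D"
        then have "Q x1 \<delta>1 \<in> ?X" "Q x2 \<delta>2 \<in> ?X" using x12 by auto
        then show "tens C C (Q x1 \<delta>1) (Q x2 \<delta>2) \<in> carr (tensor ?S ?S)" by (rule tens_mem_span[OF vspace])
      qed
    qed
    finally show "comult C u \<in> carr (tensor ?S ?S)" .
  qed
  then show ?thesis unfolding K[symmetric] using x \<delta> by blast
qed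

end

section \<open>The fibre square and its addition\<close>

definition left_proj where
  "left_proj A E f = tlift A A (\<lambda>x y. smult E (counit A y) (f x))"

definition right_proj where
  "right_proj A E f = tlift A A (\<lambda>x y. smult E (counit A x) (f y))"

text \<open>The carrier of \<open>A \<otimes>\<^sub>B A\<close>. The definition only refers to the coalgebra \<open>A\<close> and to \<open>\<pi>\<close>, so that the
  fibre square of the opposite bialgebra is literally the same set.\<close>
definition fibre_square where
  "fibre_square A E \<pi> = equalizer (tensor_coalg A A) (left_proj A E \<pi>) (right_proj A E \<pi>)"

context nonassoc_bialgebra
begin

lemma projections:
  assumes E: "vspace E" and f: "linear_map C E f"
  shows "linear_map SQ.T E (left_proj C E f)" "linear_map SQ.T E (right_proj C E f)"
    "a \<in> carr C \<Longrightarrow> b \<in> carr C \<Longrightarrow> left_proj C E f (a \<otimes> b) = smult E (counit C b) (f a)"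
    "a \<in> carr C \<Longrightarrow> b \<in> carr C \<Longrightarrow> right_proj C E f (a \<otimes> b) = smult E (counit C a) (f b)"
proof -
  note [simp] = linear_mapD[OF f] smult_simps[OF E] vspaceD(2-)[OF E]
  have l: "bilinear_map C C E (\<lambda>x y. smult E (counit C y) (f x))"
    and r: "bilinear_map C C E (\<lambda>x y. smult E (counit C x) (f y))"
    by (intro bilinear_mapI; simp add: mult.commute)+
  show "linear_map SQ.T E (left_proj C E f)" "linear_map SQ.T E (right_proj C E f)"
    unfolding SQ.linear_T left_proj_def right_proj_def
    by (rule tlift_linear[OF vspace vspace E l] tlift_linear[OF vspace vspace E r])+
  show "a \<in> carr C \<Longrightarrow> b \<in> carr C \<Longrightarrow> left_proj C E f (a \<otimes> b) = smult E (counit C b) (f a)"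
    unfolding left_proj_def by (rule tlift_tens[OF vspace vspace E l])
  show "a \<in> carr C \<Longrightarrow> b \<in> carr C \<Longrightarrow> right_proj C E f (a \<otimes> b) = smult E (counit C a) (f b)"
    unfolding right_proj_def by (rule tlift_tens[OF vspace vspace E r])
qed

text \<open>An instance of \<open>middle_exchange\<close>. It says that \<open>\<Delta>\<close> is a morphism of coalgebras.\<close>
lemma sw2_comult:
  assumes E: "vspace E" and F: "bilinear_map SQ.T SQ.T E F" and a: "a \<in> carr C"
  shows "sw2 SQ.T F (comult C a) = sw2 C (\<lambda>p q. F (comult C p) (comult C q)) a"
proof -
  note F_simps [simp] = bilinear_mapD(1-5)[OF F, unfolded SQ.T_simps]
  have "sw2 SQ.T F (comult C a) = sw2 C (\<lambda>p q. sw2 SQ.T F (p \<otimes> q)) a"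
    unfolding sw2_tens[OF a, symmetric]
    by (rule linear_sw2[OF SQ.vspace_T E SQ.T.sw2_linear[OF E F] a]) simp
  also have "\<dots> = sw2 C (\<lambda>p q. sw2 C (\<lambda>p1 p2. sw2 C (\<lambda>q1 q2. F (p1 \<otimes> q1) (p2 \<otimes> q2)) q) p) a"
    by (rule sw2_cong[OF a], rule SQ.sw2_T_tens[OF E F])
  also have "\<dots> = sw2 C (\<lambda>p q. sw2 C (\<lambda>p1 p2. sw2 C (\<lambda>q1 q2. F (p1 \<otimes> p2) (q1 \<otimes> q2)) q) p) a"
  proof -
    have "quadrilinear_map C E (\<lambda>p1 p2 q1 q2. F (p1 \<otimes> q1) (p2 \<otimes> q2))"
      by (auto simp: quadrilinear_map_def intro!: trilinear_mapI linear_mapI)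
    from middle_exchange[OF E this a] show ?thesis .
  qed
  also have "\<dots> = sw2 C (\<lambda>p q. F (comult C p) (comult C q)) a"
  proof (rule sw2_cong[OF a])
    fix p q assume p: "p \<in> carr C" and q: "q \<in> carr C"
    have cq: "comult C q \<in> carr SQ.T" using q by simp
    have "F (comult C p) (comult C q) = sw2 C (\<lambda>p1 p2. F (p1 \<otimes> p2) (comult C q)) p"
      unfolding sw2_tens[OF p, symmetric]
      by (rule linear_sw2[OF SQ.vspace_T E bilinear_mapD(7)[OF F cq] p]) simp
    also have "\<dots> = sw2 C (\<lambda>p1 p2. sw2 C (\<lambda>q1 q2. F (p1 \<otimes> p2) (q1 \<otimes> q2)) q) p"
      unfolding sw2_tens[OF q, symmetric]
      by (rule sw2_cong[OF p], rule linear_sw2[OF SQ.vspace_T E bilinear_mapD(6)[OF F] q]) simp_all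
    finally show "sw2 C (\<lambda>p1 p2. sw2 C (\<lambda>q1 q2. F (p1 \<otimes> p2) (q1 \<otimes> q2)) q) p =
      F (comult C p) (comult C q)" ..
  qed
  finally show ?thesis .
qed

end

text \<open>Here \<open>pl\<close> is the fibrewise addition and \<open>z\<close> the zero section. The multiplications \<open>m\<close> and \<open>n\<close> of
  \<open>A\<close> and \<open>B\<close> are parameters of their own in order that their opposites provide a second instance with
  the same coalgebras, the same \<open>\<pi>\<close>, \<open>pl\<close> and \<open>z\<close>.\<close>
locale addition_over = right_loop_bialgebra A m one d + B: cocomm_coalgebra B
  for A :: "('k::field, 'a::ab_group_add, 'z) coalg_scheme" and m (infixl \<open>\<odot>\<close> 70) and one
    and d (infixl \<open>\<oslash>\<close> 70) and B :: "('k, 'b::ab_group_add, 'y) coalg_scheme" +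
  fixes n :: "'b \<Rightarrow> 'b \<Rightarrow> 'b" and \<pi> :: "'a \<Rightarrow> 'b" and z :: "'b \<Rightarrow> 'a" and pl :: "('k, 'a, 'a) tensor \<Rightarrow> 'a"
  assumes n: "bilinear_map B B B n"
    and \<pi>: "coalg_hom A B \<pi>" and \<pi>_m: "u \<in> carr A \<Longrightarrow> v \<in> carr A \<Longrightarrow> \<pi> (u \<odot> v) = n (\<pi> u) (\<pi> v)"
    and z: "coalg_hom B A z" and z_n: "b \<in> carr B \<Longrightarrow> b' \<in> carr B \<Longrightarrow> z (n b b') = z b \<odot> z b'"
    and z_one: "z (\<pi> one) = one" and \<pi>_z [simp]: "b \<in> carr B \<Longrightarrow> \<pi> (z b) = b"
    and pl: "linear_map ((tensor_coalg A A)\<lparr>carr := fibre_square A B \<pi>\<rparr>) A pl"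
    and pl_star: "s \<in> fibre_square A B \<pi> \<Longrightarrow> t \<in> fibre_square A B \<pi> \<Longrightarrow> pl (nonassoc_bialgebra.star A m s t) = pl s \<odot> pl t"
    and pl_unit: "a \<in> carr A \<Longrightarrow> pl (sw2 A (\<lambda>c1 c2. tens A A (z (\<pi> c1)) c2) a) = a"
    and pl_commute: "t \<in> fibre_square A B \<pi> \<Longrightarrow>
      pl (sw2 (tensor_coalg A A) (\<lambda>s1 s2. tens A A (right_proj A A id s1) (left_proj A A id s2)) t) = pl t"
begin

notation star (infixl \<open>\<star>\<close> 70)
notation tt (infix \<open>\<otimes>\<close> 70)

abbreviation K where "K \<equiv> equalizer A \<pi> (\<lambda>c. smult B (counit A c) (\<pi> one))"
abbreviation P where "P \<equiv> fibre_square A B \<pi>"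

lemmas z_simps [simp] = coalg_homD(2-5)[OF z]
lemmas \<pi>_simps [simp] = coalg_homD(2-5)[OF \<pi>]
lemmas projs = projections[OF B.vspace coalg_homD(1)[OF \<pi>]]

lemma id_linear: "linear_map A A id"
  by (rule linear_mapI) simp_all

lemmas id_projs = projections[OF vspace id_linear]

lemma K_subcoalgebra: "subcoalgebra A K" and P_subcoalgebra: "subcoalgebra SQ.T P"
  unfolding fibre_square_def by (rule subcoalgebra_equalizer SQ.T.subcoalgebra_equalizer)+

lemma K_mem: "x \<in> K \<Longrightarrow> x \<in> carr A" and P_mem: "s \<in> P \<Longrightarrow> s \<in> carr (tensor A A)"
  using subcoalgebraD(1)[OF K_subcoalgebra vspace] subcoalgebraD(1)[OF P_subcoalgebra SQ.vspace_T] by auto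

lemma counit_\<pi>_linear: "linear_map A B (\<lambda>c. smult B (counit A c) (\<pi> one))"
  by (rule linear_mapI) (simp_all add: smult_simps[OF B.vspace])

lemma \<pi>_K: "x \<in> K \<Longrightarrow> \<pi> x = smult B (counit A x) (\<pi> one)"
  by (rule equalizer_eq[OF B.vspace coalg_homD(1)[OF \<pi>] counit_\<pi>_linear])

lemma z_\<pi>_K: "x \<in> K \<Longrightarrow> z (\<pi> x) = smult A (counit A x) one"
  by (simp add: \<pi>_K z_one)

lemma P_star:
  assumes "s \<in> P" "t \<in> P"
  shows "s \<star> t \<in> P"
proof -
  note [simp] = bilinear_mapD(1-5)[OF n]
  have lin: "linear_map SQ.T B (\<lambda>s. f (s \<star> t))" "linear_map SQ.T B (\<lambda>s. f (t \<star> s))"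
    "linear_map SQ.T B (\<lambda>s. n (f s) (f t))" "linear_map SQ.T B (\<lambda>s. n (f t) (f s))"
    if "linear_map SQ.T B f" "t \<in> carr (tensor A A)" for f t
    using that(2) linear_mapD[OF that(1)] by (auto intro!: linear_mapI)
  have mult: "f (s \<star> t) = n (f s) (f t)"
    if f: "linear_map SQ.T B f" and s: "s \<in> carr (tensor A A)" and t: "t \<in> carr (tensor A A)"
      and pure: "\<And>a b a' b'. a \<in> carr A \<Longrightarrow> b \<in> carr A \<Longrightarrow> a' \<in> carr A \<Longrightarrow> b' \<in> carr A \<Longrightarrow>
        f ((a \<odot> a') \<otimes> (b \<odot> b')) = n (f (a \<otimes> b)) (f (a' \<otimes> b'))" for f s t
  proof (rule SQ.T_eqI[OF B.vspace lin(1)[OF f t] lin(3)[OF f t] _ s])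
    fix a b assume ab: "a \<in> carr A" "b \<in> carr A"
    then have ab': "a \<otimes> b \<in> carr (tensor A A)" by simp
    show "f ((a \<otimes> b) \<star> t) = n (f (a \<otimes> b)) (f t)"
      by (rule SQ.T_eqI[OF B.vspace lin(2)[OF f ab'] lin(4)[OF f ab'] _ t]) (simp add: ab pure)
  qed
  show ?thesis
    using assms unfolding fibre_square_def
  proof (rule star_equalizer[OF B.vspace projs(1,2), rotated 2])
    fix s t assume st: "s \<in> carr (tensor A A)" "t \<in> carr (tensor A A)"
    show "left_proj A B \<pi> (s \<star> t) = n (left_proj A B \<pi> s) (left_proj A B \<pi> t)"
      by (rule mult[OF projs(1) st]) (simp add: projs \<pi>_m smult_simps[OF B.vspace] mult.commute)
    show "right_proj A B \<pi> (s \<star> t) = n (right_proj A B \<pi> s) (right_proj A B \<pi> t)"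
      by (rule mult[OF projs(2) st]) (simp add: projs \<pi>_m smult_simps[OF B.vspace] mult.commute)
  qed
qed

lemma one_mem_K: "one \<in> K"
proof -
  have "{one} \<subseteq> K"
  proof (rule subset_equalizer[OF B.vspace coalg_homD(1)[OF \<pi>] counit_\<pi>_linear])
    fix x assume "x \<in> {one}"
    then show "comult A x \<in> carr (tensor (A\<lparr>carr := module.span (smult A) {one}\<rparr>) (A\<lparr>carr := module.span (smult A) {one}\<rparr>))"
      using tens_mem_span[OF vspace, of one "{one}" one] by (simp add: comult_one)
  qed (simp_all add: smult_simps[OF B.vspace])
  then show ?thesis by simp
qed

text \<open>On the kernel \<open>\<pi>\<close> is \<open>\<epsilon>\<close>, so at \<open>x \<otimes> y\<close> both maps to \<open>B\<close> give \<open>\<epsilon>(x)\<epsilon>(y)1\<close>.\<close>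
lemma tens_mem_P:
  assumes "x \<in> K" "y \<in> K"
  shows "x \<otimes> y \<in> P"
proof -
  let ?X = "{x \<otimes> y | x y. x \<in> K \<and> y \<in> K}"
  let ?S = "SQ.T\<lparr>carr := module.span (smult SQ.T) ?X\<rparr>"
  have "?X \<subseteq> P"
    unfolding fibre_square_def
  proof (rule SQ.T.subset_equalizer[OF B.vspace projs(1,2)])
    show "?X \<subseteq> carr SQ.T" by (auto intro!: tens_mem K_mem simp: SQ.T_simps)
    fix s assume "s \<in> ?X"
    then obtain x y where s: "s = x \<otimes> y" and x: "x \<in> K" and y: "y \<in> K" by auto
    note xy = K_mem[OF x] K_mem[OF y]
    show "left_proj A B \<pi> s = right_proj A B \<pi> s"
      by (simp add: s projs xy \<pi>_K[OF x] \<pi>_K[OF y] smult_simps[OF B.vspace] mult.commute)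
    let ?F = "tens SQ.T SQ.T"
    note F = tens_bilinear[of SQ.T SQ.T]
    have "comult SQ.T s = sw2 A (\<lambda>x1 x2. sw2 A (\<lambda>y1 y2. ?F (x1 \<otimes> y1) (x2 \<otimes> y2)) y) x"
      unfolding s by (rule SQ.comult_T_tens[OF xy])
    also have "\<dots> \<in> carr (tensor ?S ?S)"
    proof (rule sw2_subcoalgebra_mem[OF K_subcoalgebra x vspace_tensor _ vspace_tensor])
      show "bilinear_map A A (tensor SQ.T SQ.T) (\<lambda>x1 x2. sw2 A (\<lambda>y1 y2. ?F (x1 \<otimes> y1) (x2 \<otimes> y2)) y)"
        by (rule bilinear_map_sw2_body[OF vspace_tensor xy(2)], rule SQ.bilinear_pure_tensors(2)[OF F])
      fix x1 x2 assume x12: "x1 \<in> K" "x2 \<in> K"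
      show "sw2 A (\<lambda>y1 y2. ?F (x1 \<otimes> y1) (x2 \<otimes> y2)) y \<in> carr (tensor ?S ?S)"
      proof (rule sw2_subcoalgebra_mem[OF K_subcoalgebra y vspace_tensor _ vspace_tensor])
        show "bilinear_map A A (tensor SQ.T SQ.T) (\<lambda>y1 y2. ?F (x1 \<otimes> y1) (x2 \<otimes> y2))"
          by (rule SQ.bilinear_pure_tensors(1)[OF F _ vs(1) _ vs(1)]) (rule K_mem[OF x12(1)] K_mem[OF x12(2)])+
        fix y1 y2 assume "y1 \<in> K" "y2 \<in> K"
        then have "x1 \<otimes> y1 \<in> ?X" "x2 \<otimes> y2 \<in> ?X" using x12 by auto
        then show "?F (x1 \<otimes> y1) (x2 \<otimes> y2) \<in> carr (tensor ?S ?S)" by (rule tens_mem_span[OF SQ.vspace_T])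
      qed
    qed
    finally show "comult SQ.T s \<in> carr (tensor ?S ?S)" .
  qed
  then show ?thesis using assms by blast
qed

text \<open>For \<open>x\<close> in the kernel the unit law \<open>0(\<pi>(x)) \<boxplus> x = x\<close> reads \<open>1 \<boxplus> x = x\<close>.\<close>
lemma pl_one_tens:
  assumes x: "x \<in> K"
  shows "pl (one \<otimes> x) = x"
proof -
  note xA = K_mem[OF x]
  have "sw2 A (\<lambda>c1 c2. z (\<pi> c1) \<otimes> c2) x = sw2 A (\<lambda>c1 c2. smult SQ.T (counit A c1) (one \<otimes> c2)) x"
    by (rule sw2_subcoalgebra_cong[OF K_subcoalgebra x SQ.vspace_T])
      (auto intro!: bilinear_mapI
        simp: z_\<pi>_K K_mem smult_simps[OF SQ.vspace_T, simplified] vspaceD[OF SQ.vspace_T, simplified] mult.commute)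
  also have "\<dots> = one \<otimes> x"
    by (rule counit_left[OF SQ.vspace_T _ xA], rule linear_mapI) simp_all
  finally show ?thesis using pl_unit[OF xA] by simp
qed

lemma pl_tens_one:
  assumes x: "x \<in> K"
  shows "pl (x \<otimes> one) = x"
proof -
  note xA = K_mem[OF x]
  note [simp] = linear_mapD[OF id_projs(1), unfolded SQ.T_simps] linear_mapD[OF id_projs(2), unfolded SQ.T_simps]
  let ?F = "\<lambda>s1 s2. right_proj A A id s1 \<otimes> left_proj A A id s2"
  have F: "bilinear_map SQ.T SQ.T SQ.T ?F"
    by (rule bilinear_mapI) simp_all
  have "sw2 SQ.T ?F (one \<otimes> x) = sw2 A (\<lambda>c1 c2. sw2 A (\<lambda>x1 x2. ?F (c1 \<otimes> x1) (c2 \<otimes> x2)) x) one"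
    by (rule SQ.sw2_T_tens[OF SQ.vspace_T F one_mem xA])
  also have "\<dots> = sw2 A (\<lambda>x1 x2. ?F (one \<otimes> x1) (one \<otimes> x2)) x"
    using xA by (intro sw2_one[OF SQ.vspace_T] bilinear_map_sw2_body[OF SQ.vspace_T]
        SQ.bilinear_pure_tensors(2)[OF F])
  also have "\<dots> = sw2 A (\<lambda>x1 x2. smult SQ.T (counit A x2) (x1 \<otimes> one)) x"
    by (rule sw2_cong[OF xA]) (simp add: id_projs smult_simps[OF vspace])
  also have "\<dots> = x \<otimes> one"
    by (rule counit_right[OF SQ.vspace_T _ xA], rule linear_mapI) simp_all
  finally show ?thesis
    using pl_commute[OF tens_mem_P[OF one_mem_K x]] pl_one_tens[OF x] by simp
qed

text \<open>On the kernel the addition is the multiplication, because \<open>x \<otimes> y = (x \<otimes> 1)(1 \<otimes> y)\<close>.\<close>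
lemma pl_tens:
  assumes "x \<in> K" "y \<in> K"
  shows "pl (x \<otimes> y) = x \<odot> y"
  using pl_star[OF tens_mem_P[OF assms(1) one_mem_K] tens_mem_P[OF one_mem_K assms(2)]] assms
  by (simp add: K_mem pl_tens_one pl_one_tens)

lemma sw2_z:
  "vspace E \<Longrightarrow> bilinear_map A A E F \<Longrightarrow> b \<in> carr B \<Longrightarrow> sw2 A F (z b) = sw2 B (\<lambda>b1 b2. F (z b1) (z b2)) b"
  by (rule sw2_coalg_hom[OF B.vspace B.comult_linear vspace z])

text \<open>The coproduct of \<open>b \<in> B\<close> is the analogue of the pair \<open>(b, b)\<close>. It lies in the fibre square, and
  the next lemma is \<open>b \<boxplus> b = b\<close>.\<close>
lemma comult_z_mem_P:
  assumes "b \<in> carr B"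
  shows "comult A (z b) \<in> P"
proof -
  let ?X = "{comult A (z b) | b. b \<in> carr B}"
  let ?S = "SQ.T\<lparr>carr := module.span (smult SQ.T) ?X\<rparr>"
  have "?X \<subseteq> P"
    unfolding fibre_square_def
  proof (rule SQ.T.subset_equalizer[OF B.vspace projs(1,2)])
    show "?X \<subseteq> carr SQ.T" by auto
    fix s assume "s \<in> ?X"
    then obtain b where s: "s = comult A (z b)" and b: "b \<in> carr B" by auto
    have zb: "z b \<in> carr A" using b by simp
    have "left_proj A B \<pi> s = sw2 A (\<lambda>u v. left_proj A B \<pi> (u \<otimes> v)) (z b)"
      unfolding s sw2_tens[OF zb, symmetric]
      by (rule linear_sw2[OF SQ.vspace_T B.vspace projs(1) zb]) simp
    also have "\<dots> = sw2 A (\<lambda>u v. smult B (counit A v) (\<pi> u)) (z b)"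
      by (rule sw2_cong[OF zb]) (simp add: projs)
    also have "\<dots> = \<pi> (z b)" by (rule counit_right[OF B.vspace coalg_homD(1)[OF \<pi>] zb])
    also have "\<dots> = sw2 A (\<lambda>u v. smult B (counit A u) (\<pi> v)) (z b)"
      by (rule counit_left[OF B.vspace coalg_homD(1)[OF \<pi>] zb, symmetric])
    also have "\<dots> = sw2 A (\<lambda>u v. right_proj A B \<pi> (u \<otimes> v)) (z b)"
      by (rule sw2_cong[OF zb]) (simp add: projs)
    also have "\<dots> = right_proj A B \<pi> s"
      unfolding s sw2_tens[OF zb, symmetric]
      by (rule linear_sw2[OF SQ.vspace_T B.vspace projs(2) zb, symmetric]) simp
    finally show "left_proj A B \<pi> s = right_proj A B \<pi> s" .
    let ?F = "tens SQ.T SQ.T"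
    note F = tens_bilinear[of SQ.T SQ.T]
    note [simp] = bilinear_mapD(1-5)[OF F, unfolded SQ.T_simps] linear_mapD(2,3)[OF comult_linear]
    have "comult SQ.T s = sw2 A (\<lambda>p q. ?F (comult A p) (comult A q)) (z b)"
      using SQ.T.sw2_tens[of s] sw2_comult[OF vspace_tensor F zb] zb by (simp add: s)
    also have "\<dots> = sw2 B (\<lambda>p q. ?F (comult A (z p)) (comult A (z q))) b"
      by (rule sw2_z[OF vspace_tensor[of SQ.T SQ.T] _ b], rule bilinear_mapI) simp_all
    also have "\<dots> \<in> carr (tensor ?S ?S)"
    proof (rule B.sw2_mem[OF vspace_tensor b])
      fix p q assume "p \<in> carr B" "q \<in> carr B"
      then have "comult A (z p) \<in> ?X" "comult A (z q) \<in> ?X" by auto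
      then show "?F (comult A (z p)) (comult A (z q)) \<in> carr (tensor ?S ?S)" by (rule tens_mem_span[OF SQ.vspace_T])
    qed
    finally show "comult SQ.T s \<in> carr (tensor ?S ?S)" .
  qed
  then show ?thesis using assms by blast
qed

lemma pl_comult_z:
  assumes b: "b \<in> carr B"
  shows "pl (comult A (z b)) = z b"
proof -
  have zb: "z b \<in> carr A" using b by simp
  have "sw2 A (\<lambda>c1 c2. z (\<pi> c1) \<otimes> c2) (z b) = sw2 B (\<lambda>c1 c2. z (\<pi> (z c1)) \<otimes> z c2) b"
    by (rule sw2_z[OF SQ.vspace_T _ b], rule bilinear_mapI) simp_all
  also have "\<dots> = sw2 B (\<lambda>c1 c2. z c1 \<otimes> z c2) b"
    by (rule B.sw2_cong[OF b]) simp
  also have "\<dots> = comult A (z b)" by (rule coalg_homD(6)[OF z b, symmetric])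
  finally show ?thesis using pl_unit[OF zb] by simp
qed

end

section \<open>Threefold Sweedler sums\<close>

lemma sw3_exchange:
  "sw3 C (\<lambda>a b c. sw3 D (\<lambda>a' b' c'. f a b c a' b' c') v) u =
    sw3 D (\<lambda>a' b' c'. sw3 C (\<lambda>a b c. f a b c a' b' c') u) v"
proof -
  have *: "sw3 C (\<lambda>a b c. sw2 D (\<lambda>p q. g a b c p q) w) u = sw2 D (\<lambda>p q. sw3 C (\<lambda>a b c. g a b c p q) u) w" for g w
    unfolding sw3_def sw2_exchange[where C = C and D = D] ..
  show ?thesis unfolding sw3_def[of D] * ..
qed

context cocomm_coalgebra
begin

lemma sw3_cong:
  assumes "u \<in> carr C"
    "\<And>a b c. a \<in> carr C \<Longrightarrow> b \<in> carr C \<Longrightarrow> c \<in> carr C \<Longrightarrow> f a b c = g a b c"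
  shows "sw3 C f u = sw3 C g u"
  unfolding sw3_def by (rule sw2_cong[OF assms(1)], rule sw2_cong) (use assms(2) in auto)

lemma sw3_reverse:
  assumes E: "vspace E" and f: "trilinear_map C C C E f" and u: "u \<in> carr C"
  shows "sw3 C (\<lambda>a b c. f c b a) u = sw3 C f u"
proof -
  have "sw3 C f u = sw2 C (\<lambda>w c. sw2 C (\<lambda>a b. f a b c) w) u"
    unfolding sw3_def by (rule coassoc[OF E f u, symmetric])
  also have "\<dots> = sw2 C (\<lambda>c w. sw2 C (\<lambda>a b. f a b c) w) u"
    by (rule cocomm[OF E bilinear_iterated_sw2(1)[OF E f] u, symmetric])
  also have "\<dots> = sw2 C (\<lambda>c w. sw2 C (\<lambda>a b. f b a c) w) u"
    by (rule sw2_cong[OF u], rule cocomm[OF E trilinear_mapD(10)[OF f], symmetric])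
  finally show ?thesis by (simp add: sw3_def)
qed

end

context coalgebra_pair
begin

lemma sw3_T_tens:
  assumes E: "vspace E" and f: "trilinear_map T T T E f" and c: "c \<in> carr C" and d: "d \<in> carr D"
  shows "sw3 T f (c \<otimes> d) =
    sw3 C (\<lambda>c1 c2 c3. sw3 D (\<lambda>d1 d2 d3. f (c1 \<otimes> d1) (c2 \<otimes> d2) (c3 \<otimes> d3)) d) c"
proof -
  have f2: "bilinear_map T T E (f s)" if "s \<in> carr T" for s by (rule trilinear_mapD(8)[OF f that])
  have "sw3 T f (c \<otimes> d) =
      sw2 C (\<lambda>c1 w. sw2 D (\<lambda>d1 w'. sw2 T (f (c1 \<otimes> d1)) (w \<otimes> w')) d) c"
    unfolding sw3_def by (rule sw2_T_tens[OF E T.bilinear_iterated_sw2(2)[OF E f] c d])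
  also have "\<dots> = sw2 C (\<lambda>c1 w. sw2 D (\<lambda>d1 w'. sw2 C (\<lambda>c2 c3. sw2 D (\<lambda>d2 d3.
      f (c1 \<otimes> d1) (c2 \<otimes> d2) (c3 \<otimes> d3)) w') w) d) c"
    by (rule C.sw2_cong[OF c], rule D.sw2_cong[OF d], rule sw2_T_tens[OF E f2]) simp_all
  also have "\<dots> = sw2 C (\<lambda>c1 w. sw2 C (\<lambda>c2 c3. sw2 D (\<lambda>d1 w'. sw2 D (\<lambda>d2 d3.
      f (c1 \<otimes> d1) (c2 \<otimes> d2) (c3 \<otimes> d3)) w') d) w) c"
    unfolding sw2_exchange[where C = D and D = C] ..
  finally show ?thesis by (simp add: sw3_def)
qed

end

section \<open>The product formula\<close>

context addition_over
begin

sublocale BB: coalgebra_pair B B ..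

text \<open>As data for \<open>morphism_quotient\<close>, \<open>right_act\<close> is the family \<open>G\<close> for \<open>r\<close> and \<open>middle_act\<close> the one
  for \<open>s\<close>. Taking \<open>x = 1\<close> in the former yields \<open>\<mu>\<close>.\<close>

abbreviation bb (infix \<open>\<diamond>\<close> 70) where "b \<diamond> b' \<equiv> tens B B b b'"

definition right_act where "right_act x = tlift B B (\<lambda>b b'. (x \<odot> z b) \<odot> z b')"
definition middle_act where "middle_act x = tlift B B (\<lambda>b b'. z b \<odot> (x \<odot> z b'))"

abbreviation \<mu> where "\<mu> \<equiv> right_act one"

lemma act_bilinear:
  assumes H: "trilinear_map A B B A H"
  shows "bilinear_map A BB.T A (\<lambda>x. tlift B B (H x))"
  unfolding bilinear_map_def BB.linear_T
proof (intro conjI ballI)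
  fix x assume x: "x \<in> carr A"
  show "linear_map (tensor B B) A (tlift B B (H x))"
    by (rule tlift_linear[OF B.vspace B.vspace vspace trilinear_mapD(8)[OF H x]])
next
  fix \<delta> assume "\<delta> \<in> carr BB.T"
  then show "linear_map A A (\<lambda>x. tlift B B (H x) \<delta>)"
    using bilinear_mapD(7)[OF trilinear_mapD(9)[OF H]]
    by (intro linear_map_tlift_body[OF B.vspace B.vspace vspace]) simp_all
qed

lemma act_tens:
  assumes "trilinear_map A B B A H" "x \<in> carr A" "b \<in> carr B" "b' \<in> carr B"
  shows "tlift B B (H x) (b \<diamond> b') = H x b b'"
  by (rule tlift_tens[OF B.vspace B.vspace vspace trilinear_mapD(8)[OF assms(1,2)] assms(3,4)])

lemma comult_act:
  assumes H: "trilinear_map A B B A H"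
    and cH: "\<And>x b b'. x \<in> carr A \<Longrightarrow> b \<in> carr B \<Longrightarrow> b' \<in> carr B \<Longrightarrow> comult A (H x b b') =
      sw2 A (\<lambda>x1 x2. sw2 B (\<lambda>b1 b2. sw2 B (\<lambda>b1' b2'. H x1 b1 b1' \<otimes> H x2 b2 b2') b') b) x"
    and x: "x \<in> carr A" and \<delta>: "\<delta> \<in> carr BB.T"
  shows "comult A (tlift B B (H x) \<delta>) =
    sw2 A (\<lambda>x1 x2. sw2 BB.T (\<lambda>\<delta>1 \<delta>2. tlift B B (H x1) \<delta>1 \<otimes> tlift B B (H x2) \<delta>2) \<delta>) x"
proof -
  let ?G = "\<lambda>x. tlift B B (H x)"
  note G = act_bilinear[OF H]
  note [simp] = bilinear_mapD(1-5)[OF G, unfolded BB.T_simps]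
  have bil: "bilinear_map BB.T BB.T (tensor A A) (\<lambda>\<delta>1 \<delta>2. ?G x1 \<delta>1 \<otimes> ?G x2 \<delta>2)"
    if "x1 \<in> carr A" "x2 \<in> carr A" for x1 x2
    using that by (intro bilinear_mapI) simp_all
  have \<delta>': "\<delta> \<in> carr (tensor B B)" using \<delta> by simp
  show ?thesis
  proof (rule BB.T_eqI[OF vspace_tensor _ _ _ \<delta>'])
    show "linear_map BB.T (tensor A A) (\<lambda>\<delta>. comult A (?G x \<delta>))"
      by (rule linear_map_comp[OF comult_linear bilinear_mapD(6)[OF G x]])
    show "linear_map BB.T (tensor A A) (\<lambda>\<delta>. sw2 A (\<lambda>x1 x2. sw2 BB.T (\<lambda>\<delta>1 \<delta>2. ?G x1 \<delta>1 \<otimes> ?G x2 \<delta>2) \<delta>) x)"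
      by (intro linear_map_sw2_body[OF vspace_tensor x] BB.T.sw2_linear[OF vspace_tensor] bil)
    fix b b' assume b: "b \<in> carr B" and b': "b' \<in> carr B"
    have "comult A (?G x (b \<diamond> b')) =
        sw2 A (\<lambda>x1 x2. sw2 B (\<lambda>b1 b2. sw2 B (\<lambda>b1' b2'. ?G x1 (b1 \<diamond> b1') \<otimes> ?G x2 (b2 \<diamond> b2')) b') b) x"
      unfolding act_tens[OF H x b b'] cH[OF x b b']
      by (rule sw2_cong[OF x], rule B.sw2_cong[OF b], rule B.sw2_cong[OF b']) (simp add: act_tens[OF H])
    also have "\<dots> = sw2 A (\<lambda>x1 x2. sw2 BB.T (\<lambda>\<delta>1 \<delta>2. ?G x1 \<delta>1 \<otimes> ?G x2 \<delta>2) (b \<diamond> b')) x"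
      by (rule sw2_cong[OF x], rule BB.sw2_T_tens[OF vspace_tensor bil b b', symmetric])
    finally show "comult A (?G x (b \<diamond> b')) =
      sw2 A (\<lambda>x1 x2. sw2 BB.T (\<lambda>\<delta>1 \<delta>2. ?G x1 \<delta>1 \<otimes> ?G x2 \<delta>2) (b \<diamond> b')) x" .
  qed
qed

lemma right_trilinear: "trilinear_map A B B A (\<lambda>x b b'. (x \<odot> z b) \<odot> z b')"
  and middle_trilinear: "trilinear_map A B B A (\<lambda>x b b'. z b \<odot> (x \<odot> z b'))"
  by (rule trilinear_mapI; simp)+

lemmas right_act_tens = act_tens[OF right_trilinear, folded right_act_def]
lemmas middle_act_tens = act_tens[OF middle_trilinear, folded middle_act_def]
lemmas right_act_bilinear = act_bilinear[OF right_trilinear, folded right_act_def]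
lemmas middle_act_bilinear = act_bilinear[OF middle_trilinear, folded middle_act_def]

lemma comult_right_act:
  assumes "x \<in> carr A" "\<delta> \<in> carr BB.T"
  shows "comult A (right_act x \<delta>) =
    sw2 A (\<lambda>x1 x2. sw2 BB.T (\<lambda>\<delta>1 \<delta>2. right_act x1 \<delta>1 \<otimes> right_act x2 \<delta>2) \<delta>) x"
  unfolding right_act_def
proof (rule comult_act[OF right_trilinear _ assms])
  fix x b b' assume x: "x \<in> carr A" and b: "b \<in> carr B" and b': "b' \<in> carr B"
  have "comult A ((x \<odot> z b) \<odot> z b') =
      sw2 A (\<lambda>p q. sw2 A (\<lambda>r s. (p \<odot> r) \<otimes> (q \<odot> s)) (z b')) (x \<odot> z b)"
    using x b b' by (intro comult_m) simp_all
  also have "\<dots> = sw2 A (\<lambda>p q. sw2 B (\<lambda>b1' b2'. (p \<odot> z b1') \<otimes> (q \<odot> z b2')) b') (x \<odot> z b)"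
    using x b by (intro sw2_cong sw2_z[OF SQ.vspace_T _ b'] bilinear_mapI) simp_all
  also have "\<dots> = sw2 A (\<lambda>x1 x2. sw2 A (\<lambda>u v. sw2 B (\<lambda>b1' b2'.
      ((x1 \<odot> u) \<odot> z b1') \<otimes> ((x2 \<odot> v) \<odot> z b2')) b') (z b)) x"
    using b by (intro sw2_m[OF SQ.vspace_T _ x] B.bilinear_map_sw2_body[OF SQ.vspace_T b'] bilinear_mapI)
      simp_all
  also have "\<dots> = sw2 A (\<lambda>x1 x2. sw2 B (\<lambda>b1 b2. sw2 B (\<lambda>b1' b2'.
      ((x1 \<odot> z b1) \<odot> z b1') \<otimes> ((x2 \<odot> z b2) \<odot> z b2')) b') b) x"
    by (intro sw2_cong[OF x] sw2_z[OF SQ.vspace_T _ b] B.bilinear_map_sw2_body[OF SQ.vspace_T b'] bilinear_mapI)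
      simp_all
  finally show "comult A ((x \<odot> z b) \<odot> z b') = sw2 A (\<lambda>x1 x2. sw2 B (\<lambda>b1 b2. sw2 B (\<lambda>b1' b2'.
      ((x1 \<odot> z b1) \<odot> z b1') \<otimes> ((x2 \<odot> z b2) \<odot> z b2')) b') b) x" .
qed

lemma comult_middle_act:
  assumes "x \<in> carr A" "\<delta> \<in> carr BB.T"
  shows "comult A (middle_act x \<delta>) =
    sw2 A (\<lambda>x1 x2. sw2 BB.T (\<lambda>\<delta>1 \<delta>2. middle_act x1 \<delta>1 \<otimes> middle_act x2 \<delta>2) \<delta>) x"
  unfolding middle_act_def
proof (rule comult_act[OF middle_trilinear _ assms])
  fix x b b' assume x: "x \<in> carr A" and b: "b \<in> carr B" and b': "b' \<in> carr B"
  have xb: "x \<odot> z b' \<in> carr A" using x b' by simp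
  have "comult A (z b \<odot> (x \<odot> z b')) =
      sw2 A (\<lambda>r s. sw2 A (\<lambda>p q. (r \<odot> p) \<otimes> (s \<odot> q)) (x \<odot> z b')) (z b)"
    using x b b' by (intro comult_m) simp_all
  also have "\<dots> = sw2 B (\<lambda>b1 b2. sw2 A (\<lambda>p q. (z b1 \<odot> p) \<otimes> (z b2 \<odot> q)) (x \<odot> z b')) b"
    by (intro sw2_z[OF SQ.vspace_T _ b] bilinear_map_sw2_body[OF SQ.vspace_T xb] bilinear_mapI) simp_all
  also have "\<dots> = sw2 B (\<lambda>b1 b2. sw2 A (\<lambda>x1 x2. sw2 A (\<lambda>u v.
      (z b1 \<odot> (x1 \<odot> u)) \<otimes> (z b2 \<odot> (x2 \<odot> v))) (z b')) x) b"
    using b' by (intro B.sw2_cong[OF b] sw2_m[OF SQ.vspace_T _ x] bilinear_mapI) simp_all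
  also have "\<dots> = sw2 B (\<lambda>b1 b2. sw2 A (\<lambda>x1 x2. sw2 B (\<lambda>b1' b2'.
      (z b1 \<odot> (x1 \<odot> z b1')) \<otimes> (z b2 \<odot> (x2 \<odot> z b2'))) b') x) b"
    by (intro B.sw2_cong[OF b] sw2_cong[OF x] sw2_z[OF SQ.vspace_T _ b'] bilinear_mapI) simp_all
  also have "\<dots> = sw2 A (\<lambda>x1 x2. sw2 B (\<lambda>b1 b2. sw2 B (\<lambda>b1' b2'.
      (z b1 \<odot> (x1 \<odot> z b1')) \<otimes> (z b2 \<odot> (x2 \<odot> z b2'))) b') b) x"
    by (rule sw2_exchange)
  finally show "comult A (z b \<odot> (x \<odot> z b')) = sw2 A (\<lambda>x1 x2. sw2 B (\<lambda>b1 b2. sw2 B (\<lambda>b1' b2'.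
      (z b1 \<odot> (x1 \<odot> z b1')) \<otimes> (z b2 \<odot> (x2 \<odot> z b2'))) b') b) x" .
qed

lemma \<mu>_tens: "b \<in> carr B \<Longrightarrow> b' \<in> carr B \<Longrightarrow> \<mu> (b \<diamond> b') = z b \<odot> z b'"
  by (simp add: right_act_tens)

lemma \<mu>_coalg_hom: "coalg_hom BB.T A \<mu>"
  unfolding coalg_hom_def
proof (intro conjI ballI)
  show lin: "linear_map BB.T A \<mu>" by (rule bilinear_mapD(6)[OF right_act_bilinear one_mem])
  note [simp] = bilinear_mapD(1-5)[OF right_act_bilinear, unfolded BB.T_simps]
  fix \<delta> assume \<delta>: "\<delta> \<in> carr BB.T"
  have "comult A (\<mu> \<delta>) =
      sw2 A (\<lambda>x1 x2. sw2 BB.T (\<lambda>\<delta>1 \<delta>2. right_act x1 \<delta>1 \<otimes> right_act x2 \<delta>2) \<delta>) one"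
    by (rule comult_right_act[OF one_mem \<delta>])
  also have "\<dots> = sw2 BB.T (\<lambda>\<delta>1 \<delta>2. \<mu> \<delta>1 \<otimes> \<mu> \<delta>2) \<delta>"
    by (intro sw2_one[OF SQ.vspace_T] BB.T.bilinear_map_sw2_body[OF SQ.vspace_T \<delta>] bilinear_mapI) simp_all
  finally show "comult A (\<mu> \<delta>) = sw2 BB.T (\<lambda>\<delta>1 \<delta>2. \<mu> \<delta>1 \<otimes> \<mu> \<delta>2) \<delta>" .
  have eps: "linear_map A ground (counit A)" using coalgebra by (simp add: coalgebra_def)
  show "counit A (\<mu> \<delta>) = counit BB.T \<delta>"
    by (rule BB.T_eqI[OF SQ.vspace_ground linear_map_comp[OF eps lin] BB.counit_T_linear])
      (use \<delta> in \<open>simp_all add: \<mu>_tens\<close>)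
qed

text \<open>The reason is that \<open>0\<close> is multiplicative. Hence the coproduct of \<open>\<mu>(\<delta>)\<close> lies in the fibre square,
  and \<open>\<mu>(\<delta>)\<close> is fixed by \<open>\<pi>\<close> followed by \<open>0\<close>.\<close>
lemma \<mu>_in_base: "\<delta> \<in> carr BB.T \<Longrightarrow> \<exists>b\<in>carr B. \<mu> \<delta> = z b"
proof -
  assume \<delta>: "\<delta> \<in> carr BB.T"
  have n': "linear_map BB.T B (tlift B B n)"
    unfolding BB.linear_T by (rule tlift_linear[OF B.vspace B.vspace B.vspace n])
  have "\<mu> \<delta> = z (tlift B B n \<delta>)"
    by (rule BB.T_eqI[OF vspace coalg_homD(1)[OF \<mu>_coalg_hom] linear_map_comp[OF coalg_homD(1)[OF z] n']])
      (use \<delta> in \<open>simp_all add: \<mu>_tens z_n tlift_tens[OF B.vspace B.vspace B.vspace n]\<close>)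
  then show ?thesis using linear_mapD(1)[OF n' \<delta>] by blast
qed

sublocale R: morphism_quotient A m one d BB.T \<mu> right_act
  by unfold_locales (rule \<mu>_coalg_hom right_act_bilinear comult_right_act; assumption?)+

sublocale S: morphism_quotient A m one d BB.T \<mu> middle_act
  by unfold_locales (rule \<mu>_coalg_hom middle_act_bilinear comult_middle_act; assumption?)+

lemma z_\<pi>_linear: "linear_map A A (\<lambda>u. z (\<pi> u))"
  by (rule linear_map_comp[OF coalg_homD(1)[OF z] coalg_homD(1)[OF \<pi>]])

lemma z_\<pi>_act:
  assumes "x \<in> K" "\<delta> \<in> carr BB.T"
  shows "z (\<pi> (right_act x \<delta>)) = smult A (counit A x) (\<mu> \<delta>)"
    "z (\<pi> (middle_act x \<delta>)) = smult A (counit A x) (\<mu> \<delta>)"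
proof -
  note x = K_mem[OF assms(1)]
  have lin: "linear_map BB.T A (\<lambda>\<delta>. smult A (counit A x) (\<mu> \<delta>))"
    using linear_mapD[OF coalg_homD(1)[OF \<mu>_coalg_hom], unfolded BB.T_simps]
    by (intro linear_mapI) (simp_all add: smult_simps[OF vspace] mult.commute)
  note [simp] = \<pi>_m z_n z_\<pi>_K[OF assms(1)] bilinear_mapD(1)[OF n] x
  have \<delta>: "\<delta> \<in> carr (tensor B B)" using assms(2) by simp
  show "z (\<pi> (right_act x \<delta>)) = smult A (counit A x) (\<mu> \<delta>)"
    by (rule BB.T_eqI[OF vspace linear_map_comp[OF z_\<pi>_linear bilinear_mapD(6)[OF right_act_bilinear x]] lin _ \<delta>])
      (simp add: right_act_tens)
  show "z (\<pi> (middle_act x \<delta>)) = smult A (counit A x) (\<mu> \<delta>)"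
    by (rule BB.T_eqI[OF vspace linear_map_comp[OF z_\<pi>_linear bilinear_mapD(6)[OF middle_act_bilinear x]] lin _ \<delta>])
      (simp add: right_act_tens middle_act_tens)
qed

lemma quotients_mem_K:
  assumes "x \<in> K" "\<delta> \<in> carr BB.T"
  shows "R.Q x \<delta> \<in> K" "S.Q x \<delta> \<in> K"
proof -
  have zm: "z (\<pi> (u \<odot> v)) = z (\<pi> u) \<odot> z (\<pi> v)" if "u \<in> carr A" "v \<in> carr A" for u v
    using that by (simp add: \<pi>_m z_n)
  have \<mu>: "z (\<pi> (\<mu> \<delta>)) = \<mu> \<delta>" if "\<delta> \<in> carr BB.T" for \<delta>
    using \<mu>_in_base[OF that] by auto
  show "R.Q x \<delta> \<in> K"
    by (rule R.Q_mem_kernel[OF B.vspace coalg_homD(1)[OF \<pi>] z_\<pi>_linear zm _ _ \<mu> z_\<pi>_act(1) refl assms])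
      simp_all
  show "S.Q x \<delta> \<in> K"
    by (rule S.Q_mem_kernel[OF B.vspace coalg_homD(1)[OF \<pi>] z_\<pi>_linear zm _ _ \<mu> z_\<pi>_act(2) refl assms])
      simp_all
qed

lemma quotient_tens:
  assumes "x \<in> carr A" "b \<in> carr B" "b' \<in> carr B"
  shows "R.Q x (b \<diamond> b') = sw2 B (\<lambda>b1 b2. sw2 B (\<lambda>b1' b2'.
      ((x \<odot> z b1) \<odot> z b1') \<oslash> (z b2 \<odot> z b2')) b') b"
    "S.Q x (b \<diamond> b') = sw2 B (\<lambda>b1 b2. sw2 B (\<lambda>b1' b2'.
      (z b1 \<odot> (x \<odot> z b1')) \<oslash> (z b2 \<odot> z b2')) b') b"
proof -
  have gen: "sw2 BB.T (\<lambda>p q. g p \<oslash> \<mu> q) (b \<diamond> b') = sw2 B (\<lambda>b1 b2. sw2 B (\<lambda>b1' b2'.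
      g (b1 \<diamond> b1') \<oslash> (z b2 \<odot> z b2')) b') b" if g: "linear_map BB.T A g" for g
  proof -
    note [simp] = R.\<mu>_simps[unfolded BB.T_simps] linear_mapD[OF g, unfolded BB.T_simps]
    have "sw2 BB.T (\<lambda>p q. g p \<oslash> \<mu> q) (b \<diamond> b') = sw2 B (\<lambda>b1 b2. sw2 B (\<lambda>b1' b2'.
        g (b1 \<diamond> b1') \<oslash> \<mu> (b2 \<diamond> b2')) b') b"
      by (rule BB.sw2_T_tens[OF vspace _ assms(2,3)], rule bilinear_mapI) simp_all
    also have "\<dots> = sw2 B (\<lambda>b1 b2. sw2 B (\<lambda>b1' b2'. g (b1 \<diamond> b1') \<oslash> (z b2 \<odot> z b2')) b') b"
      by (rule B.sw2_cong[OF assms(2)], rule B.sw2_cong[OF assms(3)]) (simp add: right_act_tens)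
    finally show ?thesis .
  qed
  note cong = B.sw2_cong[OF assms(2)] B.sw2_cong[OF assms(3)]
  show "R.Q x (b \<diamond> b') = sw2 B (\<lambda>b1 b2. sw2 B (\<lambda>b1' b2'.
      ((x \<odot> z b1) \<odot> z b1') \<oslash> (z b2 \<odot> z b2')) b') b"
    unfolding R.Q_def gen[OF bilinear_mapD(6)[OF right_act_bilinear assms(1)]]
    by (rule cong(1), rule cong(2)) (simp add: assms right_act_tens)
  show "S.Q x (b \<diamond> b') = sw2 B (\<lambda>b1 b2. sw2 B (\<lambda>b1' b2'.
      (z b1 \<odot> (x \<odot> z b1')) \<oslash> (z b2 \<odot> z b2')) b') b"
    unfolding S.Q_def gen[OF bilinear_mapD(6)[OF middle_act_bilinear assms(1)]]
    by (rule cong(1), rule cong(2)) (simp add: assms middle_act_tens)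
qed

text \<open>The analogue of \<open>(xb, b)(b', x'b') = ((xb)b', b(x'b'))\<close>: the two factors on the left are
  \<open>\<Sum>xb\<^sub>(\<^sub>1\<^sub>) \<otimes> b\<^sub>(\<^sub>2\<^sub>)\<close> and \<open>\<Sum>b'\<^sub>(\<^sub>1\<^sub>) \<otimes> x'b'\<^sub>(\<^sub>2\<^sub>)\<close>.\<close>
lemma star_as_acts:
  assumes x: "x \<in> carr A" "x' \<in> carr A" and b: "b \<in> carr B" "b' \<in> carr B"
  shows "((x \<otimes> one) \<star> comult A (z b)) \<star> ((one \<otimes> x') \<star> comult A (z b')) =
    sw2 BB.T (\<lambda>\<delta>1 \<delta>2. right_act x \<delta>1 \<otimes> middle_act x' \<delta>2) (b \<diamond> b')"
proof -
  note [simp] = R.G_simps[unfolded BB.T_simps] S.G_simps[unfolded BB.T_simps]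
  have pull: "s \<star> sw2 B f c = sw2 B (\<lambda>p q. s \<star> f p q) c" "sw2 B f c \<star> s = sw2 B (\<lambda>p q. f p q \<star> s) c"
    if "s \<in> carr (tensor A A)" "c \<in> carr B"
      "\<And>p q. p \<in> carr B \<Longrightarrow> q \<in> carr B \<Longrightarrow> f p q \<in> carr (tensor A A)" for s f c
    using that
    by (auto intro!: B.linear_sw2[OF SQ.vspace_T SQ.vspace_T] bilinear_mapD(6,7)[OF star_bilinear])
  have 1: "(x \<otimes> one) \<star> comult A (z b) = sw2 B (\<lambda>b1 b2. (x \<odot> z b1) \<otimes> z b2) b"
    unfolding coalg_homD(6)[OF z b(1)]
    by (subst pull(1)) (use x b in \<open>simp_all\<close>, (intro B.sw2_cong; simp)?)
  have 2: "(one \<otimes> x') \<star> comult A (z b') = sw2 B (\<lambda>b1 b2. z b1 \<otimes> (x' \<odot> z b2)) b'"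
    unfolding coalg_homD(6)[OF z b(2)]
    by (subst pull(1)) (use x b in \<open>simp_all\<close>, (intro B.sw2_cong; simp)?)
  have mem: "sw2 B (\<lambda>b1 b2. z b1 \<otimes> (x' \<odot> z b2)) b' \<in> carr (tensor A A)"
    by (rule B.sw2_mem[OF vspace_tensor b(2)]) (simp add: x)
  have "((x \<otimes> one) \<star> comult A (z b)) \<star> ((one \<otimes> x') \<star> comult A (z b')) =
      sw2 B (\<lambda>b1 b2. ((x \<odot> z b1) \<otimes> z b2) \<star> sw2 B (\<lambda>b1' b2'. z b1' \<otimes> (x' \<odot> z b2')) b') b"
    unfolding 1 2 by (rule pull(2)[OF mem b(1)]) (simp add: x)
  also have "\<dots> = sw2 B (\<lambda>b1 b2. sw2 B (\<lambda>b1' b2'.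
      ((x \<odot> z b1) \<otimes> z b2) \<star> (z b1' \<otimes> (x' \<odot> z b2'))) b') b"
    by (rule B.sw2_cong[OF b(1)], rule pull(1)[OF _ b(2)]) (simp_all add: x)
  also have "\<dots> = sw2 B (\<lambda>b1 b2. sw2 B (\<lambda>b1' b2'.
      right_act x (b1 \<diamond> b1') \<otimes> middle_act x' (b2 \<diamond> b2')) b') b"
    by (rule B.sw2_cong[OF b(1)], rule B.sw2_cong[OF b(2)])
      (simp add: x right_act_tens middle_act_tens)
  also have "\<dots> = sw2 BB.T (\<lambda>\<delta>1 \<delta>2. right_act x \<delta>1 \<otimes> middle_act x' \<delta>2) (b \<diamond> b')"
    using x b by (intro BB.sw2_T_tens[OF SQ.vspace_T, symmetric] bilinear_mapI) (simp_all del: plus_fun_apply)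
  finally show ?thesis .
qed

text \<open>The analogue of \<open>((r x)(bb'), (s x')(bb')) = (r x, s x')(bb', bb')\<close>. Writing both components as
  products leaves four coproduct factors of \<open>\<delta>\<close>, of which the inner two have to be exchanged.\<close>
lemma acts_as_star:
  assumes x: "x \<in> carr A" "x' \<in> carr A" and \<delta>: "\<delta> \<in> carr BB.T"
  shows "sw2 BB.T (\<lambda>\<delta>1 \<delta>2. right_act x \<delta>1 \<otimes> middle_act x' \<delta>2) \<delta> =
    sw2 BB.T (\<lambda>p q. sw2 BB.T (\<lambda>\<delta>1 \<delta>2. R.Q x \<delta>1 \<otimes> S.Q x' \<delta>2) p \<star> comult A (\<mu> q)) \<delta>"
proof -
  note [simp] = R.Q_simps S.Q_simps R.\<mu>_simps R.G_simps S.G_simps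
  note [simp del] = BB.T_simps
  have mem: "sw2 BB.T f p \<in> carr SQ.T"
    if "p \<in> carr BB.T" "\<And>a b. a \<in> carr BB.T \<Longrightarrow> b \<in> carr BB.T \<Longrightarrow> f a b \<in> carr SQ.T" for f p
    by (rule BB.T.sw2_mem[OF SQ.vspace_T that])
  have lin: "h (sw2 BB.T f p) = sw2 BB.T (\<lambda>a b. h (f a b)) p"
    if "linear_map E SQ.T h" "vspace E" "p \<in> carr BB.T"
      "\<And>a b. a \<in> carr BB.T \<Longrightarrow> b \<in> carr BB.T \<Longrightarrow> f a b \<in> carr E"
    for h f p and E :: "('k, 'e::ab_group_add, 'f) vspace_scheme"
    using that by (intro BB.T.linear_sw2[OF _ SQ.vspace_T]) auto
  have t1: "linear_map A SQ.T (\<lambda>u. u \<otimes> v)" and t2: "linear_map A SQ.T (\<lambda>u. v \<otimes> u)" if "v \<in> carr A" for v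
    using that by (auto intro!: linear_mapI)
  have "sw2 BB.T (\<lambda>\<delta>1 \<delta>2. right_act x \<delta>1 \<otimes> middle_act x' \<delta>2) \<delta> =
      sw2 BB.T (\<lambda>p q. sw2 BB.T (\<lambda>a c. sw2 BB.T (\<lambda>b e. (R.Q x a \<odot> \<mu> c) \<otimes> (S.Q x' b \<odot> \<mu> e)) q) p) \<delta>"
  proof (rule BB.T.sw2_cong[OF \<delta>])
    fix p q assume p: "p \<in> carr BB.T" and q: "q \<in> carr BB.T"
    have "right_act x p \<otimes> middle_act x' q = sw2 BB.T (\<lambda>a c. (R.Q x a \<odot> \<mu> c) \<otimes> middle_act x' q) p"
      unfolding R.G_eq_Q[OF x(1) p] by (rule lin[OF t1 vspace p]) (simp_all add: x p q)
    also have "\<dots> = sw2 BB.T (\<lambda>a c. sw2 BB.T (\<lambda>b e. (R.Q x a \<odot> \<mu> c) \<otimes> (S.Q x' b \<odot> \<mu> e)) q) p"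
      unfolding S.G_eq_Q[OF x(2) q]
      by (rule BB.T.sw2_cong[OF p], rule lin[OF t2 vspace q]) (simp_all add: x)
    finally show "right_act x p \<otimes> middle_act x' q =
      sw2 BB.T (\<lambda>a c. sw2 BB.T (\<lambda>b e. (R.Q x a \<odot> \<mu> c) \<otimes> (S.Q x' b \<odot> \<mu> e)) q) p" .
  qed
  also have "\<dots> = sw2 BB.T (\<lambda>p q. sw2 BB.T (\<lambda>a b. sw2 BB.T (\<lambda>c e. (R.Q x a \<odot> \<mu> c) \<otimes> (S.Q x' b \<odot> \<mu> e)) q) p) \<delta>"
    by (rule BB.T.middle_exchange[OF SQ.vspace_T _ \<delta>])
      (auto simp: quadrilinear_map_def x intro!: trilinear_mapI linear_mapI)
  also have "\<dots> = sw2 BB.T (\<lambda>p q. sw2 BB.T (\<lambda>a b. (R.Q x a \<otimes> S.Q x' b) \<star> comult A (\<mu> q)) p) \<delta>"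
  proof (rule BB.T.sw2_cong[OF \<delta>], rule BB.T.sw2_cong)
    fix p q a b assume *: "p \<in> carr BB.T" "q \<in> carr BB.T" "a \<in> carr BB.T" "b \<in> carr BB.T"
    have ab: "R.Q x a \<otimes> S.Q x' b \<in> carr SQ.T" using * x by simp
    have "(R.Q x a \<otimes> S.Q x' b) \<star> comult A (\<mu> q) = sw2 BB.T (\<lambda>c e. (R.Q x a \<otimes> S.Q x' b) \<star> (\<mu> c \<otimes> \<mu> e)) q"
      unfolding coalg_homD(6)[OF \<mu>_coalg_hom *(2)]
      by (rule lin[OF bilinear_mapD(6)[OF star_bilinear ab] SQ.vspace_T *(2)]) simp
    also have "\<dots> = sw2 BB.T (\<lambda>c e. (R.Q x a \<odot> \<mu> c) \<otimes> (S.Q x' b \<odot> \<mu> e)) q"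
      by (rule BB.T.sw2_cong[OF *(2)]) (simp add: x *)
    finally show "sw2 BB.T (\<lambda>c e. (R.Q x a \<odot> \<mu> c) \<otimes> (S.Q x' b \<odot> \<mu> e)) q =
      (R.Q x a \<otimes> S.Q x' b) \<star> comult A (\<mu> q)" ..
  qed
  also have "\<dots> = sw2 BB.T (\<lambda>p q. sw2 BB.T (\<lambda>a b. R.Q x a \<otimes> S.Q x' b) p \<star> comult A (\<mu> q)) \<delta>"
  proof (rule BB.T.sw2_cong[OF \<delta>])
    fix p q assume *: "p \<in> carr BB.T" "q \<in> carr BB.T"
    have c: "comult A (\<mu> q) \<in> carr SQ.T" using * by simp
    show "sw2 BB.T (\<lambda>a b. (R.Q x a \<otimes> S.Q x' b) \<star> comult A (\<mu> q)) p =
      sw2 BB.T (\<lambda>a b. R.Q x a \<otimes> S.Q x' b) p \<star> comult A (\<mu> q)"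
      by (rule lin[OF bilinear_mapD(7)[OF star_bilinear c] SQ.vspace_T *(1), symmetric]) (simp add: x)
  qed
  finally show ?thesis .
qed

lemma formula_trilinear:
  assumes "x \<in> carr A" "x' \<in> carr A"
  shows "trilinear_map BB.T BB.T BB.T A (\<lambda>\<delta>1 \<delta>2 \<delta>3. (R.Q x \<delta>1 \<odot> S.Q x' \<delta>2) \<odot> \<mu> \<delta>3)"
  using assms R.Q_simps S.Q_simps R.\<mu>_simps by (intro trilinear_mapI) (simp_all del: BB.T_simps)

text \<open>The value of \<open>pl\<close> at the tensor of the previous two lemmas can be computed in two ways,
  because \<open>pl\<close> is multiplicative for both of its factorizations. The first gives the left-hand side,
  the second the right-hand side.\<close>
lemma product_formula:
  assumes x: "x \<in> K" and x': "x' \<in> K" and b: "b \<in> carr B" and b': "b' \<in> carr B"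
  shows "(x \<odot> z b) \<odot> (x' \<odot> z b') =
    sw3 BB.T (\<lambda>\<delta>1 \<delta>2 \<delta>3. (R.Q x \<delta>1 \<odot> S.Q x' \<delta>2) \<odot> \<mu> \<delta>3) (b \<diamond> b')"
proof -
  let ?\<delta> = "b \<diamond> b'"
  have \<delta>: "?\<delta> \<in> carr BB.T" using b b' by simp
  note xA = K_mem[OF x] K_mem[OF x']
  note [simp] = R.Q_simps S.Q_simps R.\<mu>_simps xA
  note [simp del] = BB.T_simps
  let ?P = "SQ.T\<lparr>carr := P\<rparr>"
  have vP: "vspace ?P" by (rule subcoalgebraD(2)[OF P_subcoalgebra SQ.vspace_T])
  have pl_sum: "pl (sw2 BB.T f p) = sw2 BB.T (\<lambda>a c. pl (f a c)) p"
    and P_sum: "sw2 BB.T f p \<in> P"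
    if "p \<in> carr BB.T" "\<And>a c. a \<in> carr BB.T \<Longrightarrow> c \<in> carr BB.T \<Longrightarrow> f a c \<in> P" for f p
    using BB.T.linear_sw2[OF vP vspace pl that(1), of f] BB.T.sw2_mem[OF vP that(1), of f] that(2) by auto
  have QQ: "R.Q x a \<otimes> S.Q x' c \<in> P" "pl (R.Q x a \<otimes> S.Q x' c) = R.Q x a \<odot> S.Q x' c"
    if "a \<in> carr BB.T" "c \<in> carr BB.T" for a c
    using that quotients_mem_K x x' by (auto intro: tens_mem_P pl_tens)
  have \<mu>: "comult A (\<mu> q) \<in> P" "pl (comult A (\<mu> q)) = \<mu> q" if "q \<in> carr BB.T" for q
    using \<mu>_in_base[OF that] comult_z_mem_P pl_comult_z by auto
  have l: "(x \<otimes> one) \<star> comult A (z b) \<in> P" "pl ((x \<otimes> one) \<star> comult A (z b)) = x \<odot> z b"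
    and r: "(one \<otimes> x') \<star> comult A (z b') \<in> P" "pl ((one \<otimes> x') \<star> comult A (z b')) = x' \<odot> z b'"
    using x x' b b' tens_mem_P[OF x one_mem_K] tens_mem_P[OF one_mem_K x'] comult_z_mem_P
    by (simp_all add: P_star pl_star pl_tens_one pl_one_tens pl_comult_z)
  have "(x \<odot> z b) \<odot> (x' \<odot> z b') = pl (((x \<otimes> one) \<star> comult A (z b)) \<star> ((one \<otimes> x') \<star> comult A (z b')))"
    using pl_star[OF l(1) r(1)] l(2) r(2) by simp
  also have "\<dots> = pl (sw2 BB.T (\<lambda>p q. sw2 BB.T (\<lambda>\<delta>1 \<delta>2. R.Q x \<delta>1 \<otimes> S.Q x' \<delta>2) p \<star> comult A (\<mu> q)) ?\<delta>)"
    unfolding star_as_acts[OF xA b b'] acts_as_star[OF xA \<delta>] ..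
  also have "\<dots> = sw2 BB.T (\<lambda>p q. pl (sw2 BB.T (\<lambda>\<delta>1 \<delta>2. R.Q x \<delta>1 \<otimes> S.Q x' \<delta>2) p \<star> comult A (\<mu> q))) ?\<delta>"
    by (rule pl_sum[OF \<delta>], rule P_star[OF P_sum \<mu>(1)], assumption, rule QQ(1))
  also have "\<dots> = sw2 BB.T (\<lambda>p q. sw2 BB.T (\<lambda>\<delta>1 \<delta>2. (R.Q x \<delta>1 \<odot> S.Q x' \<delta>2) \<odot> \<mu> q) p) ?\<delta>"
  proof (rule BB.T.sw2_cong[OF \<delta>])
    fix p q assume p: "p \<in> carr BB.T" and q: "q \<in> carr BB.T"
    have \<mu>q: "\<mu> q \<in> carr A" using q by simp
    have "pl (sw2 BB.T (\<lambda>\<delta>1 \<delta>2. R.Q x \<delta>1 \<otimes> S.Q x' \<delta>2) p \<star> comult A (\<mu> q)) =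
        pl (sw2 BB.T (\<lambda>\<delta>1 \<delta>2. R.Q x \<delta>1 \<otimes> S.Q x' \<delta>2) p) \<odot> \<mu> q"
      using pl_star[OF P_sum[OF p QQ(1)] \<mu>(1)[OF q]] \<mu>(2)[OF q] by simp
    also have "pl (sw2 BB.T (\<lambda>\<delta>1 \<delta>2. R.Q x \<delta>1 \<otimes> S.Q x' \<delta>2) p) = sw2 BB.T (\<lambda>\<delta>1 \<delta>2. R.Q x \<delta>1 \<odot> S.Q x' \<delta>2) p"
      by (subst pl_sum[OF p QQ(1)], assumption+, rule BB.T.sw2_cong[OF p], rule QQ(2))
    also have "\<dots> \<odot> \<mu> q = sw2 BB.T (\<lambda>\<delta>1 \<delta>2. (R.Q x \<delta>1 \<odot> S.Q x' \<delta>2) \<odot> \<mu> q) p"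
      by (rule BB.T.linear_sw2[OF vspace vspace bilinear_mapD(7)[OF m_bilinear \<mu>q] p]) simp
    finally show "pl (sw2 BB.T (\<lambda>\<delta>1 \<delta>2. R.Q x \<delta>1 \<otimes> S.Q x' \<delta>2) p \<star> comult A (\<mu> q)) =
      sw2 BB.T (\<lambda>\<delta>1 \<delta>2. (R.Q x \<delta>1 \<odot> S.Q x' \<delta>2) \<odot> \<mu> q) p" .
  qed
  also have "\<dots> = sw3 BB.T (\<lambda>\<delta>1 \<delta>2 \<delta>3. (R.Q x \<delta>1 \<odot> S.Q x' \<delta>2) \<odot> \<mu> \<delta>3) ?\<delta>"
    unfolding sw3_def by (rule BB.T.coassoc[OF vspace formula_trilinear[OF xA] \<delta>])
  finally show ?thesis .
qed

end

section \<open>Abelian group objects\<close>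

lemma kernel_eq_equalizer:
  "\<pi> (bunit A) = bunit B \<Longrightarrow> kernel A B \<pi> = equalizer A \<pi> (\<lambda>c. smult B (counit A c) (\<pi> (bunit A)))"
  by (simp add: kernel_def equalizer_def)

lemma carr_fibre_product:
  "carr (fibre_product B A \<pi> A \<pi>) = fibre_square A B \<pi>"
proof -
  have "subcoalgebra (tensor_bialg A A) S \<longleftrightarrow> subcoalgebra (tensor_coalg A A) S" for S
  proof -
    have "tensor (tensor_bialg A A\<lparr>carr := S\<rparr>) (tensor_bialg A A\<lparr>carr := S\<rparr>) =
        tensor (tensor_coalg A A\<lparr>carr := S\<rparr>) (tensor_coalg A A\<lparr>carr := S\<rparr>)"
      by (rule tensor_cong) (simp_all add: tensor_bialg_def)
    then show ?thesis unfolding subcoalgebra_def by (simp add: tensor_bialg_def)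
  qed
  then show ?thesis
    by (simp add: fibre_product_def fibre_square_def equalizer_def on_left_def on_right_def
        left_proj_def right_proj_def tensor_coalg_def)
qed

text \<open>Since \<open>pl\<close> is a homomorphism on the fibre square, it is one for the reversed products as well, whose
  right division is the left division with its arguments swapped.\<close>
lemma abelian_group_object_addition_over:
  assumes B: "IBialg B" and ab: "abelian_group_object B A \<pi> pl mi z"
  shows "addition_over A (bmult A) (bunit A) (rdiv A) B (bmult B) \<pi> z pl"
    and "addition_over A (\<lambda>u v. bmult A v u) (bunit A) (\<lambda>v u. ldiv A u v) B (\<lambda>u v. bmult B v u) \<pi> z pl"
proof -
  let ?P = "fibre_product B A \<pi> A \<pi>"
  have IA: "IBialg A" and \<pi>: "bialg_hom A B \<pi>" and pl: "bialg_hom ?P A pl" and z: "bialg_hom B A z"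
    and \<pi>_z: "\<And>b. b \<in> carr B \<Longrightarrow> \<pi> (z b) = b"
    and comm: "\<And>t. t \<in> carr ?P \<Longrightarrow> pl (pairing ?P A A (on_right A A A id) (on_left A A A id) t) = pl t"
    and unit: "\<And>a. a \<in> carr A \<Longrightarrow> pl (pairing A A A (\<lambda>c. z (\<pi> c)) id a) = a"
    using ab by (simp_all add: abelian_group_object_def Let_def)
  interpret A: nonassoc_bialgebra A "bmult A" "bunit A"
    using IA by (intro unital_bialgebra_nonassoc) (simp add: IBialg_def)
  interpret Aop: nonassoc_bialgebra A "\<lambda>u v. bmult A v u" "bunit A" by (rule A.opposite)
  interpret B: nonassoc_bialgebra B "bmult B" "bunit B"
    using B by (intro unital_bialgebra_nonassoc) (simp add: IBialg_def)
  interpret right_loop_bialgebra A "bmult A" "bunit A" "rdiv A"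
    by unfold_locales (rule rdiv_divides_right[OF IA])
  interpret op: right_loop_bialgebra A "\<lambda>u v. bmult A v u" "bunit A" "\<lambda>v u. ldiv A u v"
    by unfold_locales (rule ldiv_divides_right[OF IA])
  let ?T = "tensor_coalg A A"
  have \<pi>': "coalg_hom A B \<pi>" "\<And>u v. u \<in> carr A \<Longrightarrow> v \<in> carr A \<Longrightarrow> \<pi> (bmult A u v) = bmult B (\<pi> u) (\<pi> v)"
      "\<pi> (bunit A) = bunit B"
    and z': "coalg_hom B A z" "\<And>u v. u \<in> carr B \<Longrightarrow> v \<in> carr B \<Longrightarrow> z (bmult B u v) = bmult A (z u) (z v)"
      "z (bunit B) = bunit A"
    using \<pi> z by (simp_all add: bialg_hom_def)
  have P: "carr ?P = fibre_square A B \<pi>" "smult ?P = fscale" "comult ?P = comult ?T"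
    by (rule carr_fibre_product) (simp_all add: fibre_product_def tensor_bialg_def)
  have lin: "linear_map (?T\<lparr>carr := fibre_square A B \<pi>\<rparr>) A pl"
    using pl P(1,2) by (simp add: bialg_hom_def coalg_hom_def linear_map_def)
  have star: "pl (A.star s t) = bmult A (pl s) (pl t)"
    if "s \<in> fibre_square A B \<pi>" "t \<in> fibre_square A B \<pi>" for s t
  proof -
    have "bmult ?P s t = A.star s t" by (simp add: fibre_product_def tensor_bialg_def A.star_def)
    moreover have "pl (bmult ?P s t) = bmult A (pl s) (pl t)" using pl that by (simp add: bialg_hom_def P(1))
    ultimately show ?thesis by simp
  qed
  have unit': "pl (sw2 A (\<lambda>c1 c2. tens A A (z (\<pi> c1)) c2) a) = a" if "a \<in> carr A" for a
    using unit[OF that] by (simp add: pairing_def)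
  have comm': "pl (sw2 ?T (\<lambda>s1 s2. tens A A (right_proj A A id s1) (left_proj A A id s2)) t) = pl t"
    if t: "t \<in> fibre_square A B \<pi>" for t
  proof -
    let ?F = "\<lambda>s1 s2. tens A A (right_proj A A id s1) (left_proj A A id s2)"
    have id: "linear_map A A id" by (rule linear_mapI) simp_all
    note [simp] = linear_mapD[OF A.projections(1)[OF A.vspace id], unfolded A.SQ.T_simps]
      linear_mapD[OF A.projections(2)[OF A.vspace id], unfolded A.SQ.T_simps]
    have F: "bilinear_map ?T ?T ?T ?F" by (rule bilinear_mapI) simp_all
    have sub: "subcoalgebra ?T (fibre_square A B \<pi>)"
      unfolding fibre_square_def by (rule A.SQ.T.subcoalgebra_equalizer)
    have "pairing ?P A A (on_right A A A id) (on_left A A A id) t = sw2 ?P ?F t"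
      by (simp add: pairing_def on_left_def on_right_def left_proj_def right_proj_def)
    also have "\<dots> = sw2 (?T\<lparr>carr := fibre_square A B \<pi>\<rparr>) ?F t"
    proof -
      have "smult ?P = smult (?T\<lparr>carr := fibre_square A B \<pi>\<rparr>)" "carr ?P = carr (?T\<lparr>carr := fibre_square A B \<pi>\<rparr>)"
        using P by simp_all
      note cong = tlift_cong[OF this(1,1,2,2)]
      show ?thesis by (simp add: sw2_def P(3) cong)
    qed
    also have "\<dots> = sw2 ?T ?F t" by (rule A.SQ.T.sw2_restrict[OF sub t A.SQ.vspace_T F])
    finally show ?thesis using comm[of t] t P(1) by simp
  qed
  have star': "pl (Aop.star s t) = bmult A (pl t) (pl s)"
    if "s \<in> fibre_square A B \<pi>" "t \<in> fibre_square A B \<pi>" for s t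
    unfolding star_opposite[OF A.nonassoc_bialgebra_axioms] by (rule star[OF that(2,1)])
  have bop: "bilinear_map B B B (\<lambda>u v. bmult B v u)"
    using B.m_bilinear by (auto simp: bilinear_map_def)
  have zo: "z (\<pi> (bunit A)) = bunit A" by (simp add: \<pi>'(3) z'(3))
  show "addition_over A (bmult A) (bunit A) (rdiv A) B (bmult B) \<pi> z pl"
    by unfold_locales (rule B.m_bilinear \<pi>'(1,2) z'(1,2) zo \<pi>_z lin star unit' comm'; assumption)+
  show "addition_over A (\<lambda>u v. bmult A v u) (bunit A) (\<lambda>v u. ldiv A u v) B (\<lambda>u v. bmult B v u) \<pi> z pl"
    by unfold_locales (rule bop \<pi>'(1,2) z'(1,2) zo \<pi>_z lin star' unit' comm'; assumption)+
qed

theorem proposition3p9: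
  fixes B :: "('k::field_char_0, 'b::ab_group_add) bialg"
    and A :: "('k, 'a::ab_group_add) bialg"
    and \<pi> :: "'a \<Rightarrow> 'b"
    and pl :: "('k, 'a, 'a) tensor \<Rightarrow> 'a"
    and mi :: "'a \<Rightarrow> 'a"
    and z :: "'b \<Rightarrow> 'a"
  assumes "IBialg B"
    and "abelian_group_object B A \<pi> pl mi z"
    and "x \<in> kernel A B \<pi>" and "x' \<in> kernel A B \<pi>"
    and "b \<in> carr B" and "b' \<in> carr B"
  shows "(x \<cdot>\<^bsub>A\<^esub> z b) \<cdot>\<^bsub>A\<^esub> (x' \<cdot>\<^bsub>A\<^esub> z b') =
      sw3 B (\<lambda>b1 b2 b3. sw3 B (\<lambda>b1' b2' b3'.
        (op_r B A z b1 b1' x \<cdot>\<^bsub>A\<^esub> op_s B A z b2 b2' x') \<cdot>\<^bsub>A\<^esub> (z b3 \<cdot>\<^bsub>A\<^esub> z b3')) b') b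
    \<and> (z b \<cdot>\<^bsub>A\<^esub> x) \<cdot>\<^bsub>A\<^esub> (z b' \<cdot>\<^bsub>A\<^esub> x') =
      sw3 B (\<lambda>b1 b2 b3. sw3 B (\<lambda>b1' b2' b3'.
        (z b1 \<cdot>\<^bsub>A\<^esub> z b1') \<cdot>\<^bsub>A\<^esub> (op_sbar B A z b2 b2' x \<cdot>\<^bsub>A\<^esub> op_l B A z b3 b3' x')) b') b"
proof (rule conjI, goal_cases)
  interpret E: addition_over A "bmult A" "bunit A" "rdiv A" B "bmult B" \<pi> z pl
    by (rule abelian_group_object_addition_over(1)[OF assms(1,2)])
  interpret Eop: addition_over A "\<lambda>u v. bmult A v u" "bunit A" "\<lambda>v u. ldiv A u v" B "\<lambda>u v. bmult B v u" \<pi> z pl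
    by (rule abelian_group_object_addition_over(2)[OF assms(1,2)])
  have "\<pi> (bunit A) = bunit B" using assms(2) by (simp add: abelian_group_object_def Let_def bialg_hom_def)
  then have x: "x \<in> E.K" and x': "x' \<in> E.K" using assms(3,4) kernel_eq_equalizer by metis+
  note b = assms(5,6) and xA = E.K_mem[OF x] E.K_mem[OF x']
  have r: "E.R.Q x (tens B B b b') = op_r B A z b b' x" and s: "E.S.Q x' (tens B B b b') = op_s B A z b b' x'"
    if "b \<in> carr B" "b' \<in> carr B" for b b'
    using that by (simp_all add: E.quotient_tens xA op_r_def op_s_def)
  case 1
  show ?case
    unfolding E.product_formula[OF x x' b] E.BB.sw3_T_tens[OF E.vspace E.formula_trilinear[OF xA] b]
    by (rule E.B.sw3_cong[OF b(1)], rule E.B.sw3_cong[OF b(2)]) (simp add: r s E.\<mu>_tens)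
  \<comment> \<open>The opposite instance reverses the order of \<open>b\<close> and \<open>b'\<close>, and its quotients carry the divisor on
    the coproduct factors with index 2; the operators \<open>l\<close> and \<open>s\<close>-bar carry it on those with index 1.\<close>
  have comm: "sw2 B (\<lambda>b1' b2'. sw2 B (\<lambda>b1 b2. f b2 b2' b1 b1') b) b' = sw2 B (\<lambda>b1 b2. sw2 B (\<lambda>b1' b2'. f b1 b1' b2 b2') b') b"
    if "b \<in> carr B" "b' \<in> carr B" "\<And>p q. p \<in> carr B \<Longrightarrow> q \<in> carr B \<Longrightarrow> bilinear_map B B A (\<lambda>u v. f u p v q)"
      "\<And>p q. p \<in> carr B \<Longrightarrow> q \<in> carr B \<Longrightarrow> bilinear_map B B A (\<lambda>u v. f p u q v)" for f b b'
  proof -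
    have "sw2 B (\<lambda>b1' b2'. sw2 B (\<lambda>b1 b2. f b2 b2' b1 b1') b) b' = sw2 B (\<lambda>b1' b2'. sw2 B (\<lambda>b1 b2. f b1 b2' b2 b1') b) b'"
      by (rule E.B.sw2_cong[OF that(2)], rule E.B.cocomm[OF E.vspace that(3) that(1)])
    also have "\<dots> = sw2 B (\<lambda>b1 b2. sw2 B (\<lambda>b1' b2'. f b1 b2' b2 b1') b') b" by (rule sw2_exchange)
    also have "\<dots> = sw2 B (\<lambda>b1 b2. sw2 B (\<lambda>b1' b2'. f b1 b1' b2 b2') b') b"
      by (rule E.B.sw2_cong[OF that(1)], rule E.B.cocomm[OF E.vspace that(4) that(2)])
    finally show ?thesis .
  qed
  note [simp] = bilinear_mapD(1-5)[OF Eop.d_bilinear]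
  have l: "Eop.R.Q x' (tens B B b' b) = op_l B A z b b' x'"
    and sbar: "Eop.S.Q x (tens B B b' b) = op_sbar B A z b b' x"
    if "b \<in> carr B" "b' \<in> carr B" for b b'
    unfolding Eop.quotient_tens[OF xA(1) that(2,1)] Eop.quotient_tens[OF xA(2) that(2,1)] op_l_def op_sbar_def
    by (rule comm[OF that]; (rule bilinear_mapI)?; simp add: xA)+
  case 2
  have "(z b \<cdot>\<^bsub>A\<^esub> x) \<cdot>\<^bsub>A\<^esub> (z b' \<cdot>\<^bsub>A\<^esub> x') =
      sw3 E.BB.T (\<lambda>\<delta>1 \<delta>2 \<delta>3. Eop.\<mu> \<delta>3 \<cdot>\<^bsub>A\<^esub> (Eop.S.Q x \<delta>2 \<cdot>\<^bsub>A\<^esub> Eop.R.Q x' \<delta>1)) (tens B B b' b)"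
    by (rule Eop.product_formula[OF x' x b(2,1)])
  \<comment> \<open>In the opposite formula \<open>bb'\<close> carries the last coproduct factor, in the claim the first one.\<close>
  also have "\<dots> = sw3 E.BB.T (\<lambda>\<delta>1 \<delta>2 \<delta>3. Eop.\<mu> \<delta>1 \<cdot>\<^bsub>A\<^esub> (Eop.S.Q x \<delta>2 \<cdot>\<^bsub>A\<^esub> Eop.R.Q x' \<delta>3)) (tens B B b' b)"
    by (rule E.BB.T.sw3_reverse[OF E.vspace Eop.formula_trilinear[OF xA(2,1)], symmetric]) (simp add: b)
  also have "\<dots> = sw3 B (\<lambda>b1' b2' b3'. sw3 B (\<lambda>b1 b2 b3. Eop.\<mu> (tens B B b1' b1) \<cdot>\<^bsub>A\<^esub>
      (Eop.S.Q x (tens B B b2' b2) \<cdot>\<^bsub>A\<^esub> Eop.R.Q x' (tens B B b3' b3))) b) b'"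
  proof (rule E.BB.sw3_T_tens[OF E.vspace _ b(2,1)])
    show "trilinear_map E.BB.T E.BB.T E.BB.T A (\<lambda>\<delta>1 \<delta>2 \<delta>3. Eop.\<mu> \<delta>1 \<cdot>\<^bsub>A\<^esub> (Eop.S.Q x \<delta>2 \<cdot>\<^bsub>A\<^esub> Eop.R.Q x' \<delta>3))"
      using trilinear_mapD(1-7)[OF Eop.formula_trilinear[OF xA(2,1)]] by (intro trilinear_mapI)
  qed
  also have "\<dots> = sw3 B (\<lambda>b1 b2 b3. sw3 B (\<lambda>b1' b2' b3'. Eop.\<mu> (tens B B b1' b1) \<cdot>\<^bsub>A\<^esub>
      (Eop.S.Q x (tens B B b2' b2) \<cdot>\<^bsub>A\<^esub> Eop.R.Q x' (tens B B b3' b3))) b') b"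
    by (rule sw3_exchange)
  finally show ?case
    by (rule trans) (rule E.B.sw3_cong[OF b(1)], rule E.B.sw3_cong[OF b(2)], simp add: l sbar Eop.\<mu>_tens)
qed

end
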